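(* There exist two universal constants $c,C>0$ such that the following holds. Let $X$ be a Banach space, let $1\le p,q<\infty$, and let $(\Omega,\mathscr{A},\mu)$ be a probability space with a filtration $\mathscr{A}_1\subset\mathscr{A}_2\subset\cdots\subset\mathscr{A}$ of sub-$\sigma$-algebras whose union generates $\mathscr{A}$. Then there exists a strictly increasing sequence $\{a_n\}_{n\ge0}$ with $a_0=0$ and $\lim_{n\to\infty}a_n=1$ such that the semigroup $$T^t=\sum_{n=1}^{\infty}(1-a_{n-1})^t\,dE_n=\sum_{n=1}^{\infty}\left[(1-a_{n-1})^t-(1-a_n)^t\right]E_n,\qquad t>0,$$ acting on $L_p(\Omega;X)$, satisfies, pointwise almost everywhere, $$c\,S_q(f-\mathrm{F}(f))\le G_q^T(f)\le C\,S_q(f-\mathrm{F}(f))$$ for every $f\in L_p(\Omega;X)$.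
   Context: $L_p(\Omega;X)$ is the space of strongly measurable $p$-integrable functions from $\Omega$ to $X$. A positive bounded operator $R$ on $L_p(\Omega)$ extends to $R\otimes\mathrm{Id}_X$ on $L_p(\Omega;X)$ with the same norm, still denoted by $R$. In particular $E_n(f)=E(f\mid\mathscr{A}_n)$ is the ($X$-valued) conditional expectation, $E_0=0$ by convention, $dE_n(f)=E_n(f)-E_{n-1}(f)$, and $\{T^t\}_{t>0}$ is a strongly continuous semigroup of contractions on $L_p(\Omega;X)$. For $f\in L_p(\Omega;X)$, $$S_q(f)=\Big(\sum_{n=1}^\infty\|dE_n(f)\|_X^q\Big)^{1/q},\qquad G_q^T(f)=\Big(\int_0^\infty\Big\|t\frac{\partial}{\partial t}T^t(f)\Big\|_X^q\frac{dt}{t}\Big)^{1/q}.$$ $\mathrm{F}$ denotes the projection from $L_p(\Omega;X)$ onto the fixed point subspace of $\{T^t\}_{t>0}$; here $\mathrm{F}=E_1$. *)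

theory Defs
  imports "HOL-Probability.Probability"
begin

text \<open>
  Elements of \<open>L\<^sub>p(\<Omega>;X)\<close> are represented by functions, and operators on \<open>L\<^sub>p(\<Omega>;X)\<close> by maps on
  functions; identities between elements of \<open>L\<^sub>p(\<Omega>;X)\<close> are stated almost everywhere. The Banach
  space \<open>X\<close> is an arbitrary type of class \<^class>\<open>banach\<close>. It is not assumed separable, so the
  library's Bochner integral, which is restricted to second countable types, is not used.
\<close>

definition strongly_measurable :: "'a measure \<Rightarrow> ('a \<Rightarrow> 'x::real_normed_vector) \<Rightarrow> bool" where
  "strongly_measurable M f \<longleftrightarrow>
     (\<exists>s. (\<forall>i::nat. simple_function M (s i)) \<and> (\<forall>w\<in>space M. (\<lambda>i. s i w) \<longlonglongrightarrow> f w))"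

definition ennreal_powr :: "ennreal \<Rightarrow> real \<Rightarrow> ennreal" where
  "ennreal_powr y r = (if y = \<infinity> then \<infinity> else ennreal (enn2real y powr r))"

definition Lp_norm :: "real \<Rightarrow> 'a measure \<Rightarrow> ('a \<Rightarrow> 'x::real_normed_vector) \<Rightarrow> ennreal" where
  "Lp_norm p M f = ennreal_powr (\<integral>\<^sup>+w. ennreal (norm (f w) powr p) \<partial>M) (1 / p)"

definition Lp_space :: "real \<Rightarrow> 'a measure \<Rightarrow> ('a \<Rightarrow> 'x::real_normed_vector) set" where
  "Lp_space p M = {f. strongly_measurable M f \<and> Lp_norm p M f < \<infinity>}"

definition Lp_sums ::
  "real \<Rightarrow> 'a measure \<Rightarrow> (nat \<Rightarrow> 'a \<Rightarrow> 'x::real_normed_vector) \<Rightarrow> ('a \<Rightarrow> 'x) \<Rightarrow> bool" where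
  "Lp_sums p M u g \<longleftrightarrow> (\<forall>n. u n \<in> Lp_space p M) \<and> g \<in> Lp_space p M \<and>
     (\<lambda>N. Lp_norm p M (\<lambda>w. (\<Sum>n<N. u n w) - g w)) \<longlonglongrightarrow> 0"

text \<open>
  \<open>R \<otimes> Id\<^sub>X\<close> on the step function \<open>s = \<Sum>\<^sub>y 1\<^bsub>{s = y}\<^esub> \<otimes> y\<close>, and its extension by continuity to
  \<open>L\<^sub>p(\<Omega>;X)\<close>, in which step functions are dense as \<open>p < \<infinity>\<close>.
\<close>

definition tensor_simple ::
  "'a measure \<Rightarrow> (('a \<Rightarrow> real) \<Rightarrow> 'a \<Rightarrow> real) \<Rightarrow> ('a \<Rightarrow> 'x::real_normed_vector) \<Rightarrow> 'a \<Rightarrow> 'x" where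
  "tensor_simple M R s w =
     (\<Sum>y\<in>s ` space M. R (indicator {v \<in> space M. s v = y}) w *\<^sub>R y)"

definition is_tensor_extension ::
  "real \<Rightarrow> 'a measure \<Rightarrow> (('a \<Rightarrow> real) \<Rightarrow> 'a \<Rightarrow> real) \<Rightarrow>
   ('a \<Rightarrow> 'x::real_normed_vector) \<Rightarrow> ('a \<Rightarrow> 'x) \<Rightarrow> bool" where
  "is_tensor_extension p M R f g \<longleftrightarrow> g \<in> Lp_space p M \<and>
     (\<exists>s. (\<forall>i::nat. simple_function M (s i)) \<and>
        (\<lambda>i. Lp_norm p M (\<lambda>w. s i w - f w)) \<longlonglongrightarrow> 0 \<and>
        (\<lambda>i. Lp_norm p M (\<lambda>w. tensor_simple M R (s i) w - g w)) \<longlonglongrightarrow> 0)"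

definition filtration_generating :: "'a measure \<Rightarrow> (nat \<Rightarrow> 'a measure) \<Rightarrow> bool" where
  "filtration_generating M A \<longleftrightarrow>
     (\<forall>n\<ge>1. subalgebra M (A n)) \<and>
     (\<forall>n\<ge>1. sets (A n) \<subseteq> sets (A (Suc n))) \<and>
     sets M = sigma_sets (space M) (\<Union>n\<in>{1..}. sets (A n))"

text \<open>The value \<open>A 0\<close> of the filtration is irrelevant, since \<open>E\<^sub>0 = 0\<close> by convention.\<close>

definition mart_E ::
  "real \<Rightarrow> 'a measure \<Rightarrow> (nat \<Rightarrow> 'a measure) \<Rightarrow> nat \<Rightarrow> ('a \<Rightarrow> 'x::real_normed_vector) \<Rightarrow> 'a \<Rightarrow> 'x" where
  "mart_E p M A n f =
     (if n = 0 then (\<lambda>w. 0) else (SOME g. is_tensor_extension p M (real_cond_exp M (A n)) f g))"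

definition mart_dE ::
  "real \<Rightarrow> 'a measure \<Rightarrow> (nat \<Rightarrow> 'a measure) \<Rightarrow> nat \<Rightarrow> ('a \<Rightarrow> 'x::real_normed_vector) \<Rightarrow> 'a \<Rightarrow> 'x" where
  "mart_dE p M A n f w = mart_E p M A n f w - mart_E p M A (n - 1) f w"

definition mart_S ::
  "real \<Rightarrow> real \<Rightarrow> 'a measure \<Rightarrow> (nat \<Rightarrow> 'a measure) \<Rightarrow>
   ('a \<Rightarrow> 'x::real_normed_vector) \<Rightarrow> 'a \<Rightarrow> ennreal" where
  "mart_S q p M A f w =
     ennreal_powr (\<Sum>n. ennreal (norm (mart_dE p M A (Suc n) f w) powr q)) (1 / q)"

definition mart_T ::
  "real \<Rightarrow> 'a measure \<Rightarrow> (nat \<Rightarrow> 'a measure) \<Rightarrow> (nat \<Rightarrow> real) \<Rightarrow>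
   real \<Rightarrow> ('a \<Rightarrow> 'x::real_normed_vector) \<Rightarrow> 'a \<Rightarrow> 'x" where
  "mart_T p M A a t f =
     (SOME g. Lp_sums p M (\<lambda>n w. (1 - a n) powr t *\<^sub>R mart_dE p M A (Suc n) f w) g)"

definition Lp_bounded_operator ::
  "real \<Rightarrow> 'a measure \<Rightarrow> real \<Rightarrow> (('a \<Rightarrow> 'x::real_normed_vector) \<Rightarrow> 'a \<Rightarrow> 'x) \<Rightarrow> bool" where
  "Lp_bounded_operator p M K R \<longleftrightarrow>
     (\<forall>f\<in>Lp_space p M. R f \<in> Lp_space p M \<and> Lp_norm p M (R f) \<le> ennreal K * Lp_norm p M f) \<and>
     (\<forall>f\<in>Lp_space p M. \<forall>g\<in>Lp_space p M. AE w in M. R (\<lambda>v. f v + g v) w = R f w + R g w) \<and>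
     (\<forall>f\<in>Lp_space p M. \<forall>r. AE w in M. R (\<lambda>v. r *\<^sub>R f v) w = r *\<^sub>R R f w)"

definition contraction_semigroup ::
  "real \<Rightarrow> 'a measure \<Rightarrow> (real \<Rightarrow> ('a \<Rightarrow> 'x::real_normed_vector) \<Rightarrow> 'a \<Rightarrow> 'x) \<Rightarrow> bool" where
  "contraction_semigroup p M T \<longleftrightarrow>
     (\<forall>t>0. Lp_bounded_operator p M 1 (T t)) \<and>
     (\<forall>s>0. \<forall>t>0. \<forall>f\<in>Lp_space p M. AE w in M. T (s + t) f w = T s (T t f) w) \<and>
     (\<forall>f\<in>Lp_space p M. ((\<lambda>t. Lp_norm p M (\<lambda>w. T t f w - f w)) \<longlongrightarrow> 0) (at_right 0))"

definition fixed_space ::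
  "real \<Rightarrow> 'a measure \<Rightarrow> (real \<Rightarrow> ('a \<Rightarrow> 'x::real_normed_vector) \<Rightarrow> 'a \<Rightarrow> 'x) \<Rightarrow> ('a \<Rightarrow> 'x) set" where
  "fixed_space p M T = {f \<in> Lp_space p M. \<forall>t>0. AE w in M. T t f w = f w}"

definition is_fixed_projection ::
  "real \<Rightarrow> 'a measure \<Rightarrow> (real \<Rightarrow> ('a \<Rightarrow> 'x::real_normed_vector) \<Rightarrow> 'a \<Rightarrow> 'x) \<Rightarrow>
   (('a \<Rightarrow> 'x) \<Rightarrow> 'a \<Rightarrow> 'x) \<Rightarrow> bool" where
  "is_fixed_projection p M T P \<longleftrightarrow>
     (\<exists>K. Lp_bounded_operator p M K P) \<and>
     (\<forall>f\<in>Lp_space p M. P f \<in> fixed_space p M T) \<and>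
     (\<forall>f\<in>fixed_space p M T. AE w in M. P f w = f w)"

text \<open>
  For each \<open>t\<close> the derivative \<open>\<partial>T\<^sup>t(f)/\<partial>t\<close> is an element of \<open>L\<^sub>p(\<Omega>;X)\<close>, i.e. determined only almost
  everywhere, whereas \<open>G\<^sub>q\<^sup>T(f)\<close> at a point of \<open>\<Omega>\<close> needs its values for all \<open>t > 0\<close> at once. As
  usual, this refers to a version \<open>v\<close> of the derivative which is jointly measurable in \<open>(t, w)\<close>; by
  Fubini, two such versions give almost everywhere the same value of \<open>G\<^sub>q\<^sup>T(f)\<close>.
\<close>

definition is_deriv_version ::
  "real \<Rightarrow> 'a measure \<Rightarrow> (real \<Rightarrow> ('a \<Rightarrow> 'x::real_normed_vector) \<Rightarrow> 'a \<Rightarrow> 'x) \<Rightarrow>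
   ('a \<Rightarrow> 'x) \<Rightarrow> (real \<Rightarrow> 'a \<Rightarrow> 'x) \<Rightarrow> bool" where
  "is_deriv_version p M T f v \<longleftrightarrow>
     strongly_measurable (restrict_space lborel {0<..} \<Otimes>\<^sub>M M) (\<lambda>(t, w). v t w) \<and>
     (\<forall>t>0. v t \<in> Lp_space p M \<and>
        ((\<lambda>h. Lp_norm p M (\<lambda>w. (T (t + h) f w - T t f w) /\<^sub>R h - v t w)) \<longlongrightarrow> 0) (at 0))"

definition G_of_deriv ::
  "real \<Rightarrow> (real \<Rightarrow> 'a \<Rightarrow> 'x::real_normed_vector) \<Rightarrow> 'a \<Rightarrow> ennreal" where
  "G_of_deriv q v w =
     ennreal_powr (\<integral>\<^sup>+t\<in>{0<..}. ennreal (norm (t *\<^sub>R v t w) powr q / t) \<partial>lborel) (1 / q)"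

text \<open>
  The constants \<open>c, C\<close> are universal: they do not depend on \<open>X\<close> or \<open>\<Omega>\<close> either. These are types here,
  and an existential quantifier inside a statement with free type variables would let the
  constants depend on them, so two admissible values are fixed instead; no optimality is claimed.
\<close>

definition c_univ :: real where "c_univ = 1 / 100"

definition C_univ :: real where "C_univ = 100"

end

theory Submission
  imports Defs
begin

text \<open>
  Put \<open>1 - a\<^sub>n = exp (- r\<^sub>n)\<close> with \<open>r\<^sub>0 = 0\<close> and \<open>r\<^sub>n = 1024\<^sup>n\<close> otherwise. Then, with \<open>\<phi> x = x exp (- x)\<close>,
  the derivative \<open>t \<partial>T\<^sup>t f/\<partial>t\<close> is \<open>- \<Sum>\<^sub>n \<phi> (r\<^sub>n t) dE\<^sub>n\<^sub>+\<^sub>1 f\<close>, and almost everywhere this series converges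
  absolutely for all \<open>t\<close> at once. Since \<open>\<Sum>\<^sub>n \<phi> (r\<^sub>n t)\<close> is bounded and \<open>\<phi> (r\<^sub>n t)\<close> has integral one for
  \<open>dt/t\<close>, Jensen's inequality gives the upper bound. For the lower bound, the \<open>n\<close>-th term dominates
  the sum for \<open>1/r\<^sub>n \<le> t \<le> e/r\<^sub>n\<close>, because the rates are lacunary; these intervals are disjoint and
  of mass one for \<open>dt/t\<close>. Summation by parts writes \<open>T\<^sup>t\<close> as an average of the \<open>E\<^sub>n\<close>, hence a contraction,
  and strong continuity at zero follows from \<open>E\<^sub>n f \<longlonglongrightarrow> f\<close>.
\<close>

section \<open>Jensen's inequality for extended nonnegative reals\<close>

text \<open>At a fixed point of \<Omega> the estimates concern a sequence of vectors, namely the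
  differences dE_n f with n >= 2, and use only the triangle inequality in X, so no geometric
  property of X enters the constants. They do not depend on q either: the two estimates carry the
  factors \<open>4 powr q\<close> and \<open>54 powr q\<close>, whose q-th roots 4 and 54 fit into
  \<open>C_univ\<close> and \<open>1 / c_univ\<close>. Absorbing the off-diagonal terms in the lower
  bound requires a finite quantity, whereas S_q(f) may be infinite. Geometric weights restore
  finiteness; they vary slowly enough to weaken the decay between neighbouring indices only from
  1/1024 to 1/512. A further obstacle is that E_n f, T^t f and the time derivative are determined
  only up to null sets, which may depend on t. Therefore one explicit jointly measurable derivative
  is built on a set of full measure independent of t, and every other version is compared with it by
  Fubini. The term n = 0 has rate 0 and never reaches the derivative, which is why S_q is applied to
  f - F(f).\<close>

lemma Young_powr:
  fixes x c q :: real
  assumes "0 \<le> x" "0 < c" "1 \<le> q"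
  shows "q * x \<le> x powr q * c powr (1 - q) + (q - 1) * c"
proof (cases "x = 0 \<or> q = 1")
  case True
  with assms show ?thesis by auto
next
  case False
  then have x: "x > 0" "q > 1" using assms by auto
  \<comment> \<open>Weighted AM-GM with weights 1/q and 1 - 1/q; the first factor is chosen so that
    the geometric mean is exactly \<open>x\<close>.\<close>
  have "(x powr q * c powr (1 - q)) powr (1/q) * c powr (1 - 1/q)
      \<le> (1/q) * (x powr q * c powr (1 - q)) + (1 - 1/q) * c"
    using x assms by (intro Youngs_inequality_0) auto
  also have "(x powr q * c powr (1 - q)) powr (1/q) * c powr (1 - 1/q) = x"
  proof -
    have "(x powr q * c powr (1 - q)) powr (1/q) = x * c powr (1/q - 1)"
      using x assms by (simp add: powr_mult powr_powr divide_simps)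
    moreover have "c powr (1/q - 1) * c powr (1 - 1/q) = 1"
      using assms by (simp flip: powr_add)
    ultimately show ?thesis by (simp add: mult.assoc)
  qed
  finally have "q * x \<le> q * ((1/q) * (x powr q * c powr (1 - q)) + (1 - 1/q) * c)"
    using x by (intro mult_left_mono) auto
  also have "\<dots> = x powr q * c powr (1 - q) + (q - 1) * c"
    using x by (simp add: algebra_simps)
  finally show ?thesis .
qed

lemma convex_on_powr_atLeast:
  fixes p :: real
  assumes "1 \<le> p"
  shows "convex_on {0..} (\<lambda>x. x powr p)"
proof
  fix t x y :: real assume t: "0 < t" "t < 1" and xy: "x \<in> {0..}" "y \<in> {0..}"
  \<comment> \<open>When one of the two points is 0, convexity reduces to this inequality on the
    unit interval.\<close>
  have le: "s powr p \<le> s" if "0 \<le> s" "s \<le> 1" for s :: real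
    using powr_mono'[of 1 p s] that assms by simp
  show "((1 - t) *\<^sub>R x + t *\<^sub>R y) powr p \<le> (1 - t) * x powr p + t * y powr p"
  proof (cases "x = 0 \<or> y = 0")
    case True
    then show ?thesis
      using t xy le[of t] le[of "1 - t"] by (auto simp: powr_mult mult_right_mono)
  next
    case False
    then show ?thesis
      using convex_onD[OF powr_convex[OF assms], of t x y] t xy by auto
  qed
qed simp

lemma convex_on_abs_powr:
  fixes p :: real
  assumes "1 \<le> p"
  shows "convex_on UNIV (\<lambda>x::real. \<bar>x\<bar> powr p)"
proof
  fix t x y :: real assume t: "0 < t" "t < 1"
  have "\<bar>(1 - t) *\<^sub>R x + t *\<^sub>R y\<bar> powr p \<le> ((1 - t) * \<bar>x\<bar> + t * \<bar>y\<bar>) powr p"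
    using t assms by (intro powr_mono2) (auto simp: abs_mult intro: order_trans[OF abs_triangle_ineq])
  also have "\<dots> \<le> (1 - t) * \<bar>x\<bar> powr p + t * \<bar>y\<bar> powr p"
    using convex_onD[OF convex_on_powr_atLeast[OF assms], of t "\<bar>x\<bar>" "\<bar>y\<bar>"] t by auto
  finally show "\<bar>(1 - t) *\<^sub>R x + t *\<^sub>R y\<bar> powr p \<le> (1 - t) * \<bar>x\<bar> powr p + t * \<bar>y\<bar> powr p" .
qed simp

lemma ennreal_powr_ennreal: "0 \<le> x \<Longrightarrow> ennreal_powr (ennreal x) r = ennreal (x powr r)"
  by (simp add: ennreal_powr_def)

lemma ennreal_powr_top [simp]: "ennreal_powr \<top> r = \<top>"
  by (simp add: ennreal_powr_def)

lemma ennreal_powr_0 [simp]: "ennreal_powr 0 r = 0"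
  by (simp add: ennreal_powr_def)

lemma ennreal_powr_mono:
  assumes "x \<le> y" "0 \<le> r"
  shows "ennreal_powr x r \<le> ennreal_powr y r"
  using assms
  by (cases x; cases y) (auto simp: ennreal_powr_ennreal powr_mono2 top_unique)

lemma ennreal_powr_eq_top_iff: "ennreal_powr x r = \<top> \<longleftrightarrow> x = \<top>"
  by (cases x) (auto simp: ennreal_powr_ennreal)

lemma ennreal_powr_eq_0_iff: "ennreal_powr x r = 0 \<longleftrightarrow> x = 0"
  by (cases x) (auto simp: ennreal_powr_ennreal)

lemma ennreal_powr_mult:
  assumes "0 \<le> c" "q \<noteq> 0"
  shows "ennreal_powr (ennreal (c powr q) * y) (1 / q) = ennreal c * ennreal_powr y (1 / q)"
proof (cases y)
  case (real r)
  then show ?thesis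
    using assms by (simp add: ennreal_mult'[symmetric] ennreal_powr_ennreal powr_mult powr_powr)
next
  case top
  then show ?thesis using assms by (cases "c = 0") (auto simp: ennreal_mult_top)
qed

lemma ennreal_powr_powr:
  assumes "r \<noteq> 0"
  shows "ennreal_powr (ennreal_powr x r) (1 / r) = x"
  using assms by (cases x) (auto simp: ennreal_powr_ennreal powr_powr)

lemma ennreal_powr_powr':
  assumes "r \<noteq> 0"
  shows "ennreal_powr (ennreal_powr x (1 / r)) r = x"
  using assms by (cases x) (auto simp: ennreal_powr_ennreal powr_powr)

text \<open>Young's inequality bounds \<open>f\<close> by an affine function of \<open>f powr q\<close> that is tangent at the mean
  value, so that no integrability is needed.\<close>

lemma nn_integral_powr_Jensen:
  fixes f :: "'a \<Rightarrow> real"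
  assumes q: "1 \<le> q" and \<kappa>: "0 < \<kappa>" and mass: "emeasure N (space N) \<le> ennreal \<kappa>"
    and [measurable]: "f \<in> borel_measurable N" and f: "\<And>x. 0 \<le> f x"
  shows "ennreal_powr (\<integral>\<^sup>+x. ennreal (f x) \<partial>N) q \<le> ennreal (\<kappa> powr (q - 1)) * (\<integral>\<^sup>+x. ennreal (f x powr q) \<partial>N)"
proof (cases "(\<integral>\<^sup>+x. ennreal (f x powr q) \<partial>N) = \<top>")
  case True
  with \<kappa> show ?thesis by (simp add: ennreal_mult_top)
next
  case False
  then obtain I where I: "(\<integral>\<^sup>+x. ennreal (f x powr q) \<partial>N) = ennreal I" "0 \<le> I"
    by (cases "(\<integral>\<^sup>+x. ennreal (f x powr q) \<partial>N)") auto
  have young: "ennreal q * (\<integral>\<^sup>+x. ennreal (f x) \<partial>N) \<le> ennreal (I * c powr (1 - q) + (q - 1) * c * \<kappa>)"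
    if c: "0 < c" for c
  proof -
    have "ennreal q * (\<integral>\<^sup>+x. ennreal (f x) \<partial>N) = (\<integral>\<^sup>+x. ennreal (q * f x) \<partial>N)"
      using q f by (simp add: nn_integral_cmult ennreal_mult)
    also have "\<dots> \<le> (\<integral>\<^sup>+x. ennreal (c powr (1 - q)) * ennreal (f x powr q) + ennreal ((q - 1) * c) \<partial>N)"
      using Young_powr[OF f c q] c q
      by (intro nn_integral_mono) (simp add: ennreal_mult'[symmetric] ennreal_plus[symmetric] mult.commute del: ennreal_plus)
    also have "\<dots> = ennreal (c powr (1 - q)) * ennreal I + ennreal ((q - 1) * c) * emeasure N (space N)"
      by (simp add: nn_integral_add nn_integral_cmult I)
    also have "\<dots> \<le> ennreal (c powr (1 - q)) * ennreal I + ennreal ((q - 1) * c) * ennreal \<kappa>"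
      by (intro add_left_mono mult_left_mono mass) auto
    also have "\<dots> = ennreal (I * c powr (1 - q) + (q - 1) * c * \<kappa>)"
      using c q I \<kappa> by (simp add: ennreal_mult'[symmetric] ennreal_plus[symmetric] mult.commute del: ennreal_plus)
    finally show ?thesis .
  qed
  \<comment> \<open>Already the tangent at 1 shows that the integral of \<open>f\<close> is finite,
    so that the tangent point may be chosen depending on it.\<close>
  have "ennreal q * (\<integral>\<^sup>+x. ennreal (f x) \<partial>N) < \<top>"
    using young[of 1] by (simp add: le_less_trans)
  then obtain u where u: "(\<integral>\<^sup>+x. ennreal (f x) \<partial>N) = ennreal u" "0 \<le> u"
    using q by (cases "(\<integral>\<^sup>+x. ennreal (f x) \<partial>N)") (auto simp: ennreal_mult_top)
  show ?thesis
  proof (cases "u = 0")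
    case True
    then show ?thesis by (simp add: u)
  next
    case False
    then have u0: "u > 0" using u by simp
    \<comment> \<open>This is the mean value if \<kappa> is the total mass. The affine term then
      equals \<open>(q - 1) * u\<close> and cancels all but one of the \<open>q\<close> copies of
      \<open>u\<close>.\<close>
    define c where "c = u / \<kappa>"
    have c: "c > 0" using u0 \<kappa> by (simp add: c_def)
    have "q * u \<le> I * c powr (1 - q) + (q - 1) * c * \<kappa>"
      using young[OF c] u q c I \<kappa> by (simp add: ennreal_mult'[symmetric] del: ennreal_plus)
    also have "(q - 1) * c * \<kappa> = (q - 1) * u" using \<kappa> by (simp add: c_def)
    finally have "u \<le> I * c powr (1 - q)" by (simp add: algebra_simps)
    then have "u * c powr (q - 1) \<le> I * (c powr (1 - q) * c powr (q - 1))"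
      by (metis mult.assoc mult_right_mono powr_ge_zero)
    also have "c powr (1 - q) * c powr (q - 1) = 1" using c by (simp flip: powr_add)
    finally have "u * c powr (q - 1) \<le> I" by simp
    then have "\<kappa> powr (q - 1) * (u * c powr (q - 1)) \<le> \<kappa> powr (q - 1) * I"
      by (intro mult_left_mono) auto
    also have "\<kappa> powr (q - 1) * (u * c powr (q - 1)) = u powr q"
      using u0 \<kappa> by (simp add: c_def powr_divide powr_diff)
    finally show ?thesis
      using u I \<kappa> by (simp add: ennreal_powr_ennreal ennreal_mult'[symmetric])
  qed
qed

text \<open>The weights \<open>K n\<close> become the density of a measure on the natural numbers.
  The upper bound uses it with the weights \<open>\<phi> (\<mu> n * t)\<close>, the lower bound with
  the off-diagonal kernel.\<close>

lemma suminf_powr_Jensen: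
  fixes K f :: "nat \<Rightarrow> real"
  assumes "1 \<le> q" "0 < \<kappa>" "\<And>n. 0 \<le> K n" "(\<Sum>n. ennreal (K n)) \<le> ennreal \<kappa>" "\<And>n. 0 \<le> f n"
  shows "ennreal_powr (\<Sum>n. ennreal (K n * f n)) q
    \<le> ennreal (\<kappa> powr (q - 1)) * (\<Sum>n. ennreal (K n * f n powr q))"
proof -
  let ?N = "density (count_space UNIV) (\<lambda>n. ennreal (K n))"
  have "emeasure ?N (space ?N) = (\<Sum>n. ennreal (K n))"
    by (simp add: emeasure_density nn_integral_count_space_nat)
  then have "ennreal_powr (\<integral>\<^sup>+x. ennreal (f x) \<partial>?N) q
      \<le> ennreal (\<kappa> powr (q - 1)) * (\<integral>\<^sup>+x. ennreal (f x powr q) \<partial>?N)"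
    using assms by (intro nn_integral_powr_Jensen) auto
  then show ?thesis
    using assms by (simp add: nn_integral_density nn_integral_count_space_nat ennreal_mult)
qed

section \<open>Strong measurability and the norm\<close>

lemma strongly_measurable_simple: "simple_function M f \<Longrightarrow> strongly_measurable M f"
  unfolding strongly_measurable_def by (rule exI[of _ "\<lambda>_. f"]) auto

lemma strongly_measurable_const [simp]: "strongly_measurable M (\<lambda>w. c)"
  by (rule strongly_measurable_simple) simp

lemma strongly_measurable_imp_borel_measurable:
  assumes "strongly_measurable M f"
  shows "f \<in> borel_measurable M"
proof -
  from assms obtain s where s: "\<And>i. simple_function M (s i)" "\<And>w. w \<in> space M \<Longrightarrow> (\<lambda>i. s i w) \<longlonglongrightarrow> f w"
    unfolding strongly_measurable_def by auto
  show ?thesis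
    by (rule borel_measurable_LIMSEQ_metric[of s M f, OF borel_measurable_simple_function[OF s(1)] s(2)])
qed

lemma strongly_measurable_norm:
  "strongly_measurable M f \<Longrightarrow> (\<lambda>w. norm (f w)) \<in> borel_measurable M"
  by (rule borel_measurable_continuous_on[OF continuous_on_norm_id strongly_measurable_imp_borel_measurable])

lemma strongly_measurable_compose2:
  assumes f: "strongly_measurable M f" and g: "strongly_measurable M g"
    and h: "\<And>u v x y. u \<longlonglongrightarrow> x \<Longrightarrow> v \<longlonglongrightarrow> y \<Longrightarrow> (\<lambda>i. h (u i) (v i)) \<longlonglongrightarrow> h x y"
  shows "strongly_measurable M (\<lambda>w. h (f w) (g w))"
proof -
  from f obtain s where s: "\<And>i. simple_function M (s i)" "\<And>w. w \<in> space M \<Longrightarrow> (\<lambda>i. s i w) \<longlonglongrightarrow> f w"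
    unfolding strongly_measurable_def by auto
  from g obtain r where r: "\<And>i. simple_function M (r i)" "\<And>w. w \<in> space M \<Longrightarrow> (\<lambda>i. r i w) \<longlonglongrightarrow> g w"
    unfolding strongly_measurable_def by auto
  show ?thesis unfolding strongly_measurable_def
    using s r by (intro exI[of _ "\<lambda>i w. h (s i w) (r i w)"]) (auto intro: h simple_function_compose2)
qed

lemma strongly_measurable_add:
  "strongly_measurable M f \<Longrightarrow> strongly_measurable M g \<Longrightarrow> strongly_measurable M (\<lambda>w. f w + g w)"
  by (rule strongly_measurable_compose2) (auto intro: tendsto_intros)

lemma strongly_measurable_diff:
  "strongly_measurable M f \<Longrightarrow> strongly_measurable M g \<Longrightarrow> strongly_measurable M (\<lambda>w. f w - g w)"
  by (rule strongly_measurable_compose2) (auto intro: tendsto_intros)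

lemma strongly_measurable_scaleR_fun:
  "strongly_measurable M f \<Longrightarrow> strongly_measurable M g \<Longrightarrow> strongly_measurable M (\<lambda>w. f w *\<^sub>R g w)"
  by (rule strongly_measurable_compose2) (auto intro: tendsto_intros)

lemma strongly_measurable_scaleR:
  "strongly_measurable M f \<Longrightarrow> strongly_measurable M (\<lambda>w. c *\<^sub>R f w)"
  by (rule strongly_measurable_scaleR_fun) auto

lemma strongly_measurable_sum:
  "(\<And>i. i \<in> I \<Longrightarrow> strongly_measurable M (f i)) \<Longrightarrow> strongly_measurable M (\<lambda>w. \<Sum>i\<in>I. f i w)"
  by (induction I rule: infinite_finite_induct) (auto intro: strongly_measurable_add)

lemma strongly_measurable_comp:
  assumes "T \<in> measurable M N" "strongly_measurable N f"
  shows "strongly_measurable M (\<lambda>w. f (T w))"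
proof -
  from assms obtain s where s: "\<And>i. simple_function N (s i)" "\<And>w. w \<in> space N \<Longrightarrow> (\<lambda>i. s i w) \<longlonglongrightarrow> f w"
    unfolding strongly_measurable_def by auto
  then show ?thesis unfolding strongly_measurable_def
    using assms measurable_space[OF assms(1)]
    by (intro exI[of _ "\<lambda>i w. s i (T w)"]) (auto intro: simple_function_comp)
qed

text \<open>The values of \<open>g\<close> lie in the closure of the countably many values of the step functions, so a
  step function is obtained by moving each value to the nearest of the first \<open>n\<close> points of this
  countable set. No separability of the target is needed.\<close>

lemma strongly_measurable_limit:
  fixes g :: "'a \<Rightarrow> 'x::real_normed_vector"
  assumes f: "\<And>i::nat. strongly_measurable M (f i)" and lim: "\<And>w. w \<in> space M \<Longrightarrow> (\<lambda>i. f i w) \<longlonglongrightarrow> g w"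
  shows "strongly_measurable M g"
proof (cases "space M = {}")
  case True
  then show ?thesis unfolding strongly_measurable_def by (intro exI[of _ "\<lambda>_ _. 0"]) auto
next
  case False
  have "\<forall>i. \<exists>s. (\<forall>j::nat. simple_function M (s j)) \<and> (\<forall>w\<in>space M. (\<lambda>j. s j w) \<longlonglongrightarrow> f i w)"
    using f unfolding strongly_measurable_def by blast
  then obtain s where s: "\<And>i j. simple_function M (s i j)"
    "\<And>i w. w \<in> space M \<Longrightarrow> (\<lambda>j::nat. s i j w) \<longlonglongrightarrow> f i w"
    by metis
  define D where "D = (\<Union>i. \<Union>j. s i j ` space M)"
  have D: "countable D" "D \<noteq> {}"
    unfolding D_def using countable_finite[OF simple_functionD(1)[OF s(1)]] False by (auto intro!: countable_UN)
  define d where "d = from_nat_into D"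
  have range_d: "range d = D" using D by (simp add: d_def range_from_nat_into)
  have [measurable]: "g \<in> borel_measurable M"
    by (rule borel_measurable_LIMSEQ_metric[of f M g, OF strongly_measurable_imp_borel_measurable[OF f] lim])
  have [measurable]: "(\<lambda>w. dist (g w) (d k)) \<in> borel_measurable M" for k
    by (rule borel_measurable_continuous_on[where f="\<lambda>x. dist x (d k)"]) (auto intro: continuous_intros)
  define P where "P n w k \<longleftrightarrow> k \<le> n \<and> (\<forall>j\<le>n. dist (g w) (d k) \<le> dist (g w) (d j))" for n w k
  define idx where "idx n w = (LEAST k. P n w k)" for n w
  have [measurable]: "idx n \<in> measurable M (count_space UNIV)" for n
    unfolding idx_def[abs_def] P_def by measurable
  have idx: "P n w (idx n w)" for n w
  proof -
    have "\<exists>k\<in>{..n}. \<forall>j\<in>{..n}. dist (g w) (d k) \<le> dist (g w) (d j)"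
      using arg_min_if_finite(1)[of "{..n}" "\<lambda>k. dist (g w) (d k)"]
        arg_min_least[of "{..n}" _ "\<lambda>k. dist (g w) (d k)"] by blast
    then have "\<exists>k. P n w k" by (auto simp: P_def)
    then show ?thesis unfolding idx_def by (rule LeastI_ex)
  qed
  have "simple_function M (idx n)" for n
    unfolding simple_function_eq_measurable
    using idx by (auto simp: P_def intro!: finite_subset[of "idx n ` space M" "{..n}"])
  then have "simple_function M (\<lambda>w. d (idx n w))" for n
    by (rule simple_function_compose1)
  \<comment> \<open>Some \<open>d k\<close> lies within \<open>e\<close> of \<open>g w\<close>; from
    \<open>n = k\<close> on it takes part in the minimum, so the selected point is at least as
    close.\<close>
  moreover have "(\<lambda>n. d (idx n w)) \<longlonglongrightarrow> g w" if w: "w \<in> space M" for w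
  proof (rule metric_LIMSEQ_I)
    fix e :: real assume e: "0 < e"
    obtain i where i: "dist (f i w) (g w) < e / 2"
      using metric_LIMSEQ_D[OF lim[OF w], of "e/2"] e by auto
    obtain j where j: "dist (s i j w) (f i w) < e / 2"
      using metric_LIMSEQ_D[OF s(2)[OF w], of "e/2" i] e by auto
    have "s i j w \<in> D" using w by (auto simp: D_def)
    then obtain k where k: "s i j w = d k" using range_d by (metis imageE)
    have "dist (d (idx n w)) (g w) < e" if "n \<ge> k" for n
    proof -
      have "dist (g w) (d (idx n w)) \<le> dist (g w) (d k)" using idx[of n w] that by (auto simp: P_def)
      also have "\<dots> < e"
        using i j dist_triangle[of "g w" "d k" "f i w"] k by (simp add: dist_commute)
      finally show ?thesis by (simp add: dist_commute)
    qed
    then show "\<exists>no. \<forall>n\<ge>no. dist (d (idx n w)) (g w) < e" by blast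
  qed
  ultimately show ?thesis unfolding strongly_measurable_def by (intro exI[of _ "\<lambda>n w. d (idx n w)"]) auto
qed

lemma strongly_measurable_real:
  fixes h :: "'a \<Rightarrow> real"
  assumes "h \<in> borel_measurable M"
  shows "strongly_measurable M h"
  using borel_measurable_implies_sequence_metric[OF assms, of 0] unfolding strongly_measurable_def by blast

section \<open>The L_p seminorm and Minkowski's inequality\<close>

lemma Lp_norm_mono:
  assumes "AE w in M. norm (f w) \<le> norm (g w)" "0 < p"
  shows "Lp_norm p M f \<le> Lp_norm p M g"
  unfolding Lp_norm_def
proof (intro ennreal_powr_mono nn_integral_mono_AE)
  show "AE w in M. ennreal (norm (f w) powr p) \<le> ennreal (norm (g w) powr p)"
    using assms(1) by eventually_elim (use assms in \<open>auto intro!: ennreal_leI powr_mono2\<close>)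
qed (use assms in auto)

lemma Lp_norm_cong:
  assumes "AE w in M. f w = g w"
  shows "Lp_norm p M f = Lp_norm p M g"
proof -
  have "(\<integral>\<^sup>+w. ennreal (norm (f w) powr p) \<partial>M) = (\<integral>\<^sup>+w. ennreal (norm (g w) powr p) \<partial>M)"
    using assms by (intro nn_integral_cong_AE) auto
  then show ?thesis by (simp add: Lp_norm_def)
qed

text \<open>This exhibits the norm as the gauge of a convex set, so that the triangle inequality
  follows from the convexity of \<open>powr\<close> alone.\<close>

lemma Lp_norm_le_iff:
  assumes p: "0 < p" and a: "0 < a" and f: "strongly_measurable M f"
  shows "Lp_norm p M f \<le> ennreal a \<longleftrightarrow> (\<integral>\<^sup>+w. ennreal ((norm (f w) / a) powr p) \<partial>M) \<le> 1"
proof -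
  note [measurable] = strongly_measurable_norm[OF f]
  let ?I = "\<integral>\<^sup>+w. ennreal (norm (f w) powr p) \<partial>M"
  have "(\<integral>\<^sup>+w. ennreal ((norm (f w) / a) powr p) \<partial>M) = (\<integral>\<^sup>+w. ennreal (1 / a powr p) * ennreal (norm (f w) powr p) \<partial>M)"
    using a by (intro nn_integral_cong) (simp add: powr_divide flip: ennreal_mult)
  also have "\<dots> = ennreal (1 / a powr p) * ?I" by (simp add: nn_integral_cmult)
  finally have *: "(\<integral>\<^sup>+w. ennreal ((norm (f w) / a) powr p) \<partial>M) = ennreal (1 / a powr p) * ?I" .
  show ?thesis
  proof (cases ?I)
    case (real r)
    have "Lp_norm p M f \<le> ennreal a \<longleftrightarrow> r powr (1/p) \<le> a"
      using real a by (simp add: Lp_norm_def ennreal_powr_ennreal)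
    also have "\<dots> \<longleftrightarrow> r \<le> a powr p"
      using powr_mono2[of p "r powr (1/p)" a] powr_mono2[of "1/p" r "a powr p"] real a p
      by (auto simp: powr_powr)
    also have "\<dots> \<longleftrightarrow> ennreal (1 / a powr p) * ennreal r \<le> 1"
      using a real by (simp add: divide_simps flip: ennreal_mult ennreal_1)
    finally show ?thesis unfolding * real .
  next
    case top
    then show ?thesis unfolding * using a by (simp add: Lp_norm_def ennreal_mult_top top_unique)
  qed
qed

lemma Lp_norm_triangle:
  assumes p: "1 \<le> p" and f: "strongly_measurable M f" and g: "strongly_measurable M g"
  shows "Lp_norm p M (\<lambda>w. f w + g w) \<le> Lp_norm p M f + Lp_norm p M g"
proof (cases "Lp_norm p M f = \<top> \<or> Lp_norm p M g = \<top>")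
  case True
  then show ?thesis by auto
next
  case False
  note [measurable] = strongly_measurable_norm[OF f] strongly_measurable_norm[OF g]
  from False obtain a b where a: "Lp_norm p M f = ennreal a" "0 \<le> a" and b: "Lp_norm p M g = ennreal b" "0 \<le> b"
    by (metis ennreal_cases)
  have "Lp_norm p M (\<lambda>w. f w + g w) \<le> ennreal (a + b) + ennreal e" if e: "0 < e" for e
  proof -
    \<comment> \<open>The slack keeps both radii positive even if one of the norms vanishes.\<close>
    define a' b' where "a' = a + e / 2" and "b' = b + e / 2"
    have ab': "a' > 0" "b' > 0" using a b e by (auto simp: a'_def b'_def)
    have fa: "(\<integral>\<^sup>+w. ennreal ((norm (f w) / a') powr p) \<partial>M) \<le> 1"
      using Lp_norm_le_iff[OF _ ab'(1) f, of p] p a e by (auto simp: a'_def)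
    have gb: "(\<integral>\<^sup>+w. ennreal ((norm (g w) / b') powr p) \<partial>M) \<le> 1"
      using Lp_norm_le_iff[OF _ ab'(2) g, of p] p b e by (auto simp: b'_def)
    \<comment> \<open>With this weight \<open>(f + g) / (a' + b')\<close> is the convex combination
      of \<open>f / a'\<close> and \<open>g / b'\<close>.\<close>
    define t where "t = b' / (a' + b')"
    have t: "0 \<le> t" "t \<le> 1" "1 - t = a' / (a' + b')" using ab' by (auto simp: t_def field_simps)
    have "(\<integral>\<^sup>+w. ennreal ((norm (f w + g w) / (a' + b')) powr p) \<partial>M)
        \<le> (\<integral>\<^sup>+w. ennreal (1 - t) * ennreal ((norm (f w) / a') powr p) + ennreal t * ennreal ((norm (g w) / b') powr p) \<partial>M)"
    proof (rule nn_integral_mono)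
      fix w
      have "norm (f w + g w) / (a' + b') \<le> (norm (f w) + norm (g w)) / (a' + b')"
        using ab' by (intro divide_right_mono norm_triangle_ineq) auto
      also have "\<dots> = (1 - t) * (norm (f w) / a') + t * (norm (g w) / b')"
        unfolding t(3) using ab' by (simp add: t_def add_divide_distrib)
      finally have "(norm (f w + g w) / (a' + b')) powr p \<le> ((1 - t) * (norm (f w) / a') + t * (norm (g w) / b')) powr p"
        using p ab' by (intro powr_mono2) auto
      also have "\<dots> \<le> (1 - t) * (norm (f w) / a') powr p + t * (norm (g w) / b') powr p"
        using convex_onD[OF convex_on_powr_atLeast[OF p], of t "norm (f w) / a'" "norm (g w) / b'"] t ab' by auto
      finally show "ennreal ((norm (f w + g w) / (a' + b')) powr p)
        \<le> ennreal (1 - t) * ennreal ((norm (f w) / a') powr p) + ennreal t * ennreal ((norm (g w) / b') powr p)"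
        using t(1,2) by (simp add: ennreal_mult'[symmetric] ennreal_plus[symmetric] del: ennreal_plus times_divide_eq_right times_divide_eq_left)
    qed
    also have "\<dots> = ennreal (1 - t) * (\<integral>\<^sup>+w. ennreal ((norm (f w) / a') powr p) \<partial>M) + ennreal t * (\<integral>\<^sup>+w. ennreal ((norm (g w) / b') powr p) \<partial>M)"
      by (simp add: nn_integral_add nn_integral_cmult)
    also have "\<dots> \<le> ennreal (1 - t) * 1 + ennreal t * 1"
      by (intro add_mono mult_left_mono fa gb) auto
    also have "\<dots> = 1" using t by (simp flip: ennreal_plus)
    finally have "Lp_norm p M (\<lambda>w. f w + g w) \<le> ennreal (a' + b')"
      using Lp_norm_le_iff[of p "a' + b'" M "\<lambda>w. f w + g w"] p ab' strongly_measurable_add[OF f g] by auto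
    also have "a' + b' = (a + b) + e" by (simp add: a'_def b'_def)
    finally show ?thesis using a b e by simp
  qed
  then have "Lp_norm p M (\<lambda>w. f w + g w) \<le> ennreal (a + b)"
    by (rule ennreal_le_epsilon)
  then show ?thesis using a b by simp
qed

lemma Lp_norm_scaleR:
  assumes p: "0 < p" and f: "strongly_measurable M f"
  shows "Lp_norm p M (\<lambda>w. c *\<^sub>R f w) = ennreal \<bar>c\<bar> * Lp_norm p M f"
proof -
  note [measurable] = strongly_measurable_norm[OF f]
  have "(\<integral>\<^sup>+w. ennreal (norm (c *\<^sub>R f w) powr p) \<partial>M) = ennreal (\<bar>c\<bar> powr p) * (\<integral>\<^sup>+w. ennreal (norm (f w) powr p) \<partial>M)"
    by (simp add: powr_mult ennreal_mult nn_integral_cmult)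
  then show ?thesis using p by (simp add: Lp_norm_def ennreal_powr_mult)
qed

lemma Lp_norm_0 [simp]: "Lp_norm p M (\<lambda>w. 0) = 0"
  by (simp add: Lp_norm_def)

lemma Lp_norm_minus_commute: "Lp_norm p M (\<lambda>w. f w - g w) = Lp_norm p M (\<lambda>w. g w - f w)"
  by (simp add: Lp_norm_def norm_minus_commute)

lemma Lp_norm_uminus: "Lp_norm p M (\<lambda>w. - f w) = Lp_norm p M f"
  by (simp add: Lp_norm_def)

lemma Lp_norm_norm: "Lp_norm p M (\<lambda>w. norm (f w)) = Lp_norm p M f"
  by (simp add: Lp_norm_def)

lemma Lp_norm_triangle_diff:
  assumes p: "1 \<le> p" and "strongly_measurable M f" "strongly_measurable M g" "strongly_measurable M h"
  shows "Lp_norm p M (\<lambda>w. f w - h w) \<le> Lp_norm p M (\<lambda>w. f w - g w) + Lp_norm p M (\<lambda>w. g w - h w)"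
  using Lp_norm_triangle[OF p strongly_measurable_diff[OF assms(2,3)] strongly_measurable_diff[OF assms(3,4)]]
  by simp

lemma Lp_norm_sum:
  assumes p: "1 \<le> p" and f: "\<And>i. i \<in> I \<Longrightarrow> strongly_measurable M (f i)"
  shows "Lp_norm p M (\<lambda>w. \<Sum>i\<in>I. f i w) \<le> (\<Sum>i\<in>I. Lp_norm p M (f i))"
  using f
proof (induction I rule: infinite_finite_induct)
  case (insert i I)
  then have "Lp_norm p M (\<lambda>w. f i w + (\<Sum>i\<in>I. f i w)) \<le> Lp_norm p M (f i) + Lp_norm p M (\<lambda>w. \<Sum>i\<in>I. f i w)"
    by (intro Lp_norm_triangle p strongly_measurable_sum) auto
  also have "\<dots> \<le> Lp_norm p M (f i) + (\<Sum>i\<in>I. Lp_norm p M (f i))"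
    using insert by (intro add_left_mono) auto
  finally show ?case using insert by simp
qed auto

lemma Lp_norm_eq_0_iff:
  assumes f: "strongly_measurable M f"
  shows "Lp_norm p M f = 0 \<longleftrightarrow> (AE w in M. f w = 0)"
proof -
  note [measurable] = strongly_measurable_norm[OF f]
  show ?thesis
    by (simp add: Lp_norm_def ennreal_powr_eq_0_iff nn_integral_0_iff_AE)
qed

lemma Lp_norm_less_top_iff:
  "Lp_norm p M f < \<top> \<longleftrightarrow> (\<integral>\<^sup>+w. ennreal (norm (f w) powr p) \<partial>M) < \<top>"
  by (simp add: Lp_norm_def ennreal_powr_eq_top_iff less_top[symmetric])

lemma Lp_spaceD: "f \<in> Lp_space p M \<Longrightarrow> strongly_measurable M f"
  "f \<in> Lp_space p M \<Longrightarrow> Lp_norm p M f < \<top>"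
  by (auto simp: Lp_space_def)

lemma Lp_space_add:
  assumes "1 \<le> p" "f \<in> Lp_space p M" "g \<in> Lp_space p M"
  shows "(\<lambda>w. f w + g w) \<in> Lp_space p M"
  using assms Lp_norm_triangle[of p M f g] unfolding Lp_space_def
  by (auto intro: strongly_measurable_add le_less_trans simp: ennreal_add_less_top)

lemma Lp_space_scaleR:
  assumes "1 \<le> p" "f \<in> Lp_space p M"
  shows "(\<lambda>w. c *\<^sub>R f w) \<in> Lp_space p M"
  using assms Lp_norm_scaleR[of p M f c] unfolding Lp_space_def
  by (auto intro: strongly_measurable_scaleR simp: ennreal_mult_less_top)

lemma Lp_space_diff:
  assumes "1 \<le> p" "f \<in> Lp_space p M" "g \<in> Lp_space p M"
  shows "(\<lambda>w. f w - g w) \<in> Lp_space p M"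
  using Lp_space_add[OF assms(1,2) Lp_space_scaleR[OF assms(1,3), of "-1"]] by simp

lemma Lp_space_0 [simp]: "(\<lambda>w. 0) \<in> Lp_space p M"
  by (simp add: Lp_space_def)

lemma Lp_space_sum:
  assumes "1 \<le> p" "\<And>i. i \<in> I \<Longrightarrow> f i \<in> Lp_space p M"
  shows "(\<lambda>w. \<Sum>i\<in>I. f i w) \<in> Lp_space p M"
  using assms(2)
  by (induction I rule: infinite_finite_induct) (auto intro: Lp_space_add[OF assms(1)])

lemma Lp_space_bounded:
  assumes "finite_measure M" "0 \<le> p" and f: "strongly_measurable M f" "\<And>w. w \<in> space M \<Longrightarrow> norm (f w) \<le> B"
  shows "f \<in> Lp_space p M"
proof -
  interpret finite_measure M by fact
  have "(\<integral>\<^sup>+w. ennreal (norm (f w) powr p) \<partial>M) \<le> (\<integral>\<^sup>+w. ennreal (B powr p) \<partial>M)"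
    using assms by (intro nn_integral_mono ennreal_leI powr_mono2) auto
  also have "\<dots> < \<top>" by (simp add: ennreal_mult_less_top less_top[symmetric] ennreal_mult_eq_top_iff)
  finally show ?thesis using f by (simp add: Lp_space_def Lp_norm_less_top_iff)
qed

lemma Lp_space_simple:
  assumes "finite_measure M" "0 \<le> p" "simple_function M f"
  shows "f \<in> Lp_space p M"
proof (rule Lp_space_bounded[OF assms(1,2)])
  show "norm (f w) \<le> Max ((\<lambda>w. norm (f w)) ` space M)" if "w \<in> space M" for w
    using simple_functionD(1)[OF assms(3)] that
    by (intro Max_ge) (auto simp flip: image_image[of norm f])
qed (use assms strongly_measurable_simple in auto)

text \<open>The filter is arbitrary because the lemma serves both partial sums and difference
  quotients at \<open>at 0\<close>. Measurability is required only eventually since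
  \<open>T (t + h) f\<close> is controlled only for \<open>0 < t + h\<close>.\<close>

lemma Lp_limit_unique:
  assumes p: "1 \<le> p" and F: "F \<noteq> bot" and u: "\<forall>\<^sub>F i in F. strongly_measurable M (u i)"
    and g: "strongly_measurable M g" "strongly_measurable M g'"
    and lim: "((\<lambda>i. Lp_norm p M (\<lambda>w. u i w - g w)) \<longlongrightarrow> 0) F" "((\<lambda>i. Lp_norm p M (\<lambda>w. u i w - g' w)) \<longlongrightarrow> 0) F"
  shows "AE w in M. g w = g' w"
proof -
  have "((\<lambda>i. Lp_norm p M (\<lambda>w. u i w - g w) + Lp_norm p M (\<lambda>w. u i w - g' w)) \<longlongrightarrow> 0 + 0) F"
    by (intro tendsto_add lim)
  moreover have "\<forall>\<^sub>F i in F. Lp_norm p M (\<lambda>w. g w - g' w) \<le> Lp_norm p M (\<lambda>w. u i w - g w) + Lp_norm p M (\<lambda>w. u i w - g' w)"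
    using u
  proof eventually_elim
    case (elim i)
    show ?case using Lp_norm_triangle_diff[OF p g(1) elim g(2)] by (simp add: Lp_norm_minus_commute)
  qed
  ultimately have "Lp_norm p M (\<lambda>w. g w - g' w) \<le> 0"
    using tendsto_lowerbound[OF _ _ F] by fastforce
  then show ?thesis using Lp_norm_eq_0_iff[OF strongly_measurable_diff[OF g], of p] by simp
qed

section \<open>Convergence in \<open>L\<^sub>p\<close>\<close>

text \<open>An increasing supremum of powers of finite sums gives access to monotone convergence and
  also shows that the left-hand side is measurable when the terms depend on a point.\<close>

lemma ennreal_powr_suminf_eq_SUP:
  fixes a :: "nat \<Rightarrow> real"
  assumes a: "\<And>n. 0 \<le> a n" and p: "1 \<le> p"
  shows "ennreal_powr (\<Sum>n. ennreal (a n)) p = (SUP K. ennreal ((\<Sum>n<K. a n) powr p))"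
proof (cases "(\<Sum>n. ennreal (a n)) = \<top>")
  case False
  then have sa: "summable a" using a summable_suminf_not_top by blast
  have "(\<lambda>K. ennreal ((\<Sum>n<K. a n) powr p)) \<longlonglongrightarrow> ennreal ((\<Sum>n. a n) powr p)"
    using p a by (intro tendsto_ennrealI tendsto_powr' tendsto_const summable_LIMSEQ sa) (auto intro!: always_eventually sum_nonneg)
  moreover have "(\<lambda>K. ennreal ((\<Sum>n<K. a n) powr p)) \<longlonglongrightarrow> (SUP K. ennreal ((\<Sum>n<K. a n) powr p))"
    using p a by (intro LIMSEQ_SUP incseq_SucI ennreal_leI powr_mono2 sum_nonneg) auto
  ultimately have "(SUP K. ennreal ((\<Sum>n<K. a n) powr p)) = ennreal ((\<Sum>n. a n) powr p)"
    using LIMSEQ_unique by blast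
  then show ?thesis using sa a by (simp add: suminf_ennreal2 ennreal_powr_ennreal suminf_nonneg)
next
  case True
  have "\<exists>K\<in>UNIV. of_nat N \<le> ennreal ((\<Sum>n<K. a n) powr p)" for N
  proof -
    have "ennreal (max 1 (real N)) < (SUP K. \<Sum>n<K. ennreal (a n))"
      using True unfolding suminf_eq_SUP by (simp only: ennreal_less_top)
    then obtain K where "ennreal (max 1 (real N)) < (\<Sum>n<K. ennreal (a n))"
      by (auto simp: less_SUP_iff)
    then have K: "max 1 (real N) < (\<Sum>n<K. a n)"
      using a by (simp add: sum_ennreal ennreal_less_iff)
    have "real N \<le> (\<Sum>n<K. a n) powr 1" using K by simp
    also have "\<dots> \<le> (\<Sum>n<K. a n) powr p" using K p by (intro powr_mono) auto
    finally show ?thesis by (auto simp: ennreal_of_nat_eq_real_of_nat intro!: ennreal_leI)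
  qed
  then have "(SUP K. ennreal ((\<Sum>n<K. a n) powr p)) = \<top>"
    by (rule ennreal_SUP_eq_top)
  with True show ?thesis by (simp only: ennreal_powr_top)
qed

lemma tendsto_0_if_eventually_less:
  fixes f :: "'b \<Rightarrow> ennreal"
  assumes "\<And>e::real. 0 < e \<Longrightarrow> \<forall>\<^sub>F i in F. f i \<le> ennreal e"
  shows "(f \<longlongrightarrow> 0) F"
proof (rule order_tendstoI)
  fix y :: ennreal assume "0 < y"
  then obtain e :: real where e: "0 < e" "ennreal e < y"
    using dense[of 0 y] by (metis ennreal_cases ennreal_less_zero_iff less_top top_greatest not_less)
  then show "\<forall>\<^sub>F i in F. f i < y"
    using assms[OF e(1)] by (auto elim!: eventually_mono)
qed auto

lemma tendsto_0_le_ennreal: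
  fixes f g :: "'b \<Rightarrow> ennreal"
  assumes "\<And>i. f i \<le> g i" "(g \<longlongrightarrow> 0) F"
  shows "(f \<longlongrightarrow> 0) F"
  by (rule tendsto_sandwich[OF _ _ tendsto_const assms(2)]) (simp_all add: assms(1))

lemma ennreal_suminf_tail_tendsto_0:
  fixes a :: "nat \<Rightarrow> ennreal"
  assumes "(\<Sum>n. a n) < \<top>"
  shows "(\<lambda>N. \<Sum>n. a (n + N)) \<longlonglongrightarrow> 0"
proof -
  have "a n < \<top>" for n
    using sum_le_suminf[of a "{n}"] assms by (auto intro: le_less_trans)
  then have an: "a n = ennreal (enn2real (a n))" for n by (simp add: less_top)
  define r where "r n = enn2real (a n)" for n
  have ar: "a = (\<lambda>n. ennreal (r n))" using an by (auto simp: r_def)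
  have r: "0 \<le> r n" for n by (simp add: r_def)
  have sr: "summable r" using assms r unfolding ar by (intro summable_suminf_not_top) auto
  have "(\<lambda>N. suminf r - (\<Sum>n<N. r n)) \<longlonglongrightarrow> suminf r - suminf r"
    by (intro tendsto_diff tendsto_const summable_LIMSEQ sr)
  then have "(\<lambda>N. ennreal (\<Sum>n. r (n + N))) \<longlonglongrightarrow> ennreal 0"
    by (intro tendsto_ennrealI) (simp add: suminf_minus_initial_segment[OF sr])
  then show ?thesis
    using r sr by (simp add: ar suminf_ennreal2 summable_ignore_initial_segment)
qed

section \<open>Absolutely convergent series in L_p\<close>

lemma nn_integral_powr_suminf_le:
  fixes u :: "nat \<Rightarrow> 'a \<Rightarrow> 'x::real_normed_vector"
  assumes p: "1 \<le> p" and u: "\<And>n. strongly_measurable M (u n)"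
  shows "(\<integral>\<^sup>+w. ennreal_powr (\<Sum>n. ennreal (norm (u n w))) p \<partial>M) \<le> ennreal_powr (\<Sum>n. Lp_norm p M (u n)) p"
proof -
  note [measurable] = strongly_measurable_norm[OF u]
  let ?h = "\<lambda>K w. \<Sum>n<K. norm (u n w)"
  have "(\<integral>\<^sup>+w. ennreal_powr (\<Sum>n. ennreal (norm (u n w))) p \<partial>M) = (\<integral>\<^sup>+w. (SUP K. ennreal (?h K w powr p)) \<partial>M)"
    by (simp add: ennreal_powr_suminf_eq_SUP p)
  also have "\<dots> = (SUP K. \<integral>\<^sup>+w. ennreal (?h K w powr p) \<partial>M)"
    using p by (intro nn_integral_monotone_convergence_SUP)
      (auto simp: incseq_Suc_iff le_fun_def intro!: ennreal_leI powr_mono2 sum_nonneg)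
  also have "\<dots> \<le> ennreal_powr (\<Sum>n. Lp_norm p M (u n)) p"
  proof (rule SUP_least)
    fix K
    have "(\<integral>\<^sup>+w. ennreal (?h K w powr p) \<partial>M) = ennreal_powr (Lp_norm p M (?h K)) p"
      using p by (simp add: Lp_norm_def ennreal_powr_powr' sum_nonneg)
    also have "\<dots> \<le> ennreal_powr (\<Sum>n. Lp_norm p M (u n)) p"
    proof (rule ennreal_powr_mono)
      have "Lp_norm p M (?h K) \<le> (\<Sum>n<K. Lp_norm p M (\<lambda>w. norm (u n w)))"
        by (intro Lp_norm_sum p strongly_measurable_real) auto
      also have "\<dots> = (\<Sum>n<K. Lp_norm p M (u n))" by (simp add: Lp_norm_norm)
      also have "\<dots> \<le> (\<Sum>n. Lp_norm p M (u n))" by (rule sum_le_suminf) auto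
      finally show "Lp_norm p M (?h K) \<le> (\<Sum>n. Lp_norm p M (u n))" .
    qed (use p in auto)
    finally show "(\<integral>\<^sup>+w. ennreal (?h K w powr p) \<partial>M) \<le> ennreal_powr (\<Sum>n. Lp_norm p M (u n)) p" .
  qed
  finally show ?thesis .
qed

lemma Lp_norm_suminf_le:
  fixes u :: "nat \<Rightarrow> 'a \<Rightarrow> 'x::real_normed_vector"
  assumes p: "1 \<le> p" and u: "\<And>n. strongly_measurable M (u n)"
    and g: "AE w in M. ennreal (norm (g w)) \<le> (\<Sum>n. ennreal (norm (u n w)))"
  shows "Lp_norm p M g \<le> (\<Sum>n. Lp_norm p M (u n))"
proof -
  have "(\<integral>\<^sup>+w. ennreal (norm (g w) powr p) \<partial>M) \<le> (\<integral>\<^sup>+w. ennreal_powr (\<Sum>n. ennreal (norm (u n w))) p \<partial>M)"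
  proof (rule nn_integral_mono_AE, use g in eventually_elim)
    case (elim w)
    then have "ennreal_powr (ennreal (norm (g w))) p \<le> ennreal_powr (\<Sum>n. ennreal (norm (u n w))) p"
      using p by (intro ennreal_powr_mono) auto
    then show ?case by (simp add: ennreal_powr_ennreal)
  qed
  also have "\<dots> \<le> ennreal_powr (\<Sum>n. Lp_norm p M (u n)) p"
    by (rule nn_integral_powr_suminf_le[OF p u])
  finally have "Lp_norm p M g \<le> ennreal_powr (ennreal_powr (\<Sum>n. Lp_norm p M (u n)) p) (1 / p)"
    unfolding Lp_norm_def[of p M g] using p by (intro ennreal_powr_mono) auto
  then show ?thesis using p by (simp add: ennreal_powr_powr)
qed

lemma AE_suminf_norm_finite:
  fixes u :: "nat \<Rightarrow> 'a \<Rightarrow> 'x::real_normed_vector"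
  assumes p: "1 \<le> p" and u: "\<And>n. strongly_measurable M (u n)"
    and fin: "(\<Sum>n. Lp_norm p M (u n)) < \<top>"
  shows "AE w in M. (\<Sum>n. ennreal (norm (u n w))) < \<top>"
proof -
  note [measurable] = strongly_measurable_norm[OF u]
  have "(\<integral>\<^sup>+w. ennreal_powr (\<Sum>n. ennreal (norm (u n w))) p \<partial>M) \<noteq> \<infinity>"
    using nn_integral_powr_suminf_le[of p M u, OF p u] fin
    by (auto simp: top_unique ennreal_powr_eq_top_iff)
  moreover have "(\<lambda>w. ennreal_powr (\<Sum>n. ennreal (norm (u n w))) p) \<in> borel_measurable M"
    using p by (subst ennreal_powr_suminf_eq_SUP) auto
  ultimately have "AE w in M. ennreal_powr (\<Sum>n. ennreal (norm (u n w))) p \<noteq> \<infinity>"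
    by (intro nn_integral_PInf_AE)
  then show ?thesis by eventually_elim (auto simp: ennreal_powr_eq_top_iff less_top)
qed

lemma summable_norm_iff_ennreal:
  "summable (\<lambda>n. norm (x n)) \<longleftrightarrow> (\<Sum>n. ennreal (norm (x n))) < \<top>"
proof
  assume "summable (\<lambda>n. norm (x n))"
  then show "(\<Sum>n. ennreal (norm (x n))) < \<top>" by (simp add: suminf_ennreal2)
next
  assume "(\<Sum>n. ennreal (norm (x n))) < \<top>"
  then show "summable (\<lambda>n. norm (x n))" by (intro summable_suminf_not_top) auto
qed

lemma norm_diff_suminf_le:
  fixes x :: "nat \<Rightarrow> 'x::banach"
  assumes "summable (\<lambda>n. norm (x n))"
  shows "ennreal (norm ((\<Sum>n<N. x n) - (\<Sum>n. x n))) \<le> (\<Sum>n. ennreal (norm (x (n + N))))"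
proof -
  have "(\<Sum>n. x n) - (\<Sum>n<N. x n) = (\<Sum>n. x (n + N))"
    by (rule suminf_minus_initial_segment[OF summable_norm_cancel[OF assms], symmetric])
  then have "norm ((\<Sum>n<N. x n) - (\<Sum>n. x n)) = norm (\<Sum>n. x (n + N))"
    by (metis norm_minus_commute)
  also have "\<dots> \<le> (\<Sum>n. norm (x (n + N)))"
    using assms by (intro summable_norm summable_ignore_initial_segment[where f="\<lambda>n. norm (x n)"])
  finally show ?thesis
    using summable_ignore_initial_segment[OF assms, of N] by (simp add: suminf_ennreal2 ennreal_leI)
qed

lemma strongly_measurable_If_suminf:
  fixes u :: "nat \<Rightarrow> 'a \<Rightarrow> 'x::banach"
  assumes u: "\<And>n. strongly_measurable M (u n)" and A: "A \<in> sets M"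
    and sm: "\<And>w. w \<in> A \<Longrightarrow> summable (\<lambda>n. u n w)"
  shows "strongly_measurable M (\<lambda>w. if w \<in> A then \<Sum>n. u n w else 0)"
proof (rule strongly_measurable_limit)
  show "strongly_measurable M (\<lambda>w. indicator A w *\<^sub>R (\<Sum>n<N. u n w))" for N
    using A by (intro strongly_measurable_scaleR_fun strongly_measurable_sum u strongly_measurable_simple) auto
  show "(\<lambda>N. indicator A w *\<^sub>R (\<Sum>n<N. u n w)) \<longlonglongrightarrow> (if w \<in> A then \<Sum>n. u n w else 0)" if "w \<in> space M" for w
    using summable_LIMSEQ[OF sm] by (auto simp: indicator_def)
qed

text \<open>The error of a partial sum is dominated pointwise by a tail of the series of norms, and
  Minkowski's inequality for series makes that tail small. This is the passage from pointwise sums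
  to sums in L_p.\<close>

lemma Lp_sums_AE_suminf:
  fixes u :: "nat \<Rightarrow> 'a \<Rightarrow> 'x::banach"
  assumes p: "1 \<le> p" and u: "\<And>n. u n \<in> Lp_space p M"
    and fin: "(\<Sum>n. Lp_norm p M (u n)) < \<top>"
    and g: "strongly_measurable M g" "AE w in M. g w = (\<Sum>n. u n w)"
  shows "Lp_sums p M u g"
proof -
  note um = Lp_spaceD(1)[OF u]
  have ae: "AE w in M. summable (\<lambda>n. norm (u n w))"
    using AE_suminf_norm_finite[OF p um fin] by (simp add: summable_norm_iff_ennreal)
  have diff: "Lp_norm p M (\<lambda>w. (\<Sum>n<N. u n w) - g w) \<le> (\<Sum>n. Lp_norm p M (u (n + N)))" for N
  proof (rule Lp_norm_suminf_le[OF p um])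
    show "AE w in M. ennreal (norm ((\<Sum>n<N. u n w) - g w)) \<le> (\<Sum>n. ennreal (norm (u (n + N) w)))"
      using ae g(2)
    proof eventually_elim
      case (elim w)
      show ?case unfolding elim(2) by (rule norm_diff_suminf_le[OF elim(1)])
    qed
  qed
  have "Lp_norm p M g \<le> (\<Sum>n. Lp_norm p M (u n))"
    using diff[of 0] by (simp add: Lp_norm_uminus)
  then have "g \<in> Lp_space p M" using g(1) fin by (simp add: Lp_space_def)
  moreover have "(\<lambda>N. Lp_norm p M (\<lambda>w. (\<Sum>n<N. u n w) - g w)) \<longlonglongrightarrow> 0"
    by (rule tendsto_0_le_ennreal[OF diff ennreal_suminf_tail_tendsto_0[OF fin]])
  ultimately show ?thesis using u by (simp add: Lp_sums_def)
qed

text \<open>Completeness of L_p in the form of Riesz and Fischer. Setting the sum to 0 off the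
  measurable set of absolute convergence yields a strongly measurable representative defined
  everywhere.\<close>

lemma Lp_sums_exists:
  fixes u :: "nat \<Rightarrow> 'a \<Rightarrow> 'x::banach"
  assumes p: "1 \<le> p" and u: "\<And>n. u n \<in> Lp_space p M"
    and fin: "(\<Sum>n. Lp_norm p M (u n)) < \<top>"
  shows "\<exists>g. Lp_sums p M u g"
proof -
  note um = Lp_spaceD(1)[OF u]
  note [measurable] = strongly_measurable_norm[OF um]
  define A where "A = {w \<in> space M. (\<Sum>n. ennreal (norm (u n w))) < \<top>}"
  have [measurable]: "A \<in> sets M" by (simp add: A_def)
  have A: "AE w in M. w \<in> A"
    using AE_suminf_norm_finite[OF p um fin] AE_space by eventually_elim (simp add: A_def)
  have "strongly_measurable M (\<lambda>w. if w \<in> A then \<Sum>n. u n w else 0)"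
  proof (rule strongly_measurable_If_suminf[OF um])
    fix w assume "w \<in> A"
    then have "summable (\<lambda>n. norm (u n w))" by (simp add: A_def summable_norm_iff_ennreal)
    then show "summable (\<lambda>n. u n w)" by (rule summable_norm_cancel)
  qed simp
  then have "Lp_sums p M u (\<lambda>w. if w \<in> A then \<Sum>n. u n w else 0)"
    using A by (intro Lp_sums_AE_suminf[OF p u fin]) (auto elim: eventually_mono)
  then show ?thesis by blast
qed

lemma Lp_sums_unique:
  assumes p: "1 \<le> p" and "Lp_sums p M u g" "Lp_sums p M u g'"
  shows "AE w in M. g w = g' w"
proof (rule Lp_limit_unique[OF p sequentially_bot])
  show "\<forall>\<^sub>F N in sequentially. strongly_measurable M (\<lambda>w. \<Sum>n<N. u n w)"
    using assms by (auto simp: Lp_sums_def Lp_space_def intro!: always_eventually strongly_measurable_sum)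
qed (use assms in \<open>auto simp: Lp_sums_def Lp_space_def\<close>)

lemma Lp_sums_cong:
  assumes "Lp_sums p M u g" "\<And>n. AE w in M. u n w = v n w" "AE w in M. g w = h w"
    and "\<And>n. v n \<in> Lp_space p M" "h \<in> Lp_space p M"
  shows "Lp_sums p M v h"
proof -
  have "Lp_norm p M (\<lambda>w. (\<Sum>n<N. u n w) - g w) = Lp_norm p M (\<lambda>w. (\<Sum>n<N. v n w) - h w)" for N
  proof (rule Lp_norm_cong)
    have "AE w in M. \<forall>n. u n w = v n w" using assms(2) by (simp add: AE_all_countable)
    then show "AE w in M. (\<Sum>n<N. u n w) - g w = (\<Sum>n<N. v n w) - h w"
      using assms(3) by eventually_elim simp
  qed
  then show ?thesis using assms by (simp add: Lp_sums_def)
qed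

lemma Lp_norm_limit_le:
  assumes p: "1 \<le> p" and F: "F \<noteq> bot" and u: "\<And>i. strongly_measurable M (u i)" "strongly_measurable M g"
    and lim: "((\<lambda>i. Lp_norm p M (\<lambda>w. u i w - g w)) \<longlongrightarrow> 0) F" and le: "\<And>i. Lp_norm p M (u i) \<le> B"
  shows "Lp_norm p M g \<le> B"
proof -
  have "((\<lambda>i. B + Lp_norm p M (\<lambda>w. u i w - g w)) \<longlongrightarrow> B + 0) F"
    by (intro tendsto_add lim tendsto_const)
  moreover have "Lp_norm p M g \<le> B + Lp_norm p M (\<lambda>w. u i w - g w)" for i
  proof -
    have "Lp_norm p M (\<lambda>w. u i w + (g w - u i w)) \<le> Lp_norm p M (u i) + Lp_norm p M (\<lambda>w. g w - u i w)"
      by (intro Lp_norm_triangle p u strongly_measurable_diff)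
    then show ?thesis using le[of i] by (simp add: Lp_norm_minus_commute add_right_mono order_trans)
  qed
  ultimately show ?thesis using tendsto_lowerbound[OF _ _ F] by fastforce
qed

lemma Lp_norm_sums_le:
  assumes p: "1 \<le> p" and "Lp_sums p M u g"
  shows "Lp_norm p M g \<le> (\<Sum>n. Lp_norm p M (u n))"
proof (rule Lp_norm_limit_le[OF p sequentially_bot])
  have um: "strongly_measurable M (u n)" for n using assms by (auto simp: Lp_sums_def Lp_space_def)
  show "strongly_measurable M (\<lambda>w. \<Sum>n<i. u n w)" for i by (intro strongly_measurable_sum um)
  show "Lp_norm p M (\<lambda>w. \<Sum>n<i. u n w) \<le> (\<Sum>n. Lp_norm p M (u n))" for i
    by (rule order_trans[OF Lp_norm_sum[OF p um] sum_le_suminf]) auto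
qed (use assms in \<open>auto simp: Lp_sums_def Lp_space_def\<close>)

lemma Lp_tendsto_linear:
  assumes p: "1 \<le> p"
    and "\<And>i. strongly_measurable M (u i)" "\<And>i. strongly_measurable M (u' i)" "\<And>i. strongly_measurable M (v i)" "\<And>i. strongly_measurable M (v' i)"
    and lim: "((\<lambda>i. Lp_norm p M (\<lambda>w. u i w - v i w)) \<longlongrightarrow> 0) F" "((\<lambda>i. Lp_norm p M (\<lambda>w. u' i w - v' i w)) \<longlongrightarrow> 0) F"
  shows "((\<lambda>i. Lp_norm p M (\<lambda>w. (a *\<^sub>R u i w + b *\<^sub>R u' i w) - (a *\<^sub>R v i w + b *\<^sub>R v' i w))) \<longlongrightarrow> 0) F"
proof (rule tendsto_0_le_ennreal)
  let ?d = "\<lambda>i. ennreal \<bar>a\<bar> * Lp_norm p M (\<lambda>w. u i w - v i w) + ennreal \<bar>b\<bar> * Lp_norm p M (\<lambda>w. u' i w - v' i w)"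
  have "(?d \<longlongrightarrow> ennreal \<bar>a\<bar> * 0 + ennreal \<bar>b\<bar> * 0) F"
    by (intro tendsto_add ennreal_tendsto_cmult lim) auto
  then show "(?d \<longlongrightarrow> 0) F" by simp
  show "Lp_norm p M (\<lambda>w. (a *\<^sub>R u i w + b *\<^sub>R u' i w) - (a *\<^sub>R v i w + b *\<^sub>R v' i w)) \<le> ?d i" for i
  proof -
    have d: "strongly_measurable M (\<lambda>w. u i w - v i w)" "strongly_measurable M (\<lambda>w. u' i w - v' i w)"
      using assms by (auto intro: strongly_measurable_diff)
    have "Lp_norm p M (\<lambda>w. a *\<^sub>R (u i w - v i w) + b *\<^sub>R (u' i w - v' i w)) \<le>
      Lp_norm p M (\<lambda>w. a *\<^sub>R (u i w - v i w)) + Lp_norm p M (\<lambda>w. b *\<^sub>R (u' i w - v' i w))"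
      by (intro Lp_norm_triangle p strongly_measurable_scaleR d)
    moreover have "(a *\<^sub>R u i w + b *\<^sub>R u' i w) - (a *\<^sub>R v i w + b *\<^sub>R v' i w) = a *\<^sub>R (u i w - v i w) + b *\<^sub>R (u' i w - v' i w)" for w
      by (simp add: algebra_simps)
    ultimately show ?thesis using d p by (simp add: Lp_norm_scaleR)
  qed
qed

lemma Lp_norm_1_le:
  assumes "prob_space M" "1 \<le> p" and f: "strongly_measurable M f"
  shows "Lp_norm 1 M f \<le> Lp_norm p M f"
proof -
  interpret prob_space M by fact
  note [measurable] = strongly_measurable_norm[OF f]
  have "ennreal_powr (\<integral>\<^sup>+w. ennreal (norm (f w)) \<partial>M) p \<le> ennreal (1 powr (p - 1)) * (\<integral>\<^sup>+w. ennreal (norm (f w) powr p) \<partial>M)"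
    using assms by (intro nn_integral_powr_Jensen) (auto simp: emeasure_space_1)
  then have "ennreal_powr (ennreal_powr (\<integral>\<^sup>+w. ennreal (norm (f w)) \<partial>M) p) (1 / p) \<le> Lp_norm p M f"
    unfolding Lp_norm_def using assms by (intro ennreal_powr_mono) auto
  moreover have "ennreal_powr y 1 = y" for y by (cases y) (auto simp: ennreal_powr_ennreal)
  ultimately show ?thesis using assms by (simp add: ennreal_powr_powr Lp_norm_def)
qed

section \<open>Dominated convergence and density of step functions\<close>

lemma Lp_dominated_convergence:
  fixes u :: "nat \<Rightarrow> 'a \<Rightarrow> 'x::real_normed_vector" and h :: "'a \<Rightarrow> real"
  assumes p: "1 \<le> p" and u: "\<And>i. strongly_measurable M (u i)" and g: "strongly_measurable M g"
    and h: "h \<in> Lp_space p M" and le: "\<And>i w. w \<in> space M \<Longrightarrow> norm (u i w - g w) \<le> h w"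
    and lim: "\<And>w. w \<in> space M \<Longrightarrow> (\<lambda>i. u i w) \<longlonglongrightarrow> g w"
  shows "(\<lambda>i. Lp_norm p M (\<lambda>w. u i w - g w)) \<longlonglongrightarrow> 0"
proof -
  note [measurable] = strongly_measurable_norm[OF strongly_measurable_diff[OF u g]] strongly_measurable_imp_borel_measurable[OF Lp_spaceD(1)[OF h]]
  have "(\<lambda>i. \<integral>\<^sup>+w. ennreal (norm (u i w - g w) powr p) \<partial>M) \<longlonglongrightarrow> (\<integral>\<^sup>+w. 0 \<partial>M)"
  proof (rule nn_integral_dominated_convergence)
    show "AE w in M. ennreal (norm (u j w - g w) powr p) \<le> ennreal (norm (h w) powr p)" for j
    proof (rule AE_I2)
      fix w assume "w \<in> space M"
      from le[OF this, of j] show "ennreal (norm (u j w - g w) powr p) \<le> ennreal (norm (h w) powr p)"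
        using p by (intro ennreal_leI powr_mono2) auto
    qed
    show "(\<integral>\<^sup>+w. ennreal (norm (h w) powr p) \<partial>M) < \<infinity>"
      using Lp_spaceD(2)[OF h] by (simp add: Lp_norm_less_top_iff)
    show "AE w in M. (\<lambda>i. ennreal (norm (u i w - g w) powr p)) \<longlonglongrightarrow> 0"
    proof (rule AE_I2)
      fix w assume w: "w \<in> space M"
      have "(\<lambda>i. norm (u i w - g w)) \<longlonglongrightarrow> 0" using lim[OF w] by (simp add: LIM_zero tendsto_norm_zero)
      then have "(\<lambda>i. norm (u i w - g w) powr p) \<longlonglongrightarrow> 0 powr p"
        using p by (intro tendsto_powr' tendsto_const) auto
      then show "(\<lambda>i. ennreal (norm (u i w - g w) powr p)) \<longlonglongrightarrow> 0"
        using tendsto_ennrealI by fastforce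
    qed
  qed auto
  then have lim: "(\<lambda>i. \<integral>\<^sup>+w. ennreal (norm (u i w - g w) powr p) \<partial>M) \<longlonglongrightarrow> 0" by simp
  show ?thesis
  proof (rule tendsto_0_if_eventually_less)
    fix e :: real assume e: "0 < e"
    have "\<forall>\<^sub>F i in sequentially. (\<integral>\<^sup>+w. ennreal (norm (u i w - g w) powr p) \<partial>M) < ennreal (e powr p)"
      using e by (intro order_tendstoD(2)[OF lim]) auto
    then show "\<forall>\<^sub>F i in sequentially. Lp_norm p M (\<lambda>w. u i w - g w) \<le> ennreal e"
    proof eventually_elim
      case (elim i)
      then have "Lp_norm p M (\<lambda>w. u i w - g w) \<le> ennreal_powr (ennreal (e powr p)) (1 / p)"
        unfolding Lp_norm_def using p by (intro ennreal_powr_mono) auto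
      then show ?case using e p by (simp add: ennreal_powr_ennreal powr_powr)
    qed
  qed
qed

lemma Lp_dense_simple:
  fixes f :: "'a \<Rightarrow> 'x::real_normed_vector"
  assumes p: "1 \<le> p" and f: "f \<in> Lp_space p M"
  shows "\<exists>s. (\<forall>i::nat. simple_function M (s i)) \<and> (\<lambda>i. Lp_norm p M (\<lambda>w. s i w - f w)) \<longlonglongrightarrow> 0"
proof -
  note fm = Lp_spaceD(1)[OF f]
  note [measurable] = strongly_measurable_norm[OF fm]
  from fm obtain r where r: "\<And>i. simple_function M (r i)" "\<And>w. w \<in> space M \<Longrightarrow> (\<lambda>i. r i w) \<longlonglongrightarrow> f w"
    unfolding strongly_measurable_def by auto
  note rm = strongly_measurable_simple[OF r(1)]
  note [measurable] = strongly_measurable_norm[OF rm]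
  \<comment> \<open>Cutting off where \<open>r i\<close> is too large gives domination by three
    times the norm of \<open>f\<close>. If \<open>f w \<noteq> 0\<close> the cut is eventually
    inactive; if \<open>f w = 0\<close> it forces \<open>s i w = 0\<close>.\<close>
  define A where "A i = {w \<in> space M. norm (r i w) \<le> 2 * norm (f w)}" for i
  have [measurable]: "A i \<in> sets M" for i by (simp add: A_def)
  define s where "s i w = indicat_real (A i) w *\<^sub>R r i w" for i w
  have s: "simple_function M (s i)" for i
    unfolding s_def[abs_def] by (intro simple_function_compose2[where h="(*\<^sub>R)"] r simple_function_indicator) simp
  have "(\<lambda>i. Lp_norm p M (\<lambda>w. s i w - f w)) \<longlonglongrightarrow> 0"
  proof (rule Lp_dominated_convergence[OF p strongly_measurable_simple[OF s] fm])
    have "Lp_norm p M (\<lambda>w. 3 *\<^sub>R norm (f w)) < \<top>"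
      using Lp_spaceD[OF Lp_space_scaleR[OF p f, of 3]] by (simp add: Lp_norm_def)
    then show "(\<lambda>w. 3 * norm (f w)) \<in> Lp_space p M"
      by (auto simp: Lp_space_def intro!: strongly_measurable_real)
    show "norm (s i w - f w) \<le> 3 * norm (f w)" for i w
      using norm_triangle_ineq4[of "s i w" "f w"] by (auto simp: s_def A_def indicator_def split: if_splits)
    show "(\<lambda>i. s i w) \<longlonglongrightarrow> f w" if w: "w \<in> space M" for w
    proof (cases "f w = 0")
      case True
      then have "s i w = 0" for i by (auto simp: s_def A_def indicator_def)
      with True show ?thesis by simp
    next
      case False
      have "(\<lambda>i. norm (r i w)) \<longlonglongrightarrow> norm (f w)" using r(2)[OF w] by (rule tendsto_norm)
      moreover have "norm (f w) < 2 * norm (f w)" using False by simp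
      ultimately have "\<forall>\<^sub>F i in sequentially. norm (r i w) < 2 * norm (f w)" by (rule order_tendstoD(2))
      then have "\<forall>\<^sub>F i in sequentially. r i w = s i w"
        by eventually_elim (use w in \<open>auto simp: s_def A_def\<close>)
      with r(2)[OF w] show ?thesis by (rule Lim_transform_eventually)
    qed
  qed
  with s show ?thesis by blast
qed

section \<open>Conditional expectations of vector-valued functions\<close>

locale Lp_subalgebra = prob_space M for M :: "'a measure" +
  fixes F :: "'a measure" and p :: real
  assumes subalg: "subalgebra M F" and p: "1 \<le> p"
begin

abbreviation Np :: "('a \<Rightarrow> 'x::real_normed_vector) \<Rightarrow> ennreal" where "Np \<equiv> Lp_norm p M"
abbreviation Lp :: "('a \<Rightarrow> 'x::real_normed_vector) set" where "Lp \<equiv> Lp_space p M"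

sublocale finite_measure_subalgebra M F
  by unfold_locales (rule subalg)

abbreviation "R \<equiv> real_cond_exp M F"

lemma integrable_Lp:
  fixes h :: "'a \<Rightarrow> real"
  assumes h: "h \<in> Lp"
  shows "integrable M h" "integrable M (\<lambda>w. \<bar>h w\<bar> powr p)"
proof -
  have [measurable]: "h \<in> borel_measurable M"
    using strongly_measurable_imp_borel_measurable Lp_spaceD[OF h] by blast
  have "Lp_norm 1 M h < \<top>"
    using Lp_norm_1_le[OF prob_space_axioms p Lp_spaceD(1)[OF h]] Lp_spaceD(2)[OF h] by (rule le_less_trans)
  then show "integrable M h"
    by (intro integrableI_bounded) (auto simp: Lp_norm_less_top_iff)
  have "(\<integral>\<^sup>+w. ennreal (\<bar>h w\<bar> powr p) \<partial>M) < \<top>"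
    using Lp_spaceD(2)[OF h] by (simp add: Lp_norm_less_top_iff)
  then show "integrable M (\<lambda>w. \<bar>h w\<bar> powr p)"
    by (intro integrableI_bounded) auto
qed

lemma Lp_norm_real_cond_exp_le:
  assumes h: "h \<in> Lp"
  shows "Np (R h) \<le> Np h"
proof -
  note hi = integrable_Lp[OF h]
  have jensen: "AE w in M. \<bar>R h w\<bar> powr p \<le> R (\<lambda>w. \<bar>h w\<bar> powr p) w"
    by (rule real_cond_exp_jensens_inequality(2)[where q="\<lambda>x. \<bar>x\<bar> powr p", OF hi(1) _ _ hi(2) convex_on_abs_powr[OF p]]) auto
  have nonneg: "AE w in M. 0 \<le> R (\<lambda>w. \<bar>h w\<bar> powr p) w"
    using hi(2) by (intro real_cond_exp_pos) auto
  have "(\<integral>\<^sup>+w. ennreal (norm (R h w) powr p) \<partial>M) \<le> (\<integral>\<^sup>+w. ennreal (R (\<lambda>w. \<bar>h w\<bar> powr p) w) \<partial>M)"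
    by (rule nn_integral_mono_AE) (use jensen in \<open>eventually_elim, auto intro: ennreal_leI\<close>)
  also have "\<dots> = ennreal (\<integral>w. R (\<lambda>w. \<bar>h w\<bar> powr p) w \<partial>M)"
    by (rule nn_integral_eq_integral[OF real_cond_exp_int(1)[OF hi(2)] nonneg])
  also have "\<dots> = ennreal (\<integral>w. \<bar>h w\<bar> powr p \<partial>M)"
    by (simp add: real_cond_exp_int(2)[OF hi(2)])
  also have "\<dots> = (\<integral>\<^sup>+w. ennreal (norm (h w) powr p) \<partial>M)"
    using nn_integral_eq_integral[OF hi(2)] by simp
  finally show ?thesis unfolding Lp_norm_def using p by (intro ennreal_powr_mono) auto
qed

lemma Lp_space_real_cond_exp:
  assumes h: "h \<in> Lp"
  shows "R h \<in> Lp"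
  using Lp_norm_real_cond_exp_le[OF h] Lp_spaceD(2)[OF h]
  by (auto simp: Lp_space_def intro!: strongly_measurable_real intro: le_less_trans)

lemma simple_level_sets:
  "simple_function M u \<Longrightarrow> {v \<in> space M. u v = z} \<in> sets M"
  using simple_functionD(2)[of M u "{z}"] by (simp add: vimage_def Int_def conj_commute)

text \<open>\<open>tensor_simple\<close> sums over the distinct values of its argument, so different
  step functions can be compared only through a common refinement. The level sets of
  \<open>u\<close> refine those of \<open>h\<close> composed with \<open>u\<close>, and finite
  additivity of the conditional expectation allows regrouping.\<close>

lemma tensor_simple_compose:
  fixes h :: "'z \<Rightarrow> 'x::real_normed_vector"
  assumes u: "simple_function M u"
  shows "AE w in M. tensor_simple M R (\<lambda>v. h (u v)) w =
     (\<Sum>z\<in>u ` space M. R (indicator {v \<in> space M. u v = z}) w *\<^sub>R h z)"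
proof -
  let ?I = "\<lambda>z. indicat_real {v \<in> space M. u v = z}"
  have fin: "finite (u ` space M)" using u by (rule simple_functionD)
  have *: "AE w in M. R (indicator {v \<in> space M. h (u v) = y}) w = (\<Sum>z\<in>{z\<in>u ` space M. h z = y}. R (?I z) w)" for y
  proof -
    have "indicat_real {v \<in> space M. h (u v) = y} = (\<lambda>v. \<Sum>z\<in>{z\<in>u ` space M. h z = y}. ?I z v)"
    proof
      fix v
      show "indicat_real {v \<in> space M. h (u v) = y} v = (\<Sum>z\<in>{z\<in>u ` space M. h z = y}. ?I z v)"
      proof (cases "v \<in> space M \<and> h (u v) = y")
        case True
        then have "?I z v = (if z = u v then 1 else 0)" for z by (auto simp: indicator_def)
        with True fin show ?thesis by (simp add: sum.delta)
      next
        case False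
        then show ?thesis by (auto simp: indicator_def intro!: sum.neutral)
      qed
    qed
    moreover have "AE w in M. R (\<lambda>v. \<Sum>z\<in>{z\<in>u ` space M. h z = y}. ?I z v) w = (\<Sum>z\<in>{z\<in>u ` space M. h z = y}. R (?I z) w)"
      by (intro real_cond_exp_sum integrable_real_indicator simple_level_sets u) (simp add: emeasure_eq_measure)
    ultimately show ?thesis by simp
  qed
  have "finite ((\<lambda>v. h (u v)) ` space M)" using fin by (simp flip: image_image[of h u])
  then have "AE w in M. \<forall>y\<in>(\<lambda>v. h (u v)) ` space M. R (indicator {v \<in> space M. h (u v) = y}) w = (\<Sum>z\<in>{z\<in>u ` space M. h z = y}. R (?I z) w)"
    using * by (intro AE_finite_allI)
  then show ?thesis
  proof eventually_elim
    case (elim w)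
    have "tensor_simple M R (\<lambda>v. h (u v)) w = (\<Sum>y\<in>h ` (u ` space M). \<Sum>z\<in>{z\<in>u ` space M. h z = y}. R (?I z) w *\<^sub>R h z)"
      unfolding tensor_simple_def
      using elim by (intro sum.cong) (auto simp: image_image scaleR_sum_left intro!: sum.cong)
    also have "\<dots> = (\<Sum>z\<in>u ` space M. R (?I z) w *\<^sub>R h z)"
      using fin by (intro sum.group) auto
    finally show ?case .
  qed
qed

lemma tensor_simple_linear:
  fixes s s' :: "'a \<Rightarrow> 'x::real_normed_vector"
  assumes s: "simple_function M s" and s': "simple_function M s'"
  shows "AE w in M. tensor_simple M R (\<lambda>v. a *\<^sub>R s v + b *\<^sub>R s' v) w = a *\<^sub>R tensor_simple M R s w + b *\<^sub>R tensor_simple M R s' w"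
proof -
  \<comment> \<open>The pair is a common refinement of both step functions and of their linear
    combination.\<close>
  let ?u = "\<lambda>v. (s v, s' v)"
  have u: "simple_function M ?u" using s s' by simp
  show ?thesis
    using tensor_simple_compose[OF u, of "\<lambda>z. a *\<^sub>R fst z + b *\<^sub>R snd z"]
      tensor_simple_compose[OF u, of fst] tensor_simple_compose[OF u, of snd]
    by eventually_elim (simp add: scaleR_sum_right sum.distrib[symmetric] algebra_simps)
qed

lemma tensor_simple_real:
  assumes h: "simple_function M h"
  shows "AE w in M. tensor_simple M R h w = R h w"
proof -
  let ?I = "\<lambda>z. indicat_real {v \<in> space M. h v = z}"
  have int: "integrable M (?I z)" for z
    by (intro integrable_real_indicator simple_level_sets h) (simp add: emeasure_eq_measure)
  have [measurable]: "h \<in> borel_measurable M" using h by (rule borel_measurable_simple_function)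
  have [measurable]: "{v \<in> space M. h v = z} \<in> sets M" for z by measurable
  have "AE w in M. R h w = R (\<lambda>w. \<Sum>z\<in>h ` space M. z * ?I z w) w"
  proof (rule real_cond_exp_cong)
    show "AE w in M. h w = (\<Sum>z\<in>h ` space M. z * ?I z w)"
    proof (rule AE_I2)
      fix w assume w: "w \<in> space M"
      have "(\<Sum>z\<in>h ` space M. z * ?I z w) = (\<Sum>z\<in>{h w}. z * ?I z w)"
        using w simple_functionD(1)[OF h] by (intro sum.mono_neutral_right) (auto simp: indicator_def)
      then show "h w = (\<Sum>z\<in>h ` space M. z * ?I z w)" using w by simp
    qed
  qed auto
  moreover have "AE w in M. R (\<lambda>w. \<Sum>z\<in>h ` space M. z * ?I z w) w = (\<Sum>z\<in>h ` space M. R (\<lambda>w. z * ?I z w) w)"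
    by (intro real_cond_exp_sum integrable_mult_right int)
  moreover have "AE w in M. \<forall>z\<in>h ` space M. R (\<lambda>w. z * ?I z w) w = z * R (?I z) w"
    using simple_functionD(1)[OF h] by (intro AE_finite_allI real_cond_exp_cmult int)
  ultimately show ?thesis
    by eventually_elim (simp add: tensor_simple_def mult.commute)
qed

lemma strongly_measurable_tensor_simple:
  "strongly_measurable M (tensor_simple M R s)"
  unfolding tensor_simple_def[abs_def]
  by (intro strongly_measurable_sum strongly_measurable_scaleR_fun strongly_measurable_const strongly_measurable_real) measurable

text \<open>Positivity is what makes the extension work in every Banach space: the coefficients are
  nonnegative almost everywhere, so the triangle inequality leads back to the scalar operator
  applied to the norm.\<close>

lemma norm_tensor_simple_le:
  assumes s: "simple_function M s"
  shows "AE w in M. norm (tensor_simple M R s w) \<le> R (\<lambda>v. norm (s v)) w"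
proof -
  let ?I = "\<lambda>z. indicat_real {v \<in> space M. s v = z}"
  have [measurable]: "{v \<in> space M. s v = z} \<in> sets M" for z using s by (rule simple_level_sets)
  have n: "simple_function M (\<lambda>v. norm (s v))" using s by (rule simple_function_compose1)
  have "AE w in M. \<forall>z\<in>s ` space M. 0 \<le> R (?I z) w"
    using simple_functionD(1)[OF s] by (intro AE_finite_allI real_cond_exp_pos) auto
  with tensor_simple_compose[OF s, of norm] tensor_simple_real[OF n] show ?thesis
  proof eventually_elim
    case (elim w)
    have "norm (tensor_simple M R s w) \<le> (\<Sum>z\<in>s ` space M. norm (R (?I z) w *\<^sub>R z))"
      unfolding tensor_simple_def by (rule norm_sum)
    also have "\<dots> = (\<Sum>z\<in>s ` space M. R (?I z) w * norm z)"
      using elim by (intro sum.cong) auto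
    also have "\<dots> = R (\<lambda>v. norm (s v)) w"
      using elim by simp
    finally show ?case .
  qed
qed

lemma Lp_norm_tensor_simple_le:
  assumes s: "simple_function M s"
  shows "Np (tensor_simple M R s) \<le> Np s"
proof -
  have n: "simple_function M (\<lambda>v. norm (s v))" using s by (rule simple_function_compose1)
  have "Np (tensor_simple M R s) \<le> Np (R (\<lambda>v. norm (s v)))"
    by (rule Lp_norm_mono) (use norm_tensor_simple_le[OF s] p in \<open>auto elim!: eventually_mono\<close>)
  also have "\<dots> \<le> Np (\<lambda>v. norm (s v))"
    using p by (intro Lp_norm_real_cond_exp_le Lp_space_simple n) (auto intro: finite_measure_axioms)
  finally show ?thesis by (simp add: Lp_norm_norm)
qed

lemma Lp_space_simple': "simple_function M s \<Longrightarrow> s \<in> Lp"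
  using p by (intro Lp_space_simple finite_measure_axioms) auto

lemma Lp_space_tensor_simple:
  assumes s: "simple_function M s"
  shows "tensor_simple M R s \<in> Lp"
  using strongly_measurable_tensor_simple[of s] Lp_norm_tensor_simple_le[OF s] Lp_spaceD(2)[OF Lp_space_simple'[OF s]]
  by (auto simp: Lp_space_def intro: le_less_trans)

section \<open>Existence, uniqueness and linearity of the vector-valued extension\<close>

abbreviation "ext \<equiv> is_tensor_extension p M R"

lemma ext_simple:
  assumes s: "simple_function M s"
  shows "ext s (tensor_simple M R s)"
  unfolding is_tensor_extension_def
  using s Lp_space_tensor_simple[OF s] by (intro conjI exI[of _ "\<lambda>_. s"]) auto

lemma ext_0: "ext (\<lambda>w. 0 :: 'x::real_normed_vector) (\<lambda>w. 0)"
proof -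
  have "tensor_simple M R (\<lambda>w. 0 :: 'x) = (\<lambda>w. 0)"
    by (auto simp: tensor_simple_def fun_eq_iff intro!: sum.neutral)
  then show ?thesis using ext_simple[of "\<lambda>w. 0 :: 'x"] by simp
qed

lemma ext_linear:
  assumes "ext f g" "ext f' g'" and f: "strongly_measurable M f" "strongly_measurable M f'"
  shows "ext (\<lambda>w. a *\<^sub>R f w + b *\<^sub>R f' w) (\<lambda>w. a *\<^sub>R g w + b *\<^sub>R g' w)"
proof -
  from assms(1) obtain s where g: "g \<in> Lp" and s: "\<And>i::nat. simple_function M (s i)"
    and sf: "(\<lambda>i. Np (\<lambda>w. s i w - f w)) \<longlonglongrightarrow> 0"
    and sg: "(\<lambda>i. Np (\<lambda>w. tensor_simple M R (s i) w - g w)) \<longlonglongrightarrow> 0"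
    unfolding is_tensor_extension_def by blast
  from assms(2) obtain s' where g': "g' \<in> Lp" and s': "\<And>i::nat. simple_function M (s' i)"
    and sf': "(\<lambda>i. Np (\<lambda>w. s' i w - f' w)) \<longlonglongrightarrow> 0"
    and sg': "(\<lambda>i. Np (\<lambda>w. tensor_simple M R (s' i) w - g' w)) \<longlonglongrightarrow> 0"
    unfolding is_tensor_extension_def by blast
  let ?s = "\<lambda>i w. a *\<^sub>R s i w + b *\<^sub>R s' i w"
  have "simple_function M (?s i)" for i
    by (intro simple_function_compose2[OF s s', of "\<lambda>x y. a *\<^sub>R x + b *\<^sub>R y"])
  moreover have "(\<lambda>i. Np (\<lambda>w. ?s i w - (a *\<^sub>R f w + b *\<^sub>R f' w))) \<longlonglongrightarrow> 0"
    by (intro Lp_tendsto_linear p strongly_measurable_simple s s' f sf sf')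
  moreover have "(\<lambda>i. Np (\<lambda>w. tensor_simple M R (?s i) w - (a *\<^sub>R g w + b *\<^sub>R g' w))) \<longlonglongrightarrow> 0"
  proof -
    have "Np (\<lambda>w. tensor_simple M R (?s i) w - (a *\<^sub>R g w + b *\<^sub>R g' w)) =
      Np (\<lambda>w. (a *\<^sub>R tensor_simple M R (s i) w + b *\<^sub>R tensor_simple M R (s' i) w) - (a *\<^sub>R g w + b *\<^sub>R g' w))" for i
      by (rule Lp_norm_cong) (use tensor_simple_linear[OF s[of i] s'[of i], of a b] in \<open>eventually_elim, simp\<close>)
    then show ?thesis
      using Lp_tendsto_linear[OF p strongly_measurable_tensor_simple strongly_measurable_tensor_simple Lp_spaceD(1)[OF g] Lp_spaceD(1)[OF g'] sg sg']
      by simp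
  qed
  moreover have "(\<lambda>w. a *\<^sub>R g w + b *\<^sub>R g' w) \<in> Lp"
    by (intro Lp_space_add Lp_space_scaleR p g g')
  ultimately show ?thesis unfolding is_tensor_extension_def by (intro conjI exI[of _ ?s] allI)
qed

lemma Lp_norm_ext_le:
  assumes "ext f g" and f: "strongly_measurable M f"
  shows "Np g \<le> Np f"
proof -
  from assms(1) obtain s where g: "g \<in> Lp" and s: "\<And>i::nat. simple_function M (s i)"
    and sf: "(\<lambda>i. Np (\<lambda>w. s i w - f w)) \<longlonglongrightarrow> 0"
    and sg: "(\<lambda>i. Np (\<lambda>w. tensor_simple M R (s i) w - g w)) \<longlonglongrightarrow> 0"
    unfolding is_tensor_extension_def by blast
  note sm = strongly_measurable_simple[OF s] strongly_measurable_tensor_simple Lp_spaceD(1)[OF g]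
  have "Np g \<le> Np (\<lambda>w. tensor_simple M R (s i) w - g w) + (Np (\<lambda>w. s i w - f w) + Np f)" for i
  proof -
    have "Np (\<lambda>w. (g w - tensor_simple M R (s i) w) + tensor_simple M R (s i) w) \<le>
      Np (\<lambda>w. g w - tensor_simple M R (s i) w) + Np (tensor_simple M R (s i))"
      by (intro Lp_norm_triangle p strongly_measurable_diff sm)
    also have "\<dots> \<le> Np (\<lambda>w. g w - tensor_simple M R (s i) w) + Np (\<lambda>w. (s i w - f w) + f w)"
      using Lp_norm_tensor_simple_le[OF s] by (intro add_left_mono) simp
    also have "\<dots> \<le> Np (\<lambda>w. g w - tensor_simple M R (s i) w) + (Np (\<lambda>w. s i w - f w) + Np f)"
      by (intro add_left_mono Lp_norm_triangle p strongly_measurable_diff sm f)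
    finally show ?thesis by (simp add: Lp_norm_minus_commute)
  qed
  moreover have "(\<lambda>i. Np (\<lambda>w. tensor_simple M R (s i) w - g w) + (Np (\<lambda>w. s i w - f w) + Np f)) \<longlonglongrightarrow> 0 + (0 + Np f)"
    by (intro tendsto_add sf sg tendsto_const)
  ultimately show ?thesis using LIMSEQ_le_const by fastforce
qed

text \<open>The images of an approximating sequence of step functions are Cauchy because
  \<open>tensor_simple\<close> is linear and contractive almost everywhere. A rapidly convergent
  subsequence makes the telescoping series absolutely convergent.\<close>

lemma ext_exists:
  fixes f :: "'a \<Rightarrow> 'x::banach"
  assumes f: "f \<in> Lp"
  shows "\<exists>g. ext f g"
proof -
  note fm = Lp_spaceD(1)[OF f]
  obtain r where r: "\<And>i::nat. simple_function M (r i)" "(\<lambda>i. Np (\<lambda>w. r i w - f w)) \<longlonglongrightarrow> 0"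
    using Lp_dense_simple[OF p f] by blast
  have "\<exists>i. Np (\<lambda>w. r i w - f w) < ennreal ((1/2)^k)" for k
    using order_tendstoD(2)[OF r(2), of "ennreal ((1/2)^k)"] eventually_sequentially by (auto simp: eventually_sequentially)
  then obtain j where j: "\<And>k. Np (\<lambda>w. r (j k) w - f w) < ennreal ((1/2)^k)" by metis
  define s where "s k = r (j k)" for k
  have s: "simple_function M (s k)" for k using r by (simp add: s_def)
  note sm = strongly_measurable_simple[OF s]
  define e where "e k = tensor_simple M R (s k)" for k
  have e: "e k \<in> Lp" for k using Lp_space_tensor_simple[OF s] by (simp add: e_def)
  \<comment> \<open>The first \<open>Suc N\<close> terms of this telescoping series add up to
    \<open>e N\<close>.\<close>
  define u where "u k = (if k = 0 then e 0 else (\<lambda>w. e k w - e (k - 1) w))" for k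
  have u: "u k \<in> Lp" for k using e Lp_space_diff[OF p e e] by (auto simp: u_def)
  have uS: "Np (u (Suc k)) \<le> ennreal (2 * (1/2)^k)" for k
  proof -
    have "Np (u (Suc k)) = Np (tensor_simple M R (\<lambda>v. 1 *\<^sub>R s (Suc k) v + (-1) *\<^sub>R s k v))"
      by (rule Lp_norm_cong) (use tensor_simple_linear[OF s[of "Suc k"] s[of k], of 1 "-1"] in \<open>eventually_elim, simp add: u_def e_def\<close>)
    also have "\<dots> \<le> Np (\<lambda>v. 1 *\<^sub>R s (Suc k) v + (-1) *\<^sub>R s k v)"
      by (intro Lp_norm_tensor_simple_le simple_function_compose2[OF s s, of "\<lambda>x y. 1 *\<^sub>R x + (-1) *\<^sub>R y"])
    also have "\<dots> \<le> Np (\<lambda>w. s (Suc k) w - f w) + Np (\<lambda>w. f w - s k w)"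
      using Lp_norm_triangle_diff[OF p sm fm sm] by simp
    also have "\<dots> \<le> ennreal ((1/2)^Suc k) + ennreal ((1/2)^k)"
      using j[of k] j[of "Suc k"] by (intro add_mono) (auto simp: s_def Lp_norm_minus_commute[of p M f])
    also have "\<dots> \<le> ennreal (2 * (1/2)^k)" by (auto simp flip: ennreal_plus intro!: ennreal_leI)
    finally show ?thesis .
  qed
  have "(\<Sum>k. Np (u k)) = (\<Sum>k. Np (u (k + 1))) + (\<Sum>k<1. Np (u k))"
    by (rule suminf_offset) simp
  also have "(\<Sum>k. Np (u (k + 1))) \<le> (\<Sum>k. ennreal (2 * (1/2)^k))"
    using uS by (intro suminf_le) auto
  also have "(\<Sum>k. ennreal (2 * (1/2)^k)) + (\<Sum>k<1. Np (u k)) < \<top>"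
    using Lp_spaceD(2)[OF u, of 0] by (simp add: suminf_ennreal2 summable_mult summable_geometric)
  finally have "(\<Sum>k. Np (u k)) < \<top>" by (simp add: add_right_mono)
  then obtain g where g: "Lp_sums p M u g" using Lp_sums_exists[where u=u, OF p u] by blast
  have "(\<Sum>n<Suc N. u n w) = e N w" for N w
    by (induction N) (auto simp: u_def)
  then have "(\<lambda>N. Np (\<lambda>w. e N w - g w)) \<longlonglongrightarrow> 0"
    using LIMSEQ_Suc[of "\<lambda>N. Np (\<lambda>w. (\<Sum>n<N. u n w) - g w)"] g by (auto simp: Lp_sums_def simp del: sum.lessThan_Suc)
  moreover have "(\<lambda>k. Np (\<lambda>w. s k w - f w)) \<longlonglongrightarrow> 0"
  proof (rule tendsto_0_le_ennreal)
    show "Np (\<lambda>w. s k w - f w) \<le> ennreal ((1/2)^k)" for k using j[of k] by (simp add: s_def less_imp_le)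
    have "(\<lambda>k. ennreal ((1/2)^k)) \<longlonglongrightarrow> ennreal 0" by (intro tendsto_ennrealI LIMSEQ_power_zero) simp
    then show "(\<lambda>k. ennreal ((1/2)^k)) \<longlonglongrightarrow> 0" by simp
  qed
  ultimately have "ext f g"
    using s g unfolding is_tensor_extension_def e_def by (auto simp: Lp_sums_def)
  then show ?thesis by blast
qed

text \<open>Iterated conditional expectations of step functions have coefficients
  \<open>R (indicator B)\<close>, which need not be simple; hence the scalar factor ranges over all
  of L_p.\<close>

lemma ext_scaleR_const:
  assumes h: "h \<in> Lp"
  shows "ext (\<lambda>w. h w *\<^sub>R y) (\<lambda>w. R h w *\<^sub>R y)"
proof -
  obtain s where s: "\<And>i::nat. simple_function M (s i)" "(\<lambda>i. Np (\<lambda>w. s i w - h w)) \<longlonglongrightarrow> 0"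
    using Lp_dense_simple[OF p h] by blast
  have norm_y: "Np (\<lambda>w. k w *\<^sub>R y) = ennreal (norm y) * Np k" if "strongly_measurable M k" for k
  proof -
    have "Np (\<lambda>w. k w *\<^sub>R y) = Np (\<lambda>w. norm y *\<^sub>R k w)"
      by (simp add: Lp_norm_def abs_mult mult.commute)
    then show ?thesis using Lp_norm_scaleR[OF _ that, of p "norm y"] p by simp
  qed
  have lim: "(\<lambda>i. ennreal (norm y) * Np (\<lambda>w. s i w - h w)) \<longlonglongrightarrow> 0"
    using ennreal_tendsto_cmult[OF _ s(2), of "ennreal (norm y)"] by simp
  have d: "(\<lambda>w. s i w - h w) \<in> Lp" for i by (intro Lp_space_diff p Lp_space_simple' s h)
  have "simple_function M (\<lambda>w. s i w *\<^sub>R y)" for i by (rule simple_function_compose1[OF s(1)])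
  moreover have "(\<lambda>i. Np (\<lambda>w. s i w *\<^sub>R y - h w *\<^sub>R y)) \<longlonglongrightarrow> 0"
    using lim norm_y[OF Lp_spaceD(1)[OF d]] by (simp add: scaleR_diff_left)
  moreover have "(\<lambda>i. Np (\<lambda>w. tensor_simple M R (\<lambda>v. s i v *\<^sub>R y) w - R h w *\<^sub>R y)) \<longlonglongrightarrow> 0"
  proof (rule tendsto_0_le_ennreal[OF _ lim])
    fix i
    have "Np (\<lambda>w. tensor_simple M R (\<lambda>v. s i v *\<^sub>R y) w - R h w *\<^sub>R y) = Np (\<lambda>w. R (\<lambda>w. s i w - h w) w *\<^sub>R y)"
    proof (rule Lp_norm_cong)
      show "AE w in M. tensor_simple M R (\<lambda>v. s i v *\<^sub>R y) w - R h w *\<^sub>R y = R (\<lambda>w. s i w - h w) w *\<^sub>R y"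
        using tensor_simple_compose[OF s(1)[of i], of "\<lambda>z. z *\<^sub>R y"] tensor_simple_real[OF s(1)[of i]]
          real_cond_exp_diff[OF integrable_Lp(1)[OF Lp_space_simple'[OF s(1)[of i]]] integrable_Lp(1)[OF h]]
        by eventually_elim (simp add: tensor_simple_def scaleR_sum_left[symmetric] scaleR_diff_left)
    qed
    also have "\<dots> = ennreal (norm y) * Np (R (\<lambda>w. s i w - h w))"
      by (rule norm_y[OF Lp_spaceD(1)[OF Lp_space_real_cond_exp[OF d]]])
    also have "\<dots> \<le> ennreal (norm y) * Np (\<lambda>w. s i w - h w)"
      by (intro mult_left_mono Lp_norm_real_cond_exp_le d) simp
    finally show "Np (\<lambda>w. tensor_simple M R (\<lambda>v. s i v *\<^sub>R y) w - R h w *\<^sub>R y) \<le> ennreal (norm y) * Np (\<lambda>w. s i w - h w)" .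
  qed
  moreover have "(\<lambda>w. R h w *\<^sub>R y) \<in> Lp"
    using norm_y[OF Lp_spaceD(1)[OF Lp_space_real_cond_exp[OF h]]] Lp_spaceD[OF Lp_space_real_cond_exp[OF h]]
    by (auto simp: Lp_space_def ennreal_mult_less_top intro!: strongly_measurable_scaleR_fun)
  ultimately show ?thesis unfolding is_tensor_extension_def by (intro conjI exI[of _ "\<lambda>i w. s i w *\<^sub>R y"] allI)
qed

text \<open>The choice is written as in \<open>mart_E\<close>, so that both agree literally for
  indices at least 1.\<close>

definition Lp_E :: "('a \<Rightarrow> 'x::banach) \<Rightarrow> 'a \<Rightarrow> 'x" where
  "Lp_E f = (SOME g. ext f g)"

lemma ext_Lp_E: "f \<in> Lp \<Longrightarrow> ext f (Lp_E f)"
  unfolding Lp_E_def using ext_exists by (rule someI_ex)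

lemma Lp_E_space: "f \<in> Lp \<Longrightarrow> Lp_E f \<in> Lp"
  using ext_Lp_E unfolding is_tensor_extension_def by blast

lemma Lp_E_norm_le: "f \<in> Lp \<Longrightarrow> Np (Lp_E f) \<le> Np f"
  using ext_Lp_E Lp_norm_ext_le Lp_spaceD by blast

text \<open>The difference of the two candidates extends the operator at the function 0, and the
  norm bound makes it vanish.\<close>

lemma ext_unique:
  assumes "ext f g" "ext f g'" "strongly_measurable M f"
  shows "AE w in M. g w = g' w"
proof -
  have "ext (\<lambda>w. 1 *\<^sub>R f w + (-1) *\<^sub>R f w) (\<lambda>w. 1 *\<^sub>R g w + (-1) *\<^sub>R g' w)"
    using assms by (intro ext_linear)
  from Lp_norm_ext_le[OF this] have "Np (\<lambda>w. g w - g' w) = 0" by simp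
  moreover have "strongly_measurable M (\<lambda>w. g w - g' w)"
    using assms by (intro strongly_measurable_diff) (auto simp: is_tensor_extension_def Lp_space_def)
  ultimately show ?thesis by (simp add: Lp_norm_eq_0_iff)
qed

lemma Lp_E_eqI:
  assumes "f \<in> Lp" "ext f g"
  shows "AE w in M. Lp_E f w = g w"
  using ext_unique[OF ext_Lp_E[OF assms(1)] assms(2)] Lp_spaceD(1)[OF assms(1)] by blast

lemma Lp_E_linear:
  assumes "f \<in> Lp" "f' \<in> Lp"
  shows "AE w in M. Lp_E (\<lambda>w. a *\<^sub>R f w + b *\<^sub>R f' w) w = a *\<^sub>R Lp_E f w + b *\<^sub>R Lp_E f' w"
  using assms by (intro Lp_E_eqI ext_linear ext_Lp_E Lp_space_add Lp_space_scaleR p) (auto dest: Lp_spaceD)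

lemma Lp_E_diff:
  assumes "f \<in> Lp" "f' \<in> Lp"
  shows "AE w in M. Lp_E (\<lambda>w. f w - f' w) w = Lp_E f w - Lp_E f' w"
  using Lp_E_linear[OF assms, of 1 "-1"] by simp

lemma Lp_E_diff_norm_le:
  assumes "f \<in> Lp" "f' \<in> Lp"
  shows "Np (\<lambda>w. Lp_E f w - Lp_E f' w) \<le> Np (\<lambda>w. f w - f' w)"
proof -
  have "Np (\<lambda>w. Lp_E f w - Lp_E f' w) = Np (Lp_E (\<lambda>w. f w - f' w))"
    by (rule Lp_norm_cong) (use Lp_E_diff[OF assms] in \<open>eventually_elim, simp\<close>)
  also have "\<dots> \<le> Np (\<lambda>w. f w - f' w)"
    using assms by (intro Lp_E_norm_le Lp_space_diff p)
  finally show ?thesis .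
qed

text \<open>Representatives are chosen separately for each function, so almost everywhere equality
  of the arguments is transferred through the norm bound.\<close>

lemma Lp_E_cong:
  fixes f f' :: "'a \<Rightarrow> 'x::banach"
  assumes "f \<in> Lp" "f' \<in> Lp" "AE w in M. f w = f' w"
  shows "AE w in M. Lp_E f w = Lp_E f' w"
proof -
  have "Np (\<lambda>w. f w - f' w) = Np (\<lambda>w. 0::'x)"
    by (rule Lp_norm_cong) (use assms(3) in \<open>eventually_elim, simp\<close>)
  then have "Np (\<lambda>w. Lp_E f w - Lp_E f' w) = 0"
    using Lp_E_diff_norm_le[OF assms(1,2)] by simp
  moreover have "strongly_measurable M (\<lambda>w. Lp_E f w - Lp_E f' w)"
    using assms by (intro strongly_measurable_diff Lp_spaceD(1)[OF Lp_E_space])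
  ultimately show ?thesis by (simp add: Lp_norm_eq_0_iff)
qed

lemma Lp_E_sum_scaleR_const:
  fixes y :: "'i \<Rightarrow> 'x::banach"
  assumes h: "\<And>i. i \<in> I \<Longrightarrow> h i \<in> Lp"
  shows "AE w in M. Lp_E (\<lambda>w. \<Sum>i\<in>I. h i w *\<^sub>R y i) w = (\<Sum>i\<in>I. R (h i) w *\<^sub>R y i)"
proof -
  have hy: "(\<lambda>w. h i w *\<^sub>R y i) \<in> Lp" if "i \<in> I" for i
  proof -
    have "Np (\<lambda>w. h i w *\<^sub>R y i) = Np (\<lambda>w. norm (y i) *\<^sub>R h i w)"
      by (simp add: Lp_norm_def abs_mult mult.commute)
    then show ?thesis
      using Lp_space_scaleR[OF p h[OF that], of "norm (y i)"] Lp_spaceD(1)[OF h[OF that]]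
      by (auto simp: Lp_space_def intro!: strongly_measurable_scaleR_fun)
  qed
  have "ext (\<lambda>w. \<Sum>i\<in>I. h i w *\<^sub>R y i) (\<lambda>w. \<Sum>i\<in>I. R (h i) w *\<^sub>R y i)"
    using h hy
  proof (induction I rule: infinite_finite_induct)
    case (insert i I)
    then have "ext (\<lambda>w. 1 *\<^sub>R (h i w *\<^sub>R y i) + 1 *\<^sub>R (\<Sum>i\<in>I. h i w *\<^sub>R y i)) (\<lambda>w. 1 *\<^sub>R (R (h i) w *\<^sub>R y i) + 1 *\<^sub>R (\<Sum>i\<in>I. R (h i) w *\<^sub>R y i))"
      by (intro ext_linear ext_scaleR_const strongly_measurable_sum) (auto dest: Lp_spaceD)
    with insert show ?case by simp
  qed (auto intro: ext_0)
  then show ?thesis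
    using hy by (intro Lp_E_eqI Lp_space_sum p)
qed

end

section \<open>The tower property for vector-valued conditional expectations\<close>

lemma AE_eq_by_Lp_density:
  fixes \<Phi> \<Psi> :: "('a \<Rightarrow> 'x::real_normed_vector) \<Rightarrow> 'a \<Rightarrow> 'y::real_normed_vector"
  assumes p: "1 \<le> p" and fm: "finite_measure M"
    and sp: "\<And>f. f \<in> Lp_space p M \<Longrightarrow> \<Phi> f \<in> Lp_space p M" "\<And>f. f \<in> Lp_space p M \<Longrightarrow> \<Psi> f \<in> Lp_space p M"
    and le: "\<And>f g. f \<in> Lp_space p M \<Longrightarrow> g \<in> Lp_space p M \<Longrightarrow> Lp_norm p M (\<lambda>w. \<Phi> f w - \<Phi> g w) \<le> Lp_norm p M (\<lambda>w. f w - g w)"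
      "\<And>f g. f \<in> Lp_space p M \<Longrightarrow> g \<in> Lp_space p M \<Longrightarrow> Lp_norm p M (\<lambda>w. \<Psi> f w - \<Psi> g w) \<le> Lp_norm p M (\<lambda>w. f w - g w)"
    and eq: "\<And>s. simple_function M s \<Longrightarrow> AE w in M. \<Phi> s w = \<Psi> s w"
    and f: "f \<in> Lp_space p M"
  shows "AE w in M. \<Phi> f w = \<Psi> f w"
proof -
  obtain s where s: "\<And>i::nat. simple_function M (s i)" "(\<lambda>i. Lp_norm p M (\<lambda>w. s i w - f w)) \<longlonglongrightarrow> 0"
    using Lp_dense_simple[OF p f] by blast
  have sL: "s i \<in> Lp_space p M" for i using p by (intro Lp_space_simple fm s) simp
  have l: "(\<lambda>i. Lp_norm p M (\<lambda>w. \<Phi> (s i) w - \<Phi> f w)) \<longlonglongrightarrow> 0"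
    by (rule tendsto_0_le_ennreal[OF le(1)[OF sL f] s(2)])
  have "(\<lambda>i. Lp_norm p M (\<lambda>w. \<Psi> (s i) w - \<Psi> f w)) \<longlonglongrightarrow> 0"
    by (rule tendsto_0_le_ennreal[OF le(2)[OF sL f] s(2)])
  moreover have "Lp_norm p M (\<lambda>w. \<Psi> (s i) w - \<Psi> f w) = Lp_norm p M (\<lambda>w. \<Phi> (s i) w - \<Psi> f w)" for i
    by (rule Lp_norm_cong) (use eq[OF s(1)[of i]] in \<open>eventually_elim, simp\<close>)
  ultimately have l': "(\<lambda>i. Lp_norm p M (\<lambda>w. \<Phi> (s i) w - \<Psi> f w)) \<longlonglongrightarrow> 0" by simp
  show ?thesis
    by (rule Lp_limit_unique[OF p sequentially_bot always_eventually[OF allI] _ _ l l'])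
       (intro Lp_spaceD(1)[of _ p] sp sL f)+
qed

text \<open>Both compositions are contractive on differences, so density reduces the claim to step
  functions, and linearity reduces it further to the scalar tower property for indicators.\<close>

lemma Lp_E_tower:
  fixes f :: "'a \<Rightarrow> 'x::banach"
  assumes G: "Lp_subalgebra M G p" and F: "Lp_subalgebra M F p" and FG: "subalgebra G F" and f: "f \<in> Lp_space p M"
  shows "AE w in M. Lp_subalgebra.Lp_E M F p (Lp_subalgebra.Lp_E M G p f) w = Lp_subalgebra.Lp_E M F p f w"
    and "AE w in M. Lp_subalgebra.Lp_E M G p (Lp_subalgebra.Lp_E M F p f) w = Lp_subalgebra.Lp_E M F p f w"
proof -
  interpret G: Lp_subalgebra M G p by fact
  interpret F: Lp_subalgebra M F p by fact
  note p = F.p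
  have fm: "finite_measure M" by unfold_locales
  \<comment> \<open>One argument covers both orders: \<open>H\<close> is the outer algebra,
    \<open>K\<close> the inner one, and \<open>nest\<close> is the scalar identity for that
    order.\<close>
  have simple: "AE w in M. Lp_subalgebra.Lp_E M H p (Lp_subalgebra.Lp_E M K p s) w = Lp_subalgebra.Lp_E M F p s w"
    if "Lp_subalgebra M H p" "Lp_subalgebra M K p" and s: "simple_function M s"
      and nest: "\<And>h. h \<in> Lp_space p M \<Longrightarrow> AE w in M. real_cond_exp M H (real_cond_exp M K h) w = real_cond_exp M F h w"
    for s :: "'a \<Rightarrow> 'x" and H K
  proof -
    interpret H: Lp_subalgebra M H p by fact
    interpret K: Lp_subalgebra M K p by fact
    let ?I = "\<lambda>y. indicat_real {v \<in> space M. s v = y}"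
    have I: "?I y \<in> Lp_space p M" for y
      by (intro F.Lp_space_simple' simple_function_indicator F.simple_level_sets s)
    note RI = K.Lp_space_real_cond_exp[OF I]
    have sL: "s \<in> Lp_space p M" using s by (rule F.Lp_space_simple')
    have 1: "AE w in M. K.Lp_E s w = (\<Sum>y\<in>s ` space M. K.R (?I y) w *\<^sub>R y)"
      using K.Lp_E_eqI[OF sL K.ext_simple[OF s]] by (simp add: tensor_simple_def)
    have 2: "AE w in M. F.Lp_E s w = (\<Sum>y\<in>s ` space M. F.R (?I y) w *\<^sub>R y)"
      using F.Lp_E_eqI[OF sL F.ext_simple[OF s]] by (simp add: tensor_simple_def)
    have "(\<lambda>w. \<Sum>y\<in>s ` space M. K.R (?I y) w *\<^sub>R y) \<in> Lp_space p M"
      using K.Lp_space_tensor_simple[OF s] by (simp add: tensor_simple_def[abs_def])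
    from H.Lp_E_cong[OF K.Lp_E_space[OF sL] this 1]
    have 3: "AE w in M. H.Lp_E (K.Lp_E s) w = H.Lp_E (\<lambda>w. \<Sum>y\<in>s ` space M. K.R (?I y) w *\<^sub>R y) w" .
    have 4: "AE w in M. H.Lp_E (\<lambda>w. \<Sum>y\<in>s ` space M. K.R (?I y) w *\<^sub>R y) w = (\<Sum>y\<in>s ` space M. H.R (K.R (?I y)) w *\<^sub>R y)"
      by (rule H.Lp_E_sum_scaleR_const[OF RI])
    have "AE w in M. \<forall>y\<in>s ` space M. H.R (K.R (?I y)) w = F.R (?I y) w"
      using simple_functionD(1)[OF s] nest[OF I] by (intro AE_finite_allI)
    with 2 3 4 show ?thesis by eventually_elim simp
  qed
  have 1: "AE w in M. F.R (G.R h) w = F.R h w" if "h \<in> Lp_space p M" for h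
    by (intro F.real_cond_exp_nested_subalg G.subalg FG F.integrable_Lp that)
  have 2: "AE w in M. G.R (F.R h) w = F.R h w" if "h \<in> Lp_space p M" for h
    by (intro G.real_cond_exp_F_meas F.real_cond_exp_int(1) F.integrable_Lp that measurable_from_subalg[OF FG]) simp
  show "AE w in M. F.Lp_E (G.Lp_E f) w = F.Lp_E f w"
    by (rule AE_eq_by_Lp_density[OF p fm _ _ _ _ _ f, where \<Phi>="\<lambda>f. F.Lp_E (G.Lp_E f)" and \<Psi>="F.Lp_E"])
       (auto intro!: F.Lp_E_space G.Lp_E_space F.Lp_E_diff_norm_le order_trans[OF F.Lp_E_diff_norm_le G.Lp_E_diff_norm_le] simple[OF F G _ 1])
  show "AE w in M. G.Lp_E (F.Lp_E f) w = F.Lp_E f w"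
    by (rule AE_eq_by_Lp_density[OF p fm _ _ _ _ _ f, where \<Phi>="\<lambda>f. G.Lp_E (F.Lp_E f)" and \<Psi>="F.Lp_E"])
       (auto intro!: F.Lp_E_space G.Lp_E_space F.Lp_E_diff_norm_le order_trans[OF G.Lp_E_diff_norm_le F.Lp_E_diff_norm_le] simple[OF G F _ 2])
qed

section \<open>Square functions of lacunary exponential sums\<close>

declare suminf_ennreal [simp del]

abbreviation \<phi> :: "real \<Rightarrow> real" where "\<phi> x \<equiv> x * exp (- x)"

text \<open>The ratio is chosen large enough for the off-diagonal terms in \<open>heat_deriv_lower\<close> to have total
  weight at most \<open>1/54\<close>, which is half of the lower bound \<open>1/27\<close> for the diagonal term.\<close>

abbreviation \<mu> :: "nat \<Rightarrow> real" where "\<mu> n \<equiv> 1024 ^ Suc n"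

lemma \<phi>_le_self: "0 \<le> x \<Longrightarrow> \<phi> x \<le> x"
  by (simp add: mult_left_le)

lemma \<phi>_le_inverse:
  assumes "0 < x"
  shows "\<phi> x \<le> 4 / x"
proof -
  \<comment> \<open>Squaring gives \<open>x * x / 4 \<le> exp x\<close>, which is the origin of the
    constant 4.\<close>
  have "x / 2 \<le> exp (x / 2)"
    using exp_ge_add_one_self[of "x/2"] by linarith
  then have "(x / 2)\<^sup>2 \<le> (exp (x / 2))\<^sup>2"
    using assms by (intro power_mono) auto
  also have "\<dots> = exp x" by (simp flip: exp_double)
  finally have "x * x \<le> 4 * exp x" by (simp add: power2_eq_square)
  then show ?thesis using assms by (simp add: exp_minus field_simps)
qed

lemma \<phi>_le_1: "\<phi> x \<le> 1"
proof -
  have "x \<le> exp x" using exp_ge_add_one_self[of x] by linarith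
  then show ?thesis by (simp add: exp_minus field_simps)
qed

lemma \<phi>_ge:
  assumes "1 \<le> x" "x \<le> exp 1"
  shows "1 / 27 \<le> \<phi> x"
proof -
  \<comment> \<open>From \<open>x \<le> exp 1 \<le> 3\<close> one gets
    \<open>exp x \<le> exp 3 \<le> 3 ^ 3\<close>, hence the constant 27.\<close>
  have "exp (3::real) = exp 1 ^ 3" by (simp flip: exp_of_nat_mult)
  also have "\<dots> \<le> 3 ^ 3" by (intro power_mono exp_le) simp
  finally have "exp (3::real) \<le> 27" by simp
  moreover have "x \<le> 3" using assms exp_le by linarith
  then have "exp x \<le> exp 3" by simp
  ultimately have "exp x \<le> 27" by linarith
  then show ?thesis using assms by (simp add: exp_minus field_simps)
qed

text \<open>With truncated subtraction \<open>(n - k) + (k - n)\<close> is the distance of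
  \<open>n\<close> and \<open>k\<close>. Removing the diagonal from the geometric kernel makes its
  row sums of order \<open>r\<close>.\<close>

definition offdiag :: "real \<Rightarrow> nat \<Rightarrow> nat \<Rightarrow> real" where
  "offdiag r k n = (if n = k then 0 else r ^ ((n - k) + (k - n)))"

lemma offdiag_commute: "offdiag r k n = offdiag r n k"
  by (simp add: offdiag_def add.commute)

lemma offdiag_nonneg: "0 \<le> r \<Longrightarrow> 0 \<le> offdiag r k n"
  by (simp add: offdiag_def)

text \<open>Each side of the diagonal is part of a geometric series with sum
  \<open>r / (1 - r)\<close>.\<close>

lemma suminf_offdiag_le:
  assumes r: "0 \<le> r" "r < 1"
  shows "(\<Sum>n. ennreal (offdiag r k n)) \<le> ennreal (2 * r / (1 - r))"
proof -
  have g: "summable (\<lambda>n. r * r ^ n)" "(\<Sum>n. r * r ^ n) = r / (1 - r)"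
    using r by (auto intro!: summable_mult summable_geometric simp: suminf_mult suminf_geometric)
  have 1: "(\<Sum>n. ennreal (offdiag r k (n + Suc k))) = ennreal (r / (1 - r))"
    using r g by (simp add: offdiag_def suminf_ennreal2)
  have "(\<Sum>n<k. offdiag r k n) = (\<Sum>n<k. offdiag r k (k - Suc n))"
    by (rule sum.nat_diff_reindex[symmetric])
  also have "\<dots> = (\<Sum>n<k. r * r ^ n)"
    by (intro sum.cong) (auto simp: offdiag_def Suc_diff_Suc)
  also have "\<dots> \<le> r / (1 - r)"
    using r g sum_le_suminf[of "\<lambda>n. r * r ^ n" "{..<k}"] by simp
  finally have 2: "(\<Sum>n<Suc k. offdiag r k n) \<le> r / (1 - r)" by (simp add: offdiag_def)
  have "(\<Sum>n. ennreal (offdiag r k n)) = (\<Sum>n. ennreal (offdiag r k (n + Suc k))) + (\<Sum>n<Suc k. ennreal (offdiag r k n))"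
    by (rule suminf_offset) simp
  also have "\<dots> = ennreal (r / (1 - r)) + ennreal (\<Sum>n<Suc k. offdiag r k n)"
    unfolding 1 using r by (subst sum_ennreal) (auto intro: offdiag_nonneg)
  also have "\<dots> \<le> ennreal (r / (1 - r)) + ennreal (r / (1 - r))"
    by (intro add_left_mono ennreal_leI 2)
  also have "\<dots> = ennreal (2 * r / (1 - r))"
    using r by (simp flip: ennreal_plus)
  finally show ?thesis .
qed

lemma suminf_\<phi>_le:
  assumes t: "0 < t"
  shows "(\<Sum>n. ennreal (\<phi> (\<mu> n * t))) \<le> 4"
proof -
  have "\<exists>n. 1 / t < 1024 ^ n" by (rule real_arch_pow) simp
  then obtain m where "1 / t < 1024 ^ m" ..
  moreover have "(1024::real) ^ m \<le> 1024 ^ Suc m" by simp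
  ultimately have ex: "\<exists>n. 1 < \<mu> n * t" using t by (intro exI[of _ m]) (simp add: field_simps)
  \<comment> \<open>\<open>k\<close> is the first index with argument above 1: below it
    \<open>\<phi> x \<le> x\<close> gives geometric decay, above it
    \<open>\<phi> x \<le> 4 / x\<close> does. The neighbours of \<open>k\<close> are bounded only by
    1, whence the factor 1024 in front of the kernel. The total is 1 + 2048/1023, below 4.\<close>
  define k where "k = (LEAST n. 1 < \<mu> n * t)"
  have k: "1 < \<mu> k * t" unfolding k_def using ex by (rule LeastI_ex)
  have nk: "\<mu> n * t \<le> 1" if "n < k" for n using not_less_Least[of n] that unfolding k_def by fastforce
  have "\<phi> (\<mu> n * t) \<le> (if n = k then 1 else 0) + 1024 * offdiag (1/1024) k n" for n
  proof -
    consider "n = k" | "n < k" | "k < n" by linarith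
    then show ?thesis
    proof cases
      case 1
      then show ?thesis using \<phi>_le_1[of "\<mu> k * t"] by (simp add: offdiag_def)
    next
      case 2
      define j where "j = k - Suc n"
      have kn: "k = Suc n + j" using 2 by (simp add: j_def)
      have "\<mu> (k - 1) * t \<le> 1" using 2 by (intro nk) simp
      then have "\<mu> n * 1024 ^ j * t \<le> 1" by (simp add: kn power_add mult_ac)
      then have "\<mu> n * t \<le> (1/1024) ^ j" by (simp add: field_simps power_one_over)
      moreover have "\<phi> (\<mu> n * t) \<le> \<mu> n * t" using t by (intro \<phi>_le_self) auto
      ultimately have "\<phi> (\<mu> n * t) \<le> (1/1024) ^ j" by (rule order_trans[rotated])
      also have "(1/1024) ^ j = 1024 * offdiag (1/1024) k n" by (simp add: offdiag_def kn)
      finally show ?thesis using 2 by simp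
    next
      case 3
      then obtain j where n: "n = Suc (k + j)" using less_imp_Suc_add by blast
      have "\<phi> (\<mu> n * t) \<le> 4 / (\<mu> n * t)" using t by (intro \<phi>_le_inverse) auto
      also have "4 / (\<mu> n * t) = 4 / ((\<mu> k * t) * (1024 * 1024 ^ j))" by (simp add: n power_add)
      also have "\<dots> \<le> 4 / (1 * (1024 * 1024 ^ j))"
        using k t by (intro divide_left_mono mult_right_mono mult_pos_pos) auto
      also have "\<dots> \<le> (1 / 1024) ^ j" by (simp add: power_one_over field_simps)
      also have "\<dots> = 1024 * offdiag (1/1024) k n" by (simp add: offdiag_def n)
      finally show ?thesis using 3 by simp
    qed
  qed
  then have "ennreal (\<phi> (\<mu> n * t)) \<le> ennreal ((if n = k then 1 else 0) + 1024 * offdiag (1/1024) k n)" for n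
    by (rule ennreal_leI)
  also have "ennreal ((if n = k then 1 else 0) + 1024 * offdiag (1/1024) k n) = (if n = k then 1 else 0) + 1024 * ennreal (offdiag (1/1024) k n)" for n
    by (subst ennreal_plus) (auto simp: offdiag_nonneg ennreal_mult')
  finally have "ennreal (\<phi> (\<mu> n * t)) \<le> (if n = k then 1 else 0) + 1024 * ennreal (offdiag (1/1024) k n)" for n .
  then have "(\<Sum>n. ennreal (\<phi> (\<mu> n * t))) \<le> (\<Sum>n. (if n = k then 1 else 0) + 1024 * ennreal (offdiag (1/1024) k n))"
    by (intro suminf_le) auto
  also have "\<dots> = (\<Sum>n. if n = k then 1 else 0) + (\<Sum>n. 1024 * ennreal (offdiag (1/1024) k n))"
    by (intro suminf_add[symmetric]) auto
  also have "\<dots> = 1 + 1024 * (\<Sum>n. ennreal (offdiag (1/1024) k n))"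
    using suminf_finite[of "{k}" "\<lambda>n. if n = k then 1 else 0 :: ennreal"] by (simp add: ennreal_suminf_cmult)
  also have "\<dots> \<le> 1 + 1024 * ennreal (2 * (1/1024) / (1 - 1/1024))"
    by (intro add_left_mono mult_left_mono suminf_offdiag_le) auto
  also have "\<dots> = ennreal (1 + 1024 * (2 * (1/1024) / (1 - 1/1024)))"
    by (simp add: ennreal_mult'[symmetric] flip: ennreal_numeral ennreal_1 ennreal_plus)
  also have "\<dots> \<le> ennreal 4" by (intro ennreal_leI) simp
  finally show ?thesis by simp
qed

text \<open>On the positive half-line the integrand is the density of the exponential distribution
  with parameter \<open>l\<close>.\<close>

lemma nn_integral_\<phi>_le:
  assumes "0 < l"
  shows "(\<integral>\<^sup>+t\<in>{0<..}. ennreal (\<phi> (l * t) / t) \<partial>lborel) \<le> 1"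
proof -
  interpret prob_space "density lborel (exponential_density l)"
    using assms by (rule prob_space_exponential_density)
  have "(\<integral>\<^sup>+t\<in>{0<..}. ennreal (\<phi> (l * t) / t) \<partial>lborel) \<le> (\<integral>\<^sup>+t. ennreal (exponential_density l t) \<partial>lborel)"
    using assms by (intro nn_integral_mono) (auto simp: exponential_density_def indicator_def mult.commute)
  also have "\<dots> = 1"
    using emeasure_space_1 by (simp add: emeasure_density)
  finally show ?thesis .
qed

lemma ennreal_norm_suminf_le:
  fixes x :: "nat \<Rightarrow> 'x::banach"
  assumes "summable (\<lambda>n. norm (x n))"
  shows "ennreal (norm (\<Sum>n. x n)) \<le> (\<Sum>n. ennreal (norm (x n)))"
  using norm_diff_suminf_le[OF assms, of 0] by simp

lemma ennreal_powr_add_le: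
  assumes q: "1 \<le> q" and "x \<le> y + z"
  shows "ennreal_powr x q \<le> ennreal (2 powr (q - 1)) * (ennreal_powr y q + ennreal_powr z q)"
proof (cases "y = \<top> \<or> z = \<top>")
  case True
  then show ?thesis by (auto simp: ennreal_mult_top)
next
  case False
  then obtain a b where ab: "y = ennreal a" "z = ennreal b" "0 \<le> a" "0 \<le> b"
    by (metis ennreal_cases)
  have "ennreal_powr x q \<le> ennreal_powr (ennreal (a + b)) q"
    using assms ab by (intro ennreal_powr_mono) auto
  also have "\<dots> = ennreal ((a + b) powr q)" using ab by (intro ennreal_powr_ennreal) simp
  also have "(a + b) powr q = 2 powr q * ((1 - 1/2) *\<^sub>R a + (1/2) *\<^sub>R b) powr q"
    using ab by (simp flip: powr_mult)
  also have "\<dots> \<le> 2 powr q * ((1 - 1/2) * a powr q + (1/2) * b powr q)"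
    using ab convex_onD[OF convex_on_powr_atLeast[OF q], of "1/2" a b] by (intro mult_left_mono) auto
  also have "\<dots> = 2 powr (q - 1) * (a powr q + b powr q)"
    by (simp add: powr_diff field_simps)
  finally show ?thesis
    using ab by (simp add: ennreal_powr_ennreal ennreal_leI flip: ennreal_mult ennreal_plus)
qed

text \<open>Up to its sign the derivative at time \<open>t\<close> of \<open>\<Sum>\<^sub>n exp (- \<mu> n t) x\<^sub>n\<close>.\<close>

definition heat_deriv :: "(nat \<Rightarrow> 'x::banach) \<Rightarrow> real \<Rightarrow> 'x" where
  "heat_deriv x t = (\<Sum>n. (\<mu> n * exp (- \<mu> n * t)) *\<^sub>R x n)"

text \<open>The true decay is that of 1 / \<open>\<mu> n\<close>. The weaker factor
  \<open>(1/2) ^ n\<close> suffices and separates \<open>n\<close> from \<open>t\<close>, so that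
  one summability condition on the vectors covers all positive times.\<close>

lemma \<mu>_exp_le:
  assumes "0 < t"
  shows "\<mu> n * exp (- \<mu> n * t) \<le> 4 / t\<^sup>2 * (1/2) ^ n"
proof -
  have "\<phi> (\<mu> n * t) \<le> 4 / (\<mu> n * t)" using assms by (intro \<phi>_le_inverse) auto
  then have "\<mu> n * exp (- \<mu> n * t) \<le> 4 / t\<^sup>2 * (1 / \<mu> n)"
    using assms by (simp add: field_simps power2_eq_square)
  also have "\<dots> \<le> 4 / t\<^sup>2 * (1 / 2 ^ n)"
  proof (intro mult_left_mono divide_left_mono)
    have "(2::real) ^ n \<le> 1024 ^ n" by (intro power_mono) auto
    also have "\<dots> \<le> \<mu> n" by simp
    finally show "(2::real) ^ n \<le> \<mu> n" .
  qed auto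
  finally show ?thesis by (simp add: power_one_over)
qed

section \<open>Two-sided square function estimates for a fixed sequence of vectors\<close>

context
  fixes x :: "nat \<Rightarrow> 'x::banach"
  assumes sx: "summable (\<lambda>n. (1/2) ^ n * norm (x n))"
begin

abbreviation "speed t \<equiv> norm (t *\<^sub>R heat_deriv x t)"

lemma summable_heat_deriv:
  assumes t: "0 < t"
  shows "summable (\<lambda>n. norm ((\<mu> n * exp (- \<mu> n * t)) *\<^sub>R x n))"
proof (rule summable_comparison_test')
  show "summable (\<lambda>n. 4 / t\<^sup>2 * ((1/2) ^ n * norm (x n)))" by (intro summable_mult sx)
  show "norm (norm ((\<mu> n * exp (- \<mu> n * t)) *\<^sub>R x n)) \<le> 4 / t\<^sup>2 * ((1/2) ^ n * norm (x n))" for n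
    using mult_right_mono[OF \<mu>_exp_le[OF t, of n], of "norm (x n)"] by (simp add: mult.assoc)
qed

lemma summable_\<phi>:
  assumes t: "0 < t"
  shows "summable (\<lambda>n. norm (\<phi> (\<mu> n * t) *\<^sub>R x n))"
  using summable_mult[OF summable_heat_deriv[OF t], of t] t by (simp add: mult_ac abs_mult)

lemma scaleR_heat_deriv:
  assumes t: "0 < t"
  shows "t *\<^sub>R heat_deriv x t = (\<Sum>n. \<phi> (\<mu> n * t) *\<^sub>R x n)"
  unfolding heat_deriv_def
  using suminf_scaleR_right[OF summable_norm_cancel[OF summable_heat_deriv[OF t]], of t] by (simp add: mult_ac)

lemma strongly_measurable_heat_deriv:
  "strongly_measurable lborel (\<lambda>t. if t \<in> {0<..} then heat_deriv x t else 0)"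
  unfolding heat_deriv_def
proof (rule strongly_measurable_If_suminf)
  show "strongly_measurable lborel (\<lambda>t. (\<mu> n * exp (- \<mu> n * t)) *\<^sub>R x n)" for n
    by (intro strongly_measurable_scaleR_fun strongly_measurable_real strongly_measurable_const) simp
  show "summable (\<lambda>n. (\<mu> n * exp (- \<mu> n * t)) *\<^sub>R x n)" if "t \<in> {0<..}" for t
    using that by (intro summable_norm_cancel[OF summable_heat_deriv]) simp
qed simp

lemma measurable_heat_deriv_integrand:
  "(\<lambda>t. ennreal (speed t powr q / t) * indicator {0<..} t) \<in> borel_measurable lborel"
proof -
  have [measurable]: "(\<lambda>t. norm (if t \<in> {0<..} then heat_deriv x t else 0)) \<in> borel_measurable borel"
    using strongly_measurable_norm[OF strongly_measurable_heat_deriv] by simp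
  have "(\<lambda>t. ennreal (speed t powr q / t) * indicator {0<..} t) =
    (\<lambda>t. ennreal ((\<bar>t\<bar> * norm (if t \<in> {0<..} then heat_deriv x t else 0)) powr q / t) * indicator {0<..} t)"
    by (auto simp: fun_eq_iff indicator_def)
  also have "\<dots> \<in> borel_measurable lborel" by measurable
  finally show ?thesis .
qed

lemma heat_deriv_upper:
  assumes q: "1 \<le> q"
  shows "(\<integral>\<^sup>+t\<in>{0<..}. ennreal (speed t powr q / t) \<partial>lborel)
    \<le> ennreal (4 powr q) * (\<Sum>n. ennreal (norm (x n) powr q))"
proof -
  have "(\<integral>\<^sup>+t\<in>{0<..}. ennreal (speed t powr q / t) \<partial>lborel)
    \<le> (\<integral>\<^sup>+t. ennreal (4 powr (q - 1)) * (\<Sum>n. ennreal (norm (x n) powr q) * (ennreal (\<phi> (\<mu> n * t) / t) * indicator {0<..} t)) \<partial>lborel)"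
  proof (rule nn_integral_mono)
    fix t :: real
    show "ennreal (speed t powr q / t) * indicator {0<..} t \<le>
      ennreal (4 powr (q - 1)) * (\<Sum>n. ennreal (norm (x n) powr q) * (ennreal (\<phi> (\<mu> n * t) / t) * indicator {0<..} t))"
    proof (cases "0 < t")
      case True
      have "ennreal (speed t) \<le> (\<Sum>n. ennreal (norm (\<phi> (\<mu> n * t) *\<^sub>R x n)))"
        unfolding scaleR_heat_deriv[OF True] by (rule ennreal_norm_suminf_le[OF summable_\<phi>[OF True]])
      also have "\<dots> = (\<Sum>n. ennreal (\<phi> (\<mu> n * t) * norm (x n)))"
        using True by (intro suminf_cong arg_cong[where f=ennreal]) (simp add: abs_mult)
      finally have le: "ennreal (speed t) \<le> (\<Sum>n. ennreal (\<phi> (\<mu> n * t) * norm (x n)))" .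
      have "ennreal_powr (ennreal (speed t)) q \<le> ennreal_powr (\<Sum>n. ennreal (\<phi> (\<mu> n * t) * norm (x n))) q"
        using q by (intro ennreal_powr_mono le) simp
      also have "\<dots> \<le> ennreal (4 powr (q - 1)) * (\<Sum>n. ennreal (\<phi> (\<mu> n * t) * norm (x n) powr q))"
        using True suminf_\<phi>_le[OF True] by (intro suminf_powr_Jensen q) auto
      finally have "ennreal (speed t powr q) \<le> ennreal (4 powr (q - 1)) * (\<Sum>n. ennreal (\<phi> (\<mu> n * t) * norm (x n) powr q))"
        by (simp add: ennreal_powr_ennreal)
      then have "ennreal (1 / t) * ennreal (speed t powr q) \<le>
        ennreal (1 / t) * (ennreal (4 powr (q - 1)) * (\<Sum>n. ennreal (\<phi> (\<mu> n * t) * norm (x n) powr q)))"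
        by (intro mult_left_mono) auto
      also have "\<dots> = ennreal (4 powr (q - 1)) * (\<Sum>n. ennreal (1 / t) * ennreal (\<phi> (\<mu> n * t) * norm (x n) powr q))"
        by (simp add: ennreal_suminf_cmult mult_ac)
      also have "(\<lambda>n. ennreal (1 / t) * ennreal (\<phi> (\<mu> n * t) * norm (x n) powr q)) = (\<lambda>n. ennreal (norm (x n) powr q) * ennreal (\<phi> (\<mu> n * t) / t))"
        using True by (simp add: ennreal_mult'[symmetric] fun_eq_iff mult_ac)
      finally show ?thesis using True by (simp add: ennreal_mult'[symmetric])
    qed simp
  qed
  also have "\<dots> = ennreal (4 powr (q - 1)) * (\<Sum>n. ennreal (norm (x n) powr q) * (\<integral>\<^sup>+t\<in>{0<..}. ennreal (\<phi> (\<mu> n * t) / t) \<partial>lborel))"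
    by (simp add: nn_integral_cmult nn_integral_suminf)
  also have "\<dots> \<le> ennreal (4 powr (q - 1)) * (\<Sum>n. ennreal (norm (x n) powr q) * 1)"
    by (intro mult_left_mono suminf_le nn_integral_\<phi>_le) auto
  \<comment> \<open>Raising the exponent from \<open>q - 1\<close> to \<open>q\<close> makes the
    q-th root of the factor equal to 4 for every \<open>q\<close>.\<close>
  also have "\<dots> \<le> ennreal (4 powr q) * (\<Sum>n. ennreal (norm (x n) powr q))"
    by (auto intro!: mult_right_mono ennreal_leI powr_mono)
  finally show ?thesis .
qed

text \<open>The weights \<rho> are the finiteness device of \<open>heat_deriv_lower\<close>.
  Replacing \<open>\<rho> k\<close> by \<open>\<rho> n\<close> costs a factor 2 for each step
  between the indices, which turns the ratio 1/1024 of the kernel into 1/512; the bound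
  \<open>\<rho> k \<le> 1\<close> leaves the speed unweighted.\<close>

lemma norm_term_le_heat_deriv:
  assumes t: "1 / \<mu> k \<le> t" "t \<le> exp 1 / \<mu> k" and \<rho>: "0 \<le> \<rho> k" "\<rho> k \<le> 1" "\<And>n. \<rho> k \<le> 2 ^ ((n - k) + (k - n)) * \<rho> n"
  shows "ennreal (1/27 * (\<rho> k * norm (x k))) \<le> ennreal (speed t) + (\<Sum>n. ennreal (4 * offdiag (1/512) k n * (\<rho> n * norm (x n))))"
proof -
  have t0: "0 < t" using t(1) by (rule less_le_trans[rotated]) simp
  have \<mu>t: "1 \<le> \<mu> k * t" "\<mu> k * t \<le> exp 1" using t by (auto simp: field_simps)
  define f where "f n = \<phi> (\<mu> n * t) *\<^sub>R x n" for n
  \<comment> \<open>The k-th term is the difference between the full series and this off-diagonal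
    part.\<close>
  define g where "g n = (if n = k then 0 else f n)" for n
  have sf: "summable (\<lambda>n. norm (f n))" unfolding f_def by (rule summable_\<phi>[OF t0])
  have sg: "summable (\<lambda>n. norm (g n))"
    by (rule summable_comparison_test'[OF sf]) (auto simp: g_def)
  have "(\<lambda>n. f n - g n) sums (\<Sum>n\<in>{k}. f n - g n)"
    by (rule sums_finite) (auto simp: g_def)
  then have "(\<Sum>n. f n) - (\<Sum>n. g n) = f k"
    using suminf_diff[OF summable_norm_cancel[OF sf] summable_norm_cancel[OF sg]] by (simp add: sums_iff g_def)
  then have "norm (f k) \<le> norm (\<Sum>n. f n) + norm (\<Sum>n. g n)"
    by (metis norm_triangle_ineq4)
  moreover have "1 / 27 * norm (x k) \<le> \<phi> (\<mu> k * t) * norm (x k)"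
    by (intro mult_right_mono \<phi>_ge \<mu>t) simp
  moreover have "\<phi> (\<mu> k * t) * norm (x k) = norm (f k)"
    using t0 by (simp add: f_def abs_mult)
  moreover have "speed t = norm (\<Sum>n. f n)"
    unfolding f_def scaleR_heat_deriv[OF t0] ..
  ultimately have "1 / 27 * norm (x k) \<le> speed t + norm (\<Sum>n. g n)"
    by linarith
  then have "\<rho> k * (1 / 27 * norm (x k)) \<le> \<rho> k * (speed t + norm (\<Sum>n. g n))"
    using \<rho>(1) by (intro mult_left_mono)
  also have "\<dots> \<le> speed t + \<rho> k * norm (\<Sum>n. g n)"
    using \<rho>(1,2) by (simp add: distrib_left mult_left_le_one_le)
  finally have "ennreal (1/27 * (\<rho> k * norm (x k))) \<le> ennreal (speed t + \<rho> k * norm (\<Sum>n. g n))"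
    by (intro ennreal_leI) (simp add: mult_ac)
  also have "\<dots> = ennreal (speed t) + ennreal (\<rho> k) * ennreal (norm (\<Sum>n. g n))"
    using \<rho>(1) by (simp add: ennreal_mult)
  also have "ennreal (\<rho> k) * ennreal (norm (\<Sum>n. g n)) \<le> ennreal (\<rho> k) * (\<Sum>n. ennreal (norm (g n)))"
    by (intro mult_left_mono ennreal_norm_suminf_le sg) simp
  also have "\<dots> = (\<Sum>n. ennreal (\<rho> k * norm (g n)))"
    using \<rho>(1) by (simp add: ennreal_mult)
  also have "\<dots> \<le> (\<Sum>n. ennreal (4 * offdiag (1/512) k n * (\<rho> n * norm (x n))))"
  proof (intro suminf_le ennreal_leI)
    fix n
    \<comment> \<open>For \<open>n < k\<close> use \<open>\<phi> x \<le> x\<close> and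
      \<open>\<mu> k * t \<le> exp 1 \<le> 4\<close>; for \<open>k < n\<close> use
      \<open>\<phi> x \<le> 4 / x\<close> and \<open>1 \<le> \<mu> k * t\<close>. The constant 4
      serves both sides.\<close>
    have h: "\<phi> (\<mu> n * t) \<le> 4 * (1/1024) ^ ((n - k) + (k - n))" if "n \<noteq> k"
    proof (cases "n < k")
      case True
      then obtain j where j: "k = n + j" using less_imp_add_positive by blast
      have "\<phi> (\<mu> n * t) \<le> \<mu> n * t" using t0 by (intro \<phi>_le_self) auto
      also have "\<mu> n * t = (\<mu> k * t) * (1/1024) ^ j" by (simp add: j power_add power_one_over)
      also have "\<dots> \<le> 4 * (1/1024) ^ j"
      proof (rule mult_right_mono)
        show "\<mu> k * t \<le> 4" using \<mu>t(2) exp_le by linarith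
      qed simp
      finally have "\<phi> (\<mu> n * t) \<le> 4 * (1/1024) ^ j" .
      moreover have "(n - k) + (k - n) = j" using j by simp
      ultimately show ?thesis by (simp only:)
    next
      case False
      then obtain j where j: "n = k + j" using le_Suc_ex by (metis not_less)
      have "\<phi> (\<mu> n * t) \<le> 4 / (\<mu> n * t)" using t0 by (intro \<phi>_le_inverse) auto
      also have "4 / (\<mu> n * t) = 4 / ((\<mu> k * t) * 1024 ^ j)" by (simp add: j power_add)
      also have "\<dots> \<le> 4 / (1 * 1024 ^ j)"
        using \<mu>t t0 by (intro divide_left_mono mult_right_mono mult_pos_pos) auto
      also have "\<dots> = 4 * (1/1024) ^ j" by (simp add: power_one_over)
      finally have "\<phi> (\<mu> n * t) \<le> 4 * (1/1024) ^ j" .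
      moreover have "(n - k) + (k - n) = j" using j by simp
      ultimately show ?thesis by (simp only:)
    qed
    have nn: "0 \<le> 2 ^ ((n - k) + (k - n)) * \<rho> n" by (rule order_trans[OF \<rho>(1) \<rho>(3)])
    show "\<rho> k * norm (g n) \<le> 4 * offdiag (1/512) k n * (\<rho> n * norm (x n))"
    proof (cases "n = k")
      case True
      then show ?thesis by (simp add: g_def offdiag_def)
    next
      case False
      have "\<rho> k * \<phi> (\<mu> n * t) \<le> (2 ^ ((n - k) + (k - n)) * \<rho> n) * (4 * (1/1024) ^ ((n - k) + (k - n)))"
        by (rule mult_mono[OF \<rho>(3) h[OF False] nn]) (use t0 in simp)
      also have "\<dots> = 4 * (2 ^ ((n - k) + (k - n)) * (1/1024) ^ ((n - k) + (k - n))) * \<rho> n"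
        by (simp only: mult_ac)
      also have "2 ^ ((n - k) + (k - n)) * (1/1024) ^ ((n - k) + (k - n)) = (1/512 :: real) ^ ((n - k) + (k - n))"
        by (simp flip: power_mult_distrib)
      also have "\<dots> = offdiag (1/512) k n" using False by (simp add: offdiag_def)
      finally have "\<rho> k * \<phi> (\<mu> n * t) * norm (x n) \<le> 4 * offdiag (1/512) k n * \<rho> n * norm (x n)"
        by (rule mult_right_mono) simp
      moreover have "norm (g n) = \<phi> (\<mu> n * t) * norm (x n)"
        using False t0 by (simp add: g_def f_def abs_mult)
      ultimately show ?thesis by (simp only: mult.assoc)
    qed
  qed auto
  finally show ?thesis by (simp add: add_left_mono)
qed

text \<open>The off-diagonal kernel has row and column sums at most 1/54. Splitting a q-th power of
  a sum costs \<open>2 powr (q - 1)\<close>, and \<open>2 powr (q - 1) * (1/54) powr q\<close> is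
  half of \<open>(1/27) powr q\<close>, so the off-diagonal part is absorbed and the remaining half
  yields the factor \<open>54 powr q\<close>.\<close>

lemma heat_deriv_lower:
  assumes q: "1 \<le> q"
  shows "(\<Sum>n. ennreal (norm (x n) powr q))
    \<le> ennreal (54 powr q) * (\<integral>\<^sup>+t\<in>{0<..}. ennreal (speed t powr q / t) \<partial>lborel)"
proof -
  let ?Y = "\<lambda>t. ennreal (speed t powr q / t)"
  define G where "G = (\<integral>\<^sup>+t\<in>{0<..}. ?Y t \<partial>lborel)"
  define J where "J k = {1 / \<mu> k .. exp 1 / \<mu> k}" for k
  let ?K = "\<lambda>k n. 4 * offdiag (1/512) k n"
  have J_pos: "t > 0" if "t \<in> J k" for t k
    using that by (auto simp: J_def intro: less_le_trans[rotated])
  have J_ind: "indicator (J k) t * indicator {0<..} t = (indicator (J k) t :: ennreal)" for k t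
    using J_pos[of t k] by (auto simp: indicator_def)
  have J_sets [measurable]: "J k \<in> sets borel" for k by (simp add: J_def)
  have J_disjoint: "disjoint_family J"
  proof -
    have *: "J k \<inter> J l = {}" if kl: "k < l" for k l
    proof (rule ccontr)
      assume "J k \<inter> J l \<noteq> {}"
      then obtain t where "1 / \<mu> k \<le> t" "t \<le> exp 1 / \<mu> l" by (auto simp: J_def)
      then have "1 / \<mu> k \<le> exp 1 / \<mu> l" by linarith
      then have "\<mu> l \<le> exp 1 * \<mu> k" by (simp add: field_simps)
      also have "\<dots> \<le> 3 * \<mu> k" by (intro mult_right_mono exp_le) simp
      also have "\<dots> < 1024 * \<mu> k" by simp
      also have "1024 * \<mu> k = \<mu> (Suc k)" by simp
      also have "\<dots> \<le> \<mu> l" using kl by (intro power_increasing) auto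
      finally show False by simp
    qed
    show ?thesis unfolding disjoint_family_on_def using * by (metis inf_commute nat_neq_iff)
  qed
  have J_mass: "(\<integral>\<^sup>+t\<in>J k. ennreal (1 / t) \<partial>lborel) = 1" for k
  proof -
    have "(\<integral>\<^sup>+t\<in>J k. ennreal (1 / t) \<partial>lborel) = ennreal (ln (exp 1 / \<mu> k) - ln (1 / \<mu> k))"
      unfolding J_def
    proof (rule nn_integral_FTC_Icc)
      fix t assume "t \<in> {1 / \<mu> k .. exp 1 / \<mu> k}"
      then have "0 < t" using J_pos[of t k] by (simp add: J_def)
      then show "(ln has_real_derivative 1 / t) (at t)" "0 \<le> 1 / t"
        by (auto intro!: derivative_eq_intros)
    next
      have "1 \<le> exp (1::real)" by simp
      then show "1 / \<mu> k \<le> exp 1 / \<mu> k" by (intro divide_right_mono) auto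
    qed simp
    then show ?thesis by (simp add: ln_div)
  qed
  have partial: "(\<Sum>n<N. ennreal (norm (x n) powr q)) \<le> ennreal (54 powr q) * G" for N
  proof -
    \<comment> \<open>The decay of the weights beyond \<open>N\<close> makes all sums finite, so that the off-diagonal part can be absorbed.\<close>
    define \<rho> where "\<rho> n = (1/2::real) ^ (n - N)" for n
    have \<rho>: "0 \<le> \<rho> k" "\<rho> k \<le> 1" for k by (auto simp: \<rho>_def power_le_one)
    have \<rho>_ratio: "\<rho> k \<le> 2 ^ ((n - k) + (k - n)) * \<rho> n" for k n
    proof -
      have "(2::real) ^ (n - N) \<le> 2 ^ ((n - k) + (k - n) + (k - N))"
        by (intro power_increasing) auto
      then show ?thesis by (simp add: \<rho>_def power_one_over field_simps power_add)
    qed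
    define b where "b n = (\<rho> n * norm (x n)) powr q" for n
    define B where "B = (\<Sum>n. ennreal (b n))"
    have s\<rho>: "summable (\<lambda>n. \<rho> n * norm (x n))"
    proof (rule summable_comparison_test')
      show "summable (\<lambda>n. 2 ^ N * ((1/2) ^ n * norm (x n)))" by (intro summable_mult sx)
      have "\<rho> n \<le> 2 ^ N * (1/2) ^ n" for n
      proof -
        have "(2::real) ^ n \<le> 2 ^ (N + (n - N))" by (intro power_increasing) auto
        then show ?thesis by (simp add: \<rho>_def power_one_over field_simps power_add)
      qed
      then show "norm (\<rho> n * norm (x n)) \<le> 2 ^ N * ((1/2) ^ n * norm (x n))" for n
        using \<rho>(1)[of n] by (simp add: mult.assoc[symmetric] mult_right_mono)
    qed
    \<comment> \<open>The weighted norms tend to 0, so they are eventually below 1 and dominate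
      their own q-th powers.\<close>
    have "summable b"
    proof (rule summable_comparison_test_ev)
      have "(\<lambda>n. \<rho> n * norm (x n)) \<longlonglongrightarrow> 0" by (rule summable_LIMSEQ_zero[OF s\<rho>])
      then have "\<forall>\<^sub>F n in sequentially. \<rho> n * norm (x n) < 1" by (rule order_tendstoD) simp
      then show "\<forall>\<^sub>F n in sequentially. norm (b n) \<le> \<rho> n * norm (x n)"
      proof eventually_elim
        case (elim n)
        then show ?case using powr_mono'[of 1 q "\<rho> n * norm (x n)"] q \<rho>(1)[of n] by (simp add: b_def)
      qed
    qed (rule s\<rho>)
    moreover have b0: "0 \<le> b n" for n by (simp add: b_def)
    ultimately obtain \<beta> where \<beta>: "B = ennreal \<beta>" "0 \<le> \<beta>"
      by (auto simp: B_def suminf_ennreal2 suminf_nonneg)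
    have K0: "0 \<le> ?K k n" for k n by (simp add: offdiag_nonneg)
    \<comment> \<open>The geometric bound evaluates to 8/511.\<close>
    have K_sum: "(\<Sum>n. ennreal (?K k n)) \<le> ennreal (1/54)" for k
    proof -
      have "(\<Sum>n. ennreal (?K k n)) = ennreal 4 * (\<Sum>n. ennreal (offdiag (1/512) k n))"
        by (simp only: ennreal_mult'[OF zero_le_numeral] ennreal_suminf_cmult)
      also have "\<dots> \<le> ennreal 4 * ennreal (2 * (1/512) / (1 - 1/512))"
        by (intro mult_left_mono suminf_offdiag_le) auto
      also have "\<dots> = ennreal (4 * (2 * (1/512) / (1 - 1/512)))"
        by (rule ennreal_mult'[symmetric]) simp
      also have "\<dots> \<le> ennreal (1/54)" by (intro ennreal_leI) simp
      finally show ?thesis .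
    qed
    \<comment> \<open>Jensen's bound for the q-th power of the off-diagonal sum, which spends all
      but one of the factors 1/54; the last one comes from the column sums in
      \<open>Z_sum\<close>.\<close>
    define Z where "Z k = ennreal ((1/54) powr (q - 1)) * (\<Sum>n. ennreal (?K k n * b n))" for k
    have pointwise: "ennreal ((1/27) powr q) * ennreal (b k) * ennreal (1 / t) \<le> ennreal (2 powr (q - 1)) * (?Y t + Z k * ennreal (1 / t))"
      if t: "t \<in> J k" for k t
    proof -
      have t0: "0 < t" using t by (rule J_pos)
      have "ennreal (1/27 * (\<rho> k * norm (x k))) \<le> ennreal (speed t) + (\<Sum>n. ennreal (?K k n * (\<rho> n * norm (x n))))"
        using t by (intro norm_term_le_heat_deriv \<rho> \<rho>_ratio) (auto simp: J_def)
      note le = ennreal_powr_add_le[OF q this]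
      have "ennreal_powr (ennreal (1/27 * (\<rho> k * norm (x k)))) q = ennreal ((1/27) powr q) * ennreal (b k)"
      proof -
        have "(1/27 * (\<rho> k * norm (x k))) powr q = (1/27) powr q * b k"
          unfolding b_def by (rule powr_mult)
        then show ?thesis using \<rho>(1)[of k] by (subst ennreal_powr_ennreal) (simp_all only: ennreal_mult' powr_ge_zero, simp)
      qed
      moreover have "ennreal_powr (ennreal (speed t)) q = ennreal (speed t powr q)"
        by (rule ennreal_powr_ennreal) simp
      ultimately have "ennreal ((1/27) powr q) * ennreal (b k) \<le> ennreal (2 powr (q - 1)) * (ennreal (speed t powr q) + ennreal_powr (\<Sum>n. ennreal (?K k n * (\<rho> n * norm (x n)))) q)"
        using le by (simp only:)
      also have "\<dots> \<le> ennreal (2 powr (q - 1)) * (ennreal (speed t powr q) + Z k)"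
        unfolding Z_def b_def using \<rho>(1) K0 K_sum
        by (intro mult_left_mono add_left_mono suminf_powr_Jensen q) auto
      finally have "ennreal ((1/27) powr q) * ennreal (b k) * ennreal (1 / t) \<le>
        ennreal (2 powr (q - 1)) * (ennreal (speed t powr q) + Z k) * ennreal (1 / t)"
        by (rule mult_right_mono) simp
      also have "\<dots> = ennreal (2 powr (q - 1)) * (ennreal (speed t powr q) * ennreal (1 / t) + Z k * ennreal (1 / t))"
        by (simp only: distrib_right mult.assoc)
      also have "ennreal (speed t powr q) * ennreal (1 / t) = ?Y t"
        using t0 by (simp flip: ennreal_mult)
      finally show ?thesis .
    qed
    have YJ: "(\<lambda>t. ?Y t * indicator (J k) t) \<in> borel_measurable lborel" for k
    proof -
      have "(\<lambda>t. (?Y t * indicator {0<..} t) * indicator (J k) t) \<in> borel_measurable lborel"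
        by (rule borel_measurable_times_ennreal[OF measurable_heat_deriv_integrand]) simp
      also have "(\<lambda>t. (?Y t * indicator {0<..} t) * indicator (J k) t) = (\<lambda>t. ?Y t * indicator (J k) t)"
        by (simp only: mult.assoc mult.commute[of "indicator {0<..} _"] J_ind)
      finally show ?thesis .
    qed
    have step: "ennreal ((1/27) powr q) * ennreal (b k) \<le> ennreal (2 powr (q - 1)) * ((\<integral>\<^sup>+t\<in>J k. ?Y t \<partial>lborel) + Z k)" for k
    proof -
      have "ennreal ((1/27) powr q) * ennreal (b k) = (\<integral>\<^sup>+t. ennreal ((1/27) powr q) * ennreal (b k) * (ennreal (1 / t) * indicator (J k) t) \<partial>lborel)"
        by (subst nn_integral_cmult) (auto simp: J_mass)
      also have "\<dots> \<le> (\<integral>\<^sup>+t. ennreal (2 powr (q - 1)) * (?Y t * indicator (J k) t + Z k * (ennreal (1 / t) * indicator (J k) t)) \<partial>lborel)"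
        by (intro nn_integral_mono) (use pointwise[of _ k] in \<open>auto simp: indicator_def mult.assoc\<close>)
      also have "\<dots> = ennreal (2 powr (q - 1)) * ((\<integral>\<^sup>+t\<in>J k. ?Y t \<partial>lborel) + Z k * (\<integral>\<^sup>+t\<in>J k. ennreal (1 / t) \<partial>lborel))"
        using YJ[of k] by (simp add: nn_integral_cmult nn_integral_add)
      finally show ?thesis by (simp add: J_mass)
    qed
    have Y_sum: "(\<Sum>k. \<integral>\<^sup>+t\<in>J k. ?Y t \<partial>lborel) \<le> G"
    proof -
      have "(\<Sum>k. \<integral>\<^sup>+t\<in>J k. ?Y t \<partial>lborel) = (\<integral>\<^sup>+t. (\<Sum>k. ?Y t * indicator (J k) t) \<partial>lborel)"
        by (rule nn_integral_suminf[symmetric, OF YJ])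
      also have "\<dots> = (\<integral>\<^sup>+t. ?Y t * indicator (\<Union>k. J k) t \<partial>lborel)"
        by (simp add: ennreal_suminf_cmult suminf_indicator[OF J_disjoint])
      also have "\<dots> \<le> G" unfolding G_def
        using J_pos by (intro nn_integral_mono) (auto simp: indicator_def)
      finally show ?thesis .
    qed
    \<comment> \<open>A Schur test: the kernel is symmetric, so after exchanging the sums the row
      bound controls the columns as well.\<close>
    have Z_sum: "(\<Sum>k. Z k) \<le> ennreal ((1/54) powr q) * B"
    proof -
      have "(\<Sum>k. Z k) = ennreal ((1/54) powr (q - 1)) * (\<Sum>k. \<Sum>n. ennreal (?K k n * b n))"
        unfolding Z_def by (rule ennreal_suminf_cmult)
      also have "(\<Sum>k. \<Sum>n. ennreal (?K k n * b n)) = (\<Sum>n. \<Sum>k. ennreal (?K k n * b n))"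
        by (subst (1 2) nn_integral_count_space_nat[symmetric]) (rule nn_integral_suminf, simp)
      also have "\<dots> = (\<Sum>n. ennreal (b n) * (\<Sum>k. ennreal (?K n k)))"
        using K0 b0 by (simp only: ennreal_suminf_cmult[symmetric] offdiag_commute[of _ _ _] ennreal_mult mult.commute)
      also have "\<dots> \<le> (\<Sum>n. ennreal (b n) * ennreal (1/54))"
        by (intro suminf_le mult_left_mono K_sum) auto
      also have "\<dots> = ennreal (1/54) * B"
        by (simp add: B_def ennreal_suminf_multc mult.commute)
      also have "ennreal ((1/54) powr (q - 1)) * (ennreal (1/54) * B) = ennreal ((1/54) powr q) * B"
        by (simp add: mult.assoc[symmetric] powr_diff flip: ennreal_mult)
      finally show ?thesis by (simp add: mult_left_mono)
    qed
    have "ennreal ((1/27) powr q) * B = (\<Sum>k. ennreal ((1/27) powr q) * ennreal (b k))"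
      by (simp add: B_def ennreal_suminf_cmult)
    also have "\<dots> \<le> (\<Sum>k. ennreal (2 powr (q - 1)) * ((\<integral>\<^sup>+t\<in>J k. ?Y t \<partial>lborel) + Z k))"
      by (intro suminf_le step) auto
    also have "\<dots> = ennreal (2 powr (q - 1)) * ((\<Sum>k. \<integral>\<^sup>+t\<in>J k. ?Y t \<partial>lborel) + (\<Sum>k. Z k))"
      by (simp add: ennreal_suminf_cmult suminf_add[symmetric])
    also have "\<dots> \<le> ennreal (2 powr (q - 1)) * (G + ennreal ((1/54) powr q) * B)"
      by (intro mult_left_mono add_mono Y_sum Z_sum) simp
    finally have main: "ennreal ((1/27) powr q) * B \<le> ennreal (2 powr (q - 1)) * (G + ennreal ((1/54) powr q) * B)" .
    \<comment> \<open>Only here is the finiteness of \<open>B\<close> decisive: it permits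
      subtracting the off-diagonal half in real arithmetic. If \<open>G\<close> is infinite there is
      nothing to absorb.\<close>
    have "B \<le> ennreal (54 powr q) * G"
    proof (cases G)
      case (real \<gamma>)
      have "(1/27) powr q * \<beta> \<le> 2 powr (q - 1) * (\<gamma> + (1/54) powr q * \<beta>)"
        using main \<beta> real by (simp add: ennreal_mult[symmetric] ennreal_plus[symmetric] del: ennreal_plus)
      moreover have "2 powr (q - 1) * (1/54) powr q = (1/27) powr q / 2"
      proof -
        have "(1/27) powr q = (2 * (1/54)) powr q" by simp
        also have "\<dots> = 2 powr q * (1/54) powr q" by (rule powr_mult)
        finally show ?thesis by (simp add: powr_diff)
      qed
      ultimately have "(1/27) powr q * \<beta> / 2 \<le> 2 powr (q - 1) * \<gamma>"
        by (simp add: distrib_left mult.assoc[symmetric])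
      then have "(1/27) powr q * \<beta> \<le> 2 powr q * \<gamma>" by (simp add: powr_diff)
      then have "27 powr q * ((1/27) powr q * \<beta>) \<le> 27 powr q * (2 powr q * \<gamma>)"
        by (intro mult_left_mono) auto
      then have "\<beta> \<le> 54 powr q * \<gamma>"
        by (simp add: mult.assoc[symmetric] flip: powr_mult)
      then show ?thesis using \<beta> real by (simp add: ennreal_leI flip: ennreal_mult)
    next
      case top
      then show ?thesis by (simp add: ennreal_mult_top)
    qed
    \<comment> \<open>The weights equal 1 at all indices below \<open>N\<close>.\<close>
    moreover have "(\<Sum>n<N. ennreal (norm (x n) powr q)) \<le> B"
    proof -
      have "(\<Sum>n<N. ennreal (norm (x n) powr q)) = (\<Sum>n<N. ennreal (b n))"
        by (intro sum.cong) (auto simp: b_def \<rho>_def)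
      also have "\<dots> \<le> B" unfolding B_def by (rule sum_le_suminf) auto
      finally show ?thesis .
    qed
    ultimately show ?thesis by (rule order_trans[rotated])
  qed
  show ?thesis
    using suminf_le_const[OF summableI partial] by (simp add: G_def)
qed

end

section \<open>Martingale differences\<close>

lemma Lp_sums_linear:
  assumes p: "1 \<le> p" and u: "Lp_sums p M u g" and v: "Lp_sums p M v h"
  shows "Lp_sums p M (\<lambda>n w. a *\<^sub>R u n w + b *\<^sub>R v n w) (\<lambda>w. a *\<^sub>R g w + b *\<^sub>R h w)"
proof -
  have L: "u n \<in> Lp_space p M" "v n \<in> Lp_space p M" "g \<in> Lp_space p M" "h \<in> Lp_space p M" for n
    using u v by (auto simp: Lp_sums_def)
  have "(\<lambda>N. Lp_norm p M (\<lambda>w. (a *\<^sub>R (\<Sum>n<N. u n w) + b *\<^sub>R (\<Sum>n<N. v n w)) - (a *\<^sub>R g w + b *\<^sub>R h w))) \<longlonglongrightarrow> 0"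
    using u v by (intro Lp_tendsto_linear p strongly_measurable_sum Lp_spaceD(1)[OF L(1)] Lp_spaceD(1)[OF L(2)]
        Lp_spaceD(1)[OF L(3)] Lp_spaceD(1)[OF L(4)]) (auto simp: Lp_sums_def)
  then show ?thesis
    unfolding Lp_sums_def using L
    by (auto intro!: Lp_space_add Lp_space_scaleR p simp: sum.distrib scaleR_sum_right)
qed

text \<open>It writes \<open>f\<close> itself as an average with given weights, so that for strong
  continuity \<open>T t f - f\<close> becomes a series in the differences
  \<open>E (Suc n) f - f\<close>.\<close>

lemma Lp_sums_scaleR_const:
  assumes p: "1 \<le> p" and f: "f \<in> Lp_space p M" and c: "c sums s"
  shows "Lp_sums p M (\<lambda>n w. c n *\<^sub>R f w) (\<lambda>w. s *\<^sub>R f w)"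
proof -
  have "Lp_norm p M (\<lambda>w. (\<Sum>n<N. c n *\<^sub>R f w) - s *\<^sub>R f w) = ennreal \<bar>(\<Sum>n<N. c n) - s\<bar> * Lp_norm p M f" for N
    using Lp_norm_scaleR[OF _ Lp_spaceD(1)[OF f], of p "(\<Sum>n<N. c n) - s"] p
    by (simp add: scaleR_diff_left scaleR_sum_left)
  moreover have "(\<lambda>N. ennreal \<bar>(\<Sum>n<N. c n) - s\<bar>) \<longlonglongrightarrow> ennreal \<bar>s - s\<bar>"
    using c unfolding sums_def by (intro tendsto_intros)
  then have "(\<lambda>N. Lp_norm p M f * ennreal \<bar>(\<Sum>n<N. c n) - s\<bar>) \<longlonglongrightarrow> Lp_norm p M f * ennreal \<bar>s - s\<bar>"
    using Lp_spaceD(2)[OF f] by (intro ennreal_tendsto_cmult)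
  then have "(\<lambda>N. ennreal \<bar>(\<Sum>n<N. c n) - s\<bar> * Lp_norm p M f) \<longlonglongrightarrow> 0"
    by (simp add: mult.commute)
  ultimately show ?thesis
    unfolding Lp_sums_def using f by (auto intro!: Lp_space_scaleR p)
qed

locale Lp_filtration = prob_space M for M :: "'a measure" +
  fixes A :: "nat \<Rightarrow> 'a measure" and p :: real
  assumes filtration: "filtration_generating M A" and p: "1 \<le> p"
begin

abbreviation Np :: "('a \<Rightarrow> 'x::real_normed_vector) \<Rightarrow> ennreal" where "Np \<equiv> Lp_norm p M"
abbreviation Lp :: "('a \<Rightarrow> 'x::real_normed_vector) set" where "Lp \<equiv> Lp_space p M"

lemma subalgebra_A: "1 \<le> n \<Longrightarrow> subalgebra M (A n)"
  using filtration by (simp add: filtration_generating_def)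

lemma sets_A_mono:
  assumes "1 \<le> m" "m \<le> n"
  shows "sets (A m) \<subseteq> sets (A n)"
  using assms(2)
proof (induction n rule: dec_induct)
  case (step n)
  then have "sets (A n) \<subseteq> sets (A (Suc n))"
    using filtration assms(1) by (simp add: filtration_generating_def)
  with step show ?case by blast
qed simp

lemma subalgebra_A_A:
  assumes "1 \<le> m" "m \<le> n"
  shows "subalgebra (A n) (A m)"
  using sets_A_mono[OF assms] subalgebra_A[of m] subalgebra_A[of n] assms by (auto simp: subalgebra_def)

lemma Lp_subalgebra_A: "1 \<le> n \<Longrightarrow> Lp_subalgebra M (A n) p"
  by unfold_locales (auto intro: subalgebra_A p)

abbreviation E :: "nat \<Rightarrow> ('a \<Rightarrow> 'x::banach) \<Rightarrow> 'a \<Rightarrow> 'x" where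
  "E \<equiv> mart_E p M A"

text \<open>The martingale differences, shifted so that their indices start from zero.\<close>

abbreviation D :: "nat \<Rightarrow> ('a \<Rightarrow> 'x::banach) \<Rightarrow> 'a \<Rightarrow> 'x" where
  "D n \<equiv> mart_dE p M A (Suc n)"

lemma E_0 [simp]: "E 0 f = (\<lambda>w. 0)"
  by (simp add: mart_E_def)

lemma E_eq_Lp_E: "1 \<le> n \<Longrightarrow> E n f = Lp_subalgebra.Lp_E M (A n) p f"
  by (simp add: mart_E_def Lp_subalgebra.Lp_E_def[OF Lp_subalgebra_A])

lemma D_def: "D n f = (\<lambda>w. E (Suc n) f w - E n f w)"
  by (simp add: mart_dE_def fun_eq_iff)

context
  fixes f :: "'a \<Rightarrow> 'x::banach"
  assumes f: "f \<in> Lp"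
begin

lemma E_space: "E n f \<in> Lp"
  using Lp_subalgebra.Lp_E_space[OF Lp_subalgebra_A f] by (cases "n = 0") (simp_all add: E_eq_Lp_E)

lemma E_norm_le: "Np (E n f) \<le> Np f"
  using Lp_subalgebra.Lp_E_norm_le[OF Lp_subalgebra_A f] by (cases "n = 0") (simp_all add: E_eq_Lp_E)

lemma D_space: "D n f \<in> Lp"
  unfolding D_def by (intro Lp_space_diff p E_space)

end

context
  fixes f g :: "'a \<Rightarrow> 'x::banach"
  assumes f: "f \<in> Lp" and g: "g \<in> Lp"
begin

lemma E_linear: "AE w in M. E n (\<lambda>w. a *\<^sub>R f w + b *\<^sub>R g w) w = a *\<^sub>R E n f w + b *\<^sub>R E n g w"
  using Lp_subalgebra.Lp_E_linear[OF Lp_subalgebra_A f g] by (cases "n = 0") (simp_all add: E_eq_Lp_E)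

lemma E_cong: "AE w in M. f w = g w \<Longrightarrow> AE w in M. E n f w = E n g w"
  using Lp_subalgebra.Lp_E_cong[OF Lp_subalgebra_A f g] by (cases "n = 0") (simp_all add: E_eq_Lp_E)

lemma E_diff_norm_le: "Np (\<lambda>w. E n f w - E n g w) \<le> Np (\<lambda>w. f w - g w)"
  using Lp_subalgebra.Lp_E_diff_norm_le[OF Lp_subalgebra_A f g] by (cases "n = 0") (simp_all add: E_eq_Lp_E)

end

lemmas E_measurable = Lp_spaceD(1)[OF E_space]
lemmas D_measurable = Lp_spaceD(1)[OF D_space]

lemma E_zero: "AE w in M. E n (\<lambda>w. 0 :: 'x::banach) w = 0"
  using E_linear[of "\<lambda>w. 0" "\<lambda>w. 0" n 0 0] by simp

context
  fixes f :: "'a \<Rightarrow> 'x::banach"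
  assumes f: "f \<in> Lp"
begin

text \<open>This is the tower property in both orders; the convention \<open>E 0 = 0\<close> extends
  the formula with \<open>min\<close> to index 0.\<close>

lemma E_E: "AE w in M. E n (E m f) w = E (min n m) f w"
proof -
  consider "n = 0" | "m = 0" | "1 \<le> n" "n \<le> m" | "1 \<le> m" "m \<le> n" by linarith
  then show ?thesis
  proof cases
    case 3
    then show ?thesis
      using Lp_E_tower(1)[OF Lp_subalgebra_A Lp_subalgebra_A subalgebra_A_A f, of m n] by (simp add: E_eq_Lp_E min_def)
  next
    case 4
    then show ?thesis
      using Lp_E_tower(2)[OF Lp_subalgebra_A Lp_subalgebra_A subalgebra_A_A f, of n m] by (cases "m = n") (simp_all add: E_eq_Lp_E min_def)
  qed (simp_all add: E_zero)
qed

lemma D_norm_le: "Np (D n f) \<le> 2 * Np f"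
proof -
  have "Np (\<lambda>w. E (Suc n) f w + (-1) *\<^sub>R E n f w) \<le> Np (E (Suc n) f) + Np (\<lambda>w. (-1) *\<^sub>R E n f w)"
    using E_space[OF f] by (intro Lp_norm_triangle p strongly_measurable_scaleR) (auto dest: Lp_spaceD)
  also have "\<dots> \<le> Np f + Np f"
    using E_norm_le[OF f] by (intro add_mono) (simp_all add: Lp_norm_uminus)
  finally show ?thesis by (simp add: D_def mult_2)
qed

lemma D_E: "AE w in M. D n (E m f) w = (if n < m then D n f w else 0)"
  using E_E[of "Suc n" m] E_E[of n m] by eventually_elim (auto simp: D_def min_def not_less_eq_eq le_Suc_eq)

end

context
  fixes f g :: "'a \<Rightarrow> 'x::banach"
  assumes f: "f \<in> Lp" and g: "g \<in> Lp"
begin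

lemma D_linear: "AE w in M. D n (\<lambda>w. a *\<^sub>R f w + b *\<^sub>R g w) w = a *\<^sub>R D n f w + b *\<^sub>R D n g w"
  using E_linear[OF f g, of "Suc n" a b] E_linear[OF f g, of n a b]
  by eventually_elim (simp add: D_def algebra_simps)

lemma D_cong: "AE w in M. f w = g w \<Longrightarrow> AE w in M. D n f w = D n g w"
  using E_cong[OF f g, of "Suc n"] E_cong[OF f g, of n] unfolding D_def by auto

end

lemma D_diff_norm_le:
  assumes f: "f \<in> Lp" and g: "g \<in> Lp"
  shows "Np (\<lambda>w. D n f w - D n g w) \<le> 2 * Np (\<lambda>w. f w - g w)"
proof -
  have "Np (\<lambda>w. D n f w - D n g w) = Np (D n (\<lambda>w. f w - g w))"
    by (rule Lp_norm_cong) (use D_linear[OF f g, of n 1 "-1"] in \<open>eventually_elim, simp\<close>)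
  also have "\<dots> \<le> 2 * Np (\<lambda>w. f w - g w)"
    using f g by (intro D_norm_le Lp_space_diff p)
  finally show ?thesis .
qed

text \<open>The differences are mutually annihilating projections, which is what allows coefficients
  of a series in the \<open>D n f\<close> to be read off.\<close>

lemma D_D:
  assumes f: "f \<in> Lp"
  shows "AE w in M. D m (D n f) w = (if m = n then D n f w else 0)"
proof -
  have "AE w in M. D m (\<lambda>w. 1 *\<^sub>R E (Suc n) f w + (-1) *\<^sub>R E n f w) w = 1 *\<^sub>R D m (E (Suc n) f) w + (-1) *\<^sub>R D m (E n f) w"
    by (intro D_linear E_space f)
  then show ?thesis using D_E[OF f, of m "Suc n"] D_E[OF f, of m n]
    by eventually_elim (auto simp: D_def[of n])
qed

lemma D_sum:
  fixes u :: "nat \<Rightarrow> 'a \<Rightarrow> 'x::banach"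
  assumes u: "\<And>n. u n \<in> Lp"
  shows "AE w in M. D m (\<lambda>w. \<Sum>n<N. u n w) w = (\<Sum>n<N. D m (u n) w)"
proof (induction N)
  case 0
  then show ?case using D_linear[of "\<lambda>w. 0 :: 'x" "\<lambda>w. 0" m 0 0] by simp
next
  case (Suc N)
  have "AE w in M. D m (\<lambda>w. 1 *\<^sub>R (\<Sum>n<N. u n w) + 1 *\<^sub>R u N w) w = 1 *\<^sub>R D m (\<lambda>w. \<Sum>n<N. u n w) w + 1 *\<^sub>R D m (u N) w"
    by (intro D_linear Lp_space_sum p u)
  with Suc show ?case by eventually_elim simp
qed

text \<open>\<open>D m\<close> is bounded, hence passes to the limit, and beyond index
  \<open>m\<close> each partial sum contributes just the m-th term. Reading off coefficients in this
  way gives the semigroup law and identifies the fixed points.\<close>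

lemma D_of_Lp_sums:
  fixes f :: "'a \<Rightarrow> 'x::banach"
  assumes f: "f \<in> Lp" and g: "Lp_sums p M (\<lambda>n w. c n *\<^sub>R D n f w) g"
  shows "AE w in M. D m g w = c m *\<^sub>R D m f w"
proof -
  let ?u = "\<lambda>n w. c n *\<^sub>R D n f w"
  let ?S = "\<lambda>N w. \<Sum>n<N. ?u n w"
  have uL: "?u n \<in> Lp" for n by (intro Lp_space_scaleR p D_space f)
  have gL: "g \<in> Lp" and lim: "(\<lambda>N. Np (\<lambda>w. ?S N w - g w)) \<longlonglongrightarrow> 0"
    using g by (auto simp: Lp_sums_def)
  have SL: "?S N \<in> Lp" for N by (intro Lp_space_sum p uL)
  have "(\<lambda>N. 2 * Np (\<lambda>w. ?S N w - g w)) \<longlonglongrightarrow> 2 * 0"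
    by (intro ennreal_tendsto_cmult lim) simp
  then have l2: "(\<lambda>N. 2 * Np (\<lambda>w. ?S N w - g w)) \<longlonglongrightarrow> 0" by simp
  have l1: "(\<lambda>N. Np (\<lambda>w. D m (?S N) w - D m g w)) \<longlonglongrightarrow> 0"
    by (rule tendsto_0_le_ennreal[OF D_diff_norm_le[OF SL gL] l2])
  have "AE w in M. D m (?S N) w = c m *\<^sub>R D m f w" if "m < N" for N
  proof -
    have "AE w in M. \<forall>n. D m (?u n) w = (if m = n then c n *\<^sub>R D n f w else 0)"
      unfolding AE_all_countable
    proof
      fix n
      have "AE w in M. D m (\<lambda>w. c n *\<^sub>R D n f w + 0 *\<^sub>R D n f w) w = c n *\<^sub>R D m (D n f) w + 0 *\<^sub>R D m (D n f) w"
        by (intro D_linear D_space f)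
      then show "AE w in M. D m (?u n) w = (if m = n then c n *\<^sub>R D n f w else 0)"
        using D_D[OF f, of m n] by eventually_elim simp
    qed
    then show ?thesis
      using D_sum[where u="?u" and m=m and N=N, OF uL] by eventually_elim (use that in simp)
  qed
  then have "\<forall>\<^sub>F N in sequentially. Np (\<lambda>w. D m (?S N) w - c m *\<^sub>R D m f w) = 0"
    using eventually_gt_at_top[of m]
  proof (elim eventually_mono)
    fix N assume "m < N"
    then have "AE w in M. D m (?S N) w = c m *\<^sub>R D m f w"
      using \<open>\<And>N. m < N \<Longrightarrow> AE w in M. D m (?S N) w = c m *\<^sub>R D m f w\<close> by blast
    then have "Np (\<lambda>w. D m (?S N) w - c m *\<^sub>R D m f w) = Np (\<lambda>w. 0 :: 'x)"
      by (intro Lp_norm_cong) auto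
    then show "Np (\<lambda>w. D m (?S N) w - c m *\<^sub>R D m f w) = 0" by simp
  qed
  then have l0: "(\<lambda>N. Np (\<lambda>w. D m (?S N) w - c m *\<^sub>R D m f w)) \<longlonglongrightarrow> 0"
    by (rule tendsto_eventually)
  show ?thesis
    by (rule Lp_limit_unique[OF p sequentially_bot always_eventually[OF allI] _ _ l1 l0])
       (intro Lp_spaceD(1)[of _ p] D_space SL gL Lp_space_scaleR p f)+
qed

text \<open>Each difference has norm at most twice that of \<open>f\<close>. This crude bound
  handles a fixed positive time and time derivatives; it blows up for the semigroup as the time
  tends to 0, where the averages of the \<open>E n\<close> take over.\<close>

lemma Lp_sums_multiplier:
  assumes f: "f \<in> Lp" and c: "summable (\<lambda>n. \<bar>c n\<bar>)"
  shows "(\<Sum>n. Np (\<lambda>w. c n *\<^sub>R D n f w)) \<le> ennreal (\<Sum>n. \<bar>c n\<bar>) * (2 * Np f)"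
    and "(\<Sum>n. Np (\<lambda>w. c n *\<^sub>R D n f w)) < \<top>"
proof -
  have "(\<Sum>n. Np (\<lambda>w. c n *\<^sub>R D n f w)) \<le> (\<Sum>n. ennreal \<bar>c n\<bar> * (2 * Np f))"
  proof (intro suminf_le)
    fix n
    have "Np (\<lambda>w. c n *\<^sub>R D n f w) = ennreal \<bar>c n\<bar> * Np (D n f)"
      using p by (intro Lp_norm_scaleR D_measurable[OF f]) simp
    then show "Np (\<lambda>w. c n *\<^sub>R D n f w) \<le> ennreal \<bar>c n\<bar> * (2 * Np f)"
      using D_norm_le[OF f] by (simp add: mult_left_mono)
  qed auto
  also have "\<dots> = ennreal (\<Sum>n. \<bar>c n\<bar>) * (2 * Np f)"
    using c by (simp only: ennreal_suminf_multc) (simp add: suminf_ennreal2)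
  finally show le: "(\<Sum>n. Np (\<lambda>w. c n *\<^sub>R D n f w)) \<le> ennreal (\<Sum>n. \<bar>c n\<bar>) * (2 * Np f)" .
  also have "\<dots> < \<top>" using Lp_spaceD(2)[OF f] by (simp add: ennreal_mult_less_top)
  finally show "(\<Sum>n. Np (\<lambda>w. c n *\<^sub>R D n f w)) < \<top>" .
qed

section \<open>Convergence of E_n f to f in L_p\<close>

abbreviation conv :: "('a \<Rightarrow> 'x::banach) \<Rightarrow> bool" where
  "conv f \<equiv> (\<lambda>n. Np (\<lambda>w. E n f w - f w)) \<longlonglongrightarrow> 0"

lemma conv_linear:
  assumes f: "f \<in> Lp" "conv f" and g: "g \<in> Lp" "conv g"
  shows "conv (\<lambda>w. a *\<^sub>R f w + b *\<^sub>R g w)"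
proof -
  have "Np (\<lambda>w. E n (\<lambda>w. a *\<^sub>R f w + b *\<^sub>R g w) w - (a *\<^sub>R f w + b *\<^sub>R g w)) =
    Np (\<lambda>w. (a *\<^sub>R E n f w + b *\<^sub>R E n g w) - (a *\<^sub>R f w + b *\<^sub>R g w))" for n
    by (rule Lp_norm_cong) (use E_linear[OF f(1) g(1), of n a b] in \<open>eventually_elim, simp\<close>)
  then show ?thesis
    using Lp_tendsto_linear[OF p Lp_spaceD(1)[OF E_space[OF f(1)]] Lp_spaceD(1)[OF E_space[OF g(1)]]
        Lp_spaceD(1)[OF f(1)] Lp_spaceD(1)[OF g(1)] f(2) g(2)] by simp
qed

lemma conv_sum:
  fixes f :: "'i \<Rightarrow> 'a \<Rightarrow> 'x::banach"
  assumes "\<And>i. i \<in> I \<Longrightarrow> f i \<in> Lp" "\<And>i. i \<in> I \<Longrightarrow> conv (f i)"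
  shows "conv (\<lambda>w. \<Sum>i\<in>I. f i w)"
proof -
  have z: "conv (\<lambda>w. 0 :: 'x)"
  proof -
    have "Np (\<lambda>w. E n (\<lambda>w. 0 :: 'x) w - 0) = Np (\<lambda>w. 0 :: 'x)" for n
      using E_zero[of n] by (intro Lp_norm_cong) simp
    then show ?thesis by simp
  qed
  show ?thesis
    using assms
  proof (induction I rule: infinite_finite_induct)
    case (insert i I)
    then have "conv (\<lambda>w. 1 *\<^sub>R f i w + 1 *\<^sub>R (\<Sum>i\<in>I. f i w))"
      by (intro conv_linear Lp_space_sum p) auto
    with insert show ?case by simp
  qed (use z in simp_all)
qed

lemma conv_cong:
  assumes f: "f \<in> Lp" and g: "g \<in> Lp" and eq: "AE w in M. f w = g w" and "conv f"
  shows "conv g"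
proof -
  have "Np (\<lambda>w. E n g w - g w) = Np (\<lambda>w. E n f w - f w)" for n
    by (rule Lp_norm_cong) (use E_cong[OF f g eq, of n] eq in \<open>eventually_elim, simp\<close>)
  with assms show ?thesis by simp
qed

text \<open>A three-term estimate that rests on the contractivity of \<open>E n\<close> on
  differences, uniformly in \<open>n\<close>.\<close>

lemma conv_limit:
  assumes h: "\<And>i::nat. h i \<in> Lp" "\<And>i. conv (h i)"
    and f: "f \<in> Lp" and lim: "(\<lambda>i. Np (\<lambda>w. h i w - f w)) \<longlonglongrightarrow> 0"
  shows "conv f"
proof (rule tendsto_0_if_eventually_less)
  fix e :: real assume e: "0 < e"
  have "\<forall>\<^sub>F i in sequentially. Np (\<lambda>w. h i w - f w) < ennreal (e/3)"
    using e by (intro order_tendstoD(2)[OF lim]) simp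
  then obtain i where i: "Np (\<lambda>w. h i w - f w) < ennreal (e/3)" by (auto simp: eventually_sequentially)
  have "\<forall>\<^sub>F n in sequentially. Np (\<lambda>w. E n (h i) w - h i w) < ennreal (e/3)"
    using e by (intro order_tendstoD(2)[OF h(2)]) simp
  then show "\<forall>\<^sub>F n in sequentially. Np (\<lambda>w. E n f w - f w) \<le> ennreal e"
  proof eventually_elim
    case (elim n)
    note sm = Lp_spaceD(1)[OF f] Lp_spaceD(1)[OF h(1)] E_measurable[OF f] Lp_spaceD(1)[OF E_space[OF h(1)]]
    have "Np (\<lambda>w. E n f w - f w) \<le> Np (\<lambda>w. E n f w - E n (h i) w) + Np (\<lambda>w. E n (h i) w - f w)"
      by (intro Lp_norm_triangle_diff p sm)
    also have "\<dots> \<le> Np (\<lambda>w. E n f w - E n (h i) w) + (Np (\<lambda>w. E n (h i) w - h i w) + Np (\<lambda>w. h i w - f w))"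
      by (intro add_left_mono Lp_norm_triangle_diff p sm)
    also have "Np (\<lambda>w. E n f w - E n (h i) w) \<le> Np (\<lambda>w. h i w - f w)"
      using E_diff_norm_le[OF f h(1), of n i] by (simp add: Lp_norm_minus_commute[of p M f])
    also have "Np (\<lambda>w. h i w - f w) + (Np (\<lambda>w. E n (h i) w - h i w) + Np (\<lambda>w. h i w - f w))
      \<le> ennreal (e/3) + (ennreal (e/3) + ennreal (e/3))"
      using elim i by (intro add_mono) auto
    also have "\<dots> = ennreal e" using e by (simp flip: ennreal_plus)
    finally show ?case by (simp add: add_right_mono)
  qed
qed

lemma indicator_scaleR_space:
  "B \<in> sets M \<Longrightarrow> (\<lambda>w. indicat_real B w *\<^sub>R y) \<in> Lp"
  using p by (intro Lp_space_simple simple_function_compose1[of _ _ "\<lambda>r. r *\<^sub>R y"] simple_function_indicator) (auto intro: finite_measure_axioms)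

lemma E_indicator:
  fixes y :: "'x::banach"
  assumes n: "1 \<le> n" and B: "B \<in> sets (A n)"
  shows "AE w in M. E n (\<lambda>w. indicator B w *\<^sub>R y) w = indicator B w *\<^sub>R y"
proof -
  interpret An: Lp_subalgebra M "A n" p using n by (rule Lp_subalgebra_A)
  have BM: "B \<in> sets M" using B An.subalg by (auto simp: subalgebra_def)
  have iL: "indicat_real B \<in> Lp" by (intro An.Lp_space_simple' simple_function_indicator BM)
  have "AE w in M. E n (\<lambda>w. indicator B w *\<^sub>R y) w = An.R (indicator B) w *\<^sub>R y"
    using An.Lp_E_eqI[OF indicator_scaleR_space[OF BM] An.ext_scaleR_const[OF iL]] n by (simp add: E_eq_Lp_E)
  moreover have "AE w in M. An.R (indicator B) w = indicator B w"
    using B by (intro An.real_cond_exp_F_meas An.integrable_Lp iL) simp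
  ultimately show ?thesis by eventually_elim simp
qed

text \<open>A Dynkin argument: a set of the filtration is fixed by \<open>E n\<close> for all large
  \<open>n\<close>, and convergence is inherited by complements and by disjoint countable
  unions.\<close>

lemma conv_indicator:
  fixes y :: "'x::banach"
  assumes B: "B \<in> sets M"
  shows "conv (\<lambda>w. indicator B w *\<^sub>R y)"
proof -
  let ?G = "\<Union>n\<in>{1..}. sets (A n)"
  have basic: "conv (\<lambda>w. indicator B w *\<^sub>R y)" if "B \<in> ?G" for B
  proof -
    from that obtain m where m: "1 \<le> m" "B \<in> sets (A m)" by auto
    have "\<forall>\<^sub>F n in sequentially. Np (\<lambda>w. E n (\<lambda>w. indicator B w *\<^sub>R y) w - indicator B w *\<^sub>R y) = 0"
      using eventually_ge_at_top[of m]
    proof eventually_elim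
      case (elim n)
      then have n: "1 \<le> n" "B \<in> sets (A n)" using sets_A_mono[OF m(1)] m by auto
      have "Np (\<lambda>w. E n (\<lambda>w. indicator B w *\<^sub>R y) w - indicator B w *\<^sub>R y) = Np (\<lambda>w. 0 :: 'x)"
        by (rule Lp_norm_cong) (use E_indicator[OF n, of y] in \<open>eventually_elim, simp\<close>)
      then show ?case by simp
    qed
    then show ?thesis by (rule tendsto_eventually)
  qed
  have sM: "sets M = sigma_sets (space M) ?G" using filtration by (simp add: filtration_generating_def)
  \<comment> \<open>Since the algebras increase, two sets from different stages both lie in the
    later one.\<close>
  have "Int_stable ?G"
  proof (rule Int_stableI)
    fix a b assume "a \<in> ?G" "b \<in> ?G"
    then obtain m n where mn: "1 \<le> m" "a \<in> sets (A m)" "1 \<le> n" "b \<in> sets (A n)" by auto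
    then have "a \<in> sets (A (max m n))" "b \<in> sets (A (max m n))"
      using sets_A_mono[of m "max m n"] sets_A_mono[of n "max m n"] by auto
    then have "a \<inter> b \<in> sets (A (max m n))" by (rule sets.Int)
    then show "a \<inter> b \<in> ?G" using mn by (intro UN_I[of "max m n"]) auto
  qed
  moreover have "?G \<subseteq> Pow (space M)"
    using sets.sets_into_space subalgebra_A by (fastforce simp: subalgebra_def)
  moreover have "B \<in> sigma_sets (space M) ?G" using B sM by simp
  ultimately show ?thesis
  proof (induction B rule: sigma_sets_induct_disjoint)
    case (basic B)
    then show ?case by (rule \<open>\<And>B. B \<in> ?G \<Longrightarrow> conv (\<lambda>w. indicator B w *\<^sub>R y)\<close>)
  next
    case empty
    have "{} \<in> sets (A 1)" by simp
    then show ?case by (intro basic) blast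
  next
    case (compl B)
    have BM: "B \<in> sets M" using compl sM by simp
    have "space (A 1) \<in> sets (A 1)" by simp
    then have "space M \<in> sets (A 1)" using subalgebra_A[of 1] by (metis subalgebra_def order_refl)
    then have sp: "space M \<in> ?G" by (intro UN_I[of 1]) auto
    have "conv (\<lambda>w. 1 *\<^sub>R (indicator (space M) w *\<^sub>R y) + (-1) *\<^sub>R (indicator B w *\<^sub>R y))"
      by (intro conv_linear indicator_scaleR_space BM basic[OF sp] compl.IH sets.top)
    then show ?case
    proof (rule conv_cong[rotated -1])
      show "(\<lambda>w. 1 *\<^sub>R (indicator (space M) w *\<^sub>R y) + (-1) *\<^sub>R (indicator B w *\<^sub>R y)) \<in> Lp"
        by (intro Lp_space_add Lp_space_scaleR p indicator_scaleR_space BM sets.top)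
      show "(\<lambda>w. indicator (space M - B) w *\<^sub>R y) \<in> Lp"
        by (intro indicator_scaleR_space sets.compl_sets BM)
      show "AE w in M. 1 *\<^sub>R (indicator (space M) w *\<^sub>R y) + (-1) *\<^sub>R (indicator B w *\<^sub>R y) = indicator (space M - B) w *\<^sub>R y"
        using sets.sets_into_space[OF BM] by (intro AE_I2) (auto simp: indicator_def)
    qed
  next
    case (union B)
    have BM: "B i \<in> sets M" for i using union sM by auto
    let ?h = "\<lambda>N w. \<Sum>i<N. indicator (B i) w *\<^sub>R y"
    let ?f = "\<lambda>w. indicator (\<Union>i. B i) w *\<^sub>R y"
    have UM: "(\<Union>i. B i) \<in> sets M" using BM by auto
    show ?case
    proof (rule conv_limit[of ?h])
      show "?h N \<in> Lp" for N by (intro Lp_space_sum p indicator_scaleR_space BM)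
      show "conv (?h N)" for N by (intro conv_sum indicator_scaleR_space BM union)
      show "?f \<in> Lp" by (intro indicator_scaleR_space UM)
      \<comment> \<open>Disjointness turns the partial sum into a single indicator, so that the
        constant \<open>norm y\<close> dominates all errors.\<close>
      have h_eq: "?h N w = indicator (\<Union>i<N. B i) w *\<^sub>R y" for N w
      proof -
        have "(\<Sum>i<N. indicat_real (B i) w) = indicator (\<Union>i<N. B i) w"
          using union(1) by (intro indicator_UN_disjoint[symmetric]) (auto intro: disjoint_family_on_mono)
        then show ?thesis by (simp flip: scaleR_sum_left)
      qed
      show "(\<lambda>N. Np (\<lambda>w. ?h N w - ?f w)) \<longlonglongrightarrow> 0"
      proof (rule Lp_dominated_convergence[OF p, where h="\<lambda>w. norm y"])
        show "strongly_measurable M (?h N)" for N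
          by (intro Lp_spaceD(1)[of _ p] Lp_space_sum p indicator_scaleR_space BM)
        show "strongly_measurable M ?f" by (intro Lp_spaceD(1)[of _ p] indicator_scaleR_space UM)
        show "(\<lambda>w. norm y) \<in> Lp"
          using p by (intro Lp_space_simple finite_measure_axioms) auto
        show "norm (?h N w - ?f w) \<le> norm y" for N w
          unfolding h_eq by (auto simp: indicator_def)
        show "(\<lambda>N. ?h N w) \<longlonglongrightarrow> ?f w" for w
          unfolding h_eq by (intro tendsto_scaleR tendsto_const LIMSEQ_indicator_UN)
      qed
    qed
  qed
qed

lemma E_tendsto:
  assumes f: "f \<in> Lp"
  shows "(\<lambda>n. Np (\<lambda>w. E n f w - f w)) \<longlonglongrightarrow> 0"
proof -
  obtain s where s: "\<And>i::nat. simple_function M (s i)" "(\<lambda>i. Np (\<lambda>w. s i w - f w)) \<longlonglongrightarrow> 0"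
    using Lp_dense_simple[OF p f] by blast
  have sL: "s i \<in> Lp" for i using p by (intro Lp_space_simple finite_measure_axioms s) simp
  have "conv (s i)" for i
  proof (rule conv_cong)
    let ?B = "\<lambda>y. {v \<in> space M. s i v = y}"
    have B: "?B y \<in> sets M" for y
      using simple_functionD(2)[OF s(1), of i "{y}"] by (simp add: vimage_def Int_def conj_commute)
    show "conv (\<lambda>w. \<Sum>y\<in>s i ` space M. indicator (?B y) w *\<^sub>R y)"
      by (intro conv_sum indicator_scaleR_space conv_indicator B)
    show "(\<lambda>w. \<Sum>y\<in>s i ` space M. indicator (?B y) w *\<^sub>R y) \<in> Lp"
      by (intro Lp_space_sum p indicator_scaleR_space B)
    show "AE w in M. (\<Sum>y\<in>s i ` space M. indicator (?B y) w *\<^sub>R y) = s i w"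
    proof (rule AE_I2)
      fix w assume w: "w \<in> space M"
      then have "(\<Sum>y\<in>s i ` space M. indicator (?B y) w *\<^sub>R y) = (\<Sum>y\<in>s i ` space M. if s i w = y then y else 0)"
        by (intro sum.cong) (auto simp: indicator_def)
      also have "\<dots> = s i w"
        using w simple_functionD(1)[OF s(1), of i] by (simp add: sum.delta)
      finally show "(\<Sum>y\<in>s i ` space M. indicator (?B y) w *\<^sub>R y) = s i w" .
    qed
  qed (rule sL)
  then show ?thesis by (rule conv_limit[OF sL _ f s(2)])
qed

end

section \<open>The semigroup\<close>

text \<open>The value 0 at index 0 gives \<open>knot 0 = 0\<close>: the first difference dE_1 = E_1
  is left untouched, whence F = E_1. From index 1 on these are the \<open>\<mu> n\<close> of the
  square function estimates, shifted by one.\<close>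

definition rate :: "nat \<Rightarrow> real" where
  "rate n = (if n = 0 then 0 else 1024 ^ n)"

definition knot :: "nat \<Rightarrow> real" where
  "knot n = 1 - exp (- rate n)"

lemma rate_simps [simp]: "rate 0 = 0" "rate (Suc n) = \<mu> n"
  by (simp_all add: rate_def)

lemma rate_nonneg: "0 \<le> rate n"
  by (simp add: rate_def)

lemma rate_ge_1: "1 \<le> n \<Longrightarrow> 1 \<le> rate n"
  by (simp add: rate_def)

lemma rate_le_square: "rate n \<le> (rate n)\<^sup>2"
  using rate_ge_1[of n] by (cases "n = 0") (auto simp: power2_eq_square intro: mult_left_mono[of 1 "rate n" "rate n", simplified])

lemma strict_mono_rate: "strict_mono rate"
proof (rule strict_mono_Suc_iff[THEN iffD2], rule allI)
  show "rate n < rate (Suc n)" for n by (cases n) simp_all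
qed

lemma knot_powr: "(1 - knot n) powr t = exp (- rate n * t)"
  by (simp add: knot_def powr_def mult.commute)

text \<open>Up to the shift of the index, the terms are the squares of those in
  \<open>\<mu>_exp_le\<close> at time \<open>t/2\<close>. This series controls the remainder of the
  difference quotients, and since every rate is 0 or at least 1 it also dominates the lower-order
  series, for the plain exponentials from index 1 on.\<close>

lemma summable_rate_square:
  assumes t: "0 < t"
  shows "summable (\<lambda>n. (rate n)\<^sup>2 * exp (- rate n * t))"
proof -
  define C where "C = 4 / (t/2)\<^sup>2"
  have "summable (\<lambda>n. (rate (Suc n))\<^sup>2 * exp (- rate (Suc n) * t))"
  proof (rule summable_comparison_test')
    show "summable (\<lambda>n. C\<^sup>2 * (1/2) ^ n)" by (intro summable_mult summable_geometric) simp
    fix n :: nat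
    have e: "(\<mu> n * exp (- \<mu> n * (t/2)))\<^sup>2 = (rate (Suc n))\<^sup>2 * exp (- rate (Suc n) * t)"
      by (simp add: power_mult_distrib exp_double[symmetric])
    have "(\<mu> n * exp (- \<mu> n * (t/2)))\<^sup>2 \<le> (C * (1/2) ^ n)\<^sup>2"
      using \<mu>_exp_le[of "t/2" n] t by (intro power_mono) (auto simp: C_def)
    also have "\<dots> = C\<^sup>2 * ((1/2) ^ n * (1/2) ^ n)" by (simp add: power2_eq_square)
    also have "\<dots> \<le> C\<^sup>2 * ((1/2) ^ n * 1)" by (intro mult_left_mono) (auto simp: power_le_one)
    finally show "norm ((rate (Suc n))\<^sup>2 * exp (- rate (Suc n) * t)) \<le> C\<^sup>2 * (1/2) ^ n"
      unfolding e by simp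
  qed
  then show ?thesis
    using summable_Suc_iff[of "\<lambda>n. (rate n)\<^sup>2 * exp (- rate n * t)"] by blast
qed

lemma summable_rate:
  assumes t: "0 < t"
  shows "summable (\<lambda>n. \<bar>- (rate n * exp (- rate n * t))\<bar>)"
  by (rule summable_comparison_test'[OF summable_rate_square[OF t]])
    (auto simp: abs_mult rate_nonneg rate_le_square intro!: mult_right_mono)

lemma summable_exp_rate:
  assumes t: "0 < t"
  shows "summable (\<lambda>n. \<bar>exp (- rate n * t)\<bar>)"
proof (rule summable_comparison_test'[OF summable_rate_square[OF t], of 1])
  fix n :: nat assume "1 \<le> n"
  then have "1 \<le> (rate n)\<^sup>2" using rate_ge_1[of n] by (simp add: one_le_power)
  then have "1 * exp (- rate n * t) \<le> (rate n)\<^sup>2 * exp (- rate n * t)"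
    by (rule mult_right_mono) simp
  then show "norm \<bar>exp (- rate n * t)\<bar> \<le> (rate n)\<^sup>2 * exp (- rate n * t)" by simp
qed

lemma exp_rate_tendsto_0: "0 < t \<Longrightarrow> (\<lambda>n. exp (- rate n * t)) \<longlonglongrightarrow> 0"
  using summable_LIMSEQ_zero[OF summable_exp_rate] by simp

lemma knot_limit: "knot \<longlonglongrightarrow> 1"
  using tendsto_diff[OF tendsto_const exp_rate_tendsto_0[of 1], of 1] by (simp add: knot_def[abs_def])

lemma strict_mono_knot: "strict_mono knot"
  using strict_mono_rate by (auto simp: strict_mono_def knot_def)

text \<open>Second-order Maclaurin expansion of \<open>exp (- l * h)\<close>. The restriction on
  \<open>h\<close> ensures that the factor \<open>exp \<theta>\<close> in the remainder uses up at
  most half of the decay \<open>exp (- l * t)\<close>.\<close>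

lemma exp_difference_quotient_le:
  fixes l t h :: real
  assumes l: "0 \<le> l" and h: "h \<noteq> 0" "\<bar>h\<bar> \<le> t / 2"
  shows "\<bar>(exp (- l * (t + h)) - exp (- l * t)) / h + l * exp (- l * t)\<bar> \<le> \<bar>h\<bar> * (l\<^sup>2 * exp (- l * (t/2)))"
proof -
  obtain \<theta> where \<theta>: "\<bar>\<theta>\<bar> \<le> \<bar>- l * h\<bar>" "exp (- l * h) = (\<Sum>m<2. (- l * h) ^ m / fact m) + exp \<theta> / fact 2 * (- l * h) ^ 2"
    using Maclaurin_exp_le[of "- l * h" 2] by blast
  have 1: "exp (- l * h) = 1 - l * h + exp \<theta> / 2 * (l * h)\<^sup>2"
    using \<theta>(2) by (simp add: numeral_2_eq_2)
  have "(exp (- l * (t + h)) - exp (- l * t)) / h + l * exp (- l * t) = exp (- l * t) * (exp (- l * h) - 1 + l * h) / h"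
    using h by (simp add: field_simps flip: exp_add)
  also have "\<dots> = h * l\<^sup>2 * (exp (- l * t) * exp \<theta>) / 2"
    using h unfolding 1 by (simp add: field_simps power2_eq_square)
  finally have "\<bar>(exp (- l * (t + h)) - exp (- l * t)) / h + l * exp (- l * t)\<bar> = \<bar>h * l\<^sup>2 * (exp (- l * t) * exp \<theta>) / 2\<bar>"
    by (rule arg_cong)
  also have "\<dots> = \<bar>h\<bar> * (l\<^sup>2 * (exp (- l * t + \<theta>) / 2))"
    by (simp add: abs_mult flip: exp_add)
  also have "\<dots> \<le> \<bar>h\<bar> * (l\<^sup>2 * exp (- l * (t/2)))"
  proof (intro mult_left_mono)
    have "\<theta> \<le> l * (t / 2)"
      using \<theta>(1) l h(2) mult_left_mono[OF h(2) l] by (simp add: abs_mult)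
    then have "exp (- l * t + \<theta>) \<le> exp (- l * (t/2))" by (simp add: field_simps)
    moreover have "exp (- l * t + \<theta>) / 2 \<le> exp (- l * t + \<theta>)" by simp
    ultimately show "exp (- l * t + \<theta>) / 2 \<le> exp (- l * (t/2))" by (rule order_trans[rotated])
  qed auto
  finally show ?thesis .
qed

text \<open>A one-term series, so that \<open>E 1 f\<close> can be compared with \<open>T t\<close>
  coefficient by coefficient.\<close>

lemma Lp_sums_single:
  assumes g: "g \<in> Lp_space p M"
  shows "Lp_sums p M (\<lambda>n w. if n = 0 then g w else 0) g"
proof -
  have "(\<Sum>n<N. if n = 0 then g w else 0) = g w" if "1 \<le> N" for N :: nat and w
    using that by (cases N) (auto simp: sum.lessThan_Suc_shift)
  then have "\<forall>\<^sub>F N in sequentially. Lp_norm p M (\<lambda>w. (\<Sum>n<N. if n = 0 then g w else 0) - g w) = 0"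
    by (intro eventually_sequentiallyI[of 1]) simp
  then have "(\<lambda>N. Lp_norm p M (\<lambda>w. (\<Sum>n<N. if n = 0 then g w else 0) - g w)) \<longlonglongrightarrow> 0"
    by (rule tendsto_eventually)
  moreover have "(\<lambda>w. if n = 0 then g w else 0) \<in> Lp_space p M" for n :: nat
    using g by (cases "n = 0") simp_all
  ultimately show ?thesis using g by (simp add: Lp_sums_def)
qed

section \<open>Contractivity, semigroup law and strong continuity\<close>

context Lp_filtration
begin

abbreviation T :: "real \<Rightarrow> ('a \<Rightarrow> 'x::banach) \<Rightarrow> 'a \<Rightarrow> 'x" where
  "T \<equiv> mart_T p M A knot"

lemma T_sums:
  assumes f: "f \<in> Lp" and t: "0 < t"
  shows "Lp_sums p M (\<lambda>n w. exp (- rate n * t) *\<^sub>R D n f w) (T t f)"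
proof -
  have "\<exists>g. Lp_sums p M (\<lambda>n w. exp (- rate n * t) *\<^sub>R D n f w) g"
    by (intro Lp_sums_exists p Lp_space_scaleR D_space f Lp_sums_multiplier(2) summable_exp_rate t)
  then have "Lp_sums p M (\<lambda>n w. exp (- rate n * t) *\<^sub>R D n f w) (SOME g. Lp_sums p M (\<lambda>n w. exp (- rate n * t) *\<^sub>R D n f w) g)"
    by (rule someI_ex)
  then show ?thesis unfolding mart_T_def knot_powr .
qed

lemma T_space: "f \<in> Lp \<Longrightarrow> 0 < t \<Longrightarrow> T t f \<in> Lp"
  using T_sums by (auto simp: Lp_sums_def)

lemma T_unique:
  assumes f: "f \<in> Lp" and t: "0 < t" and u: "Lp_sums p M u g"
    and eq: "\<And>n. AE w in M. u n w = exp (- rate n * t) *\<^sub>R D n f w"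
  shows "AE w in M. T t f w = g w"
proof (rule Lp_sums_unique[OF p T_sums[OF f t]])
  show "Lp_sums p M (\<lambda>n w. exp (- rate n * t) *\<^sub>R D n f w) g"
    using u by (rule Lp_sums_cong[OF _ eq])
      (use u in \<open>auto simp: Lp_sums_def intro!: Lp_space_scaleR p D_space f\<close>)
qed

lemma T_sums_E:
  assumes f: "f \<in> Lp" and t: "0 < t"
  shows "Lp_sums p M (\<lambda>n w. (exp (- rate n * t) - exp (- rate (Suc n) * t)) *\<^sub>R E (Suc n) f w) (T t f)"
proof -
  let ?c = "\<lambda>n. exp (- rate n * t)"
  let ?u = "\<lambda>n w. (?c n - ?c (Suc n)) *\<^sub>R E (Suc n) f w"
  note ED = E_measurable[OF f] D_measurable[OF f] Lp_spaceD(1)[OF T_space[OF f t]]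
  \<comment> \<open>Summation by parts leaves the boundary term
    \<open>?c N *\<^sub>R E N f w\<close>, which vanishes in the limit because the norms of
    \<open>E N f\<close> are bounded.\<close>
  have parts: "(\<Sum>n<N. ?u n w) = (\<Sum>n<N. ?c n *\<^sub>R D n f w) - ?c N *\<^sub>R E N f w" for N w
    by (induction N) (simp_all add: D_def algebra_simps)
  let ?d = "\<lambda>N. Np (\<lambda>w. (\<Sum>n<N. ?c n *\<^sub>R D n f w) - T t f w) + Np f * ennreal (?c N)"
  have "?d \<longlonglongrightarrow> 0 + Np f * ennreal 0"
    using T_sums[OF f t] Lp_spaceD(2)[OF f] exp_rate_tendsto_0[OF t] unfolding Lp_sums_def
    by (intro tendsto_add ennreal_tendsto_cmult tendsto_ennrealI) auto
  then have d: "?d \<longlonglongrightarrow> 0" by simp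
  have le: "Np (\<lambda>w. (\<Sum>n<N. ?u n w) - T t f w) \<le> ?d N" for N
  proof -
    have "Np (\<lambda>w. (\<Sum>n<N. ?u n w) - T t f w) = Np (\<lambda>w. ((\<Sum>n<N. ?c n *\<^sub>R D n f w) - T t f w) + (- ?c N) *\<^sub>R E N f w)"
      unfolding parts by (simp add: algebra_simps)
    also have "\<dots> \<le> Np (\<lambda>w. (\<Sum>n<N. ?c n *\<^sub>R D n f w) - T t f w) + Np (\<lambda>w. (- ?c N) *\<^sub>R E N f w)"
      by (intro Lp_norm_triangle p strongly_measurable_diff strongly_measurable_sum strongly_measurable_scaleR ED)
    also have "Np (\<lambda>w. (- ?c N) *\<^sub>R E N f w) = ennreal (?c N) * Np (E N f)"
      using p by (subst Lp_norm_scaleR) (simp_all add: ED)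
    also have "\<dots> \<le> Np f * ennreal (?c N)"
      unfolding mult.commute[of "Np f"] by (intro mult_left_mono E_norm_le[OF f]) simp
    finally show ?thesis by (simp add: add_left_mono)
  qed
  have "(\<lambda>N. Np (\<lambda>w. (\<Sum>n<N. ?u n w) - T t f w)) \<longlonglongrightarrow> 0"
    by (rule tendsto_0_le_ennreal[OF le d])
  then show ?thesis
    unfolding Lp_sums_def by (intro conjI allI Lp_space_scaleR p E_space f T_space t)
qed

lemma exp_rate_telescope:
  assumes t: "0 < t"
  shows "(\<lambda>n. exp (- rate n * t) - exp (- rate (Suc n) * t)) sums 1"
    "0 \<le> exp (- rate n * t) - exp (- rate (Suc n) * t)"
proof -
  show "(\<lambda>n. exp (- rate n * t) - exp (- rate (Suc n) * t)) sums 1"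
    using telescope_sums'[OF exp_rate_tendsto_0[OF t]] by simp
  have "rate n \<le> rate (Suc n)" using strict_mono_rate by (simp add: strict_mono_less_eq del: rate_simps)
  then show "0 \<le> exp (- rate n * t) - exp (- rate (Suc n) * t)" using t by (simp add: mult_right_mono del: rate_simps)
qed

lemma T_norm_le:
  assumes f: "f \<in> Lp" and t: "0 < t"
  shows "Np (T t f) \<le> Np f"
proof -
  let ?w = "\<lambda>n. exp (- rate n * t) - exp (- rate (Suc n) * t)"
  note w = exp_rate_telescope[OF t]
  have "Np (T t f) \<le> (\<Sum>n. Np (\<lambda>v. ?w n *\<^sub>R E (Suc n) f v))"
    by (rule Lp_norm_sums_le[OF p T_sums_E[OF f t]])
  also have "\<dots> \<le> (\<Sum>n. ennreal (?w n) * Np f)"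
  proof (intro suminf_le)
    fix n
    have "Np (\<lambda>v. ?w n *\<^sub>R E (Suc n) f v) = ennreal \<bar>?w n\<bar> * Np (E (Suc n) f)"
      using p by (intro Lp_norm_scaleR E_measurable[OF f]) simp
    also have "\<bar>?w n\<bar> = ?w n" using w(2)[of n] by (rule abs_of_nonneg)
    finally show "Np (\<lambda>v. ?w n *\<^sub>R E (Suc n) f v) \<le> ennreal (?w n) * Np f"
      using E_norm_le[OF f, of "Suc n"] by (simp add: mult_left_mono)
  qed auto
  also have "\<dots> = (\<Sum>n. ennreal (?w n)) * Np f" by (rule ennreal_suminf_multc)
  also have "(\<Sum>n. ennreal (?w n)) = ennreal 1" by (rule suminf_ennreal_eq[OF w(2) w(1)])
  finally show ?thesis by simp
qed

lemma T_linear: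
  assumes f: "f \<in> Lp" and g: "g \<in> Lp" and t: "0 < t"
  shows "AE w in M. T t (\<lambda>w. a *\<^sub>R f w + b *\<^sub>R g w) w = a *\<^sub>R T t f w + b *\<^sub>R T t g w"
proof (rule T_unique[OF _ t Lp_sums_linear[OF p T_sums[OF f t] T_sums[OF g t]]])
  show "(\<lambda>w. a *\<^sub>R f w + b *\<^sub>R g w) \<in> Lp" by (intro Lp_space_add Lp_space_scaleR p f g)
  show "AE w in M. a *\<^sub>R (exp (- rate n * t) *\<^sub>R D n f w) + b *\<^sub>R (exp (- rate n * t) *\<^sub>R D n g w) =
    exp (- rate n * t) *\<^sub>R D n (\<lambda>w. a *\<^sub>R f w + b *\<^sub>R g w) w" for n
    using D_linear[OF f g, of n a b] by eventually_elim (simp add: scaleR_add_right mult.commute)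
qed

text \<open>The n-th coefficient of \<open>T t f\<close> is \<open>exp (- rate n * t)\<close>, so
  applying \<open>T s\<close> multiplies the exponentials.\<close>

lemma T_semigroup:
  assumes f: "f \<in> Lp" and s: "0 < s" and t: "0 < t"
  shows "AE w in M. T (s + t) f w = T s (T t f) w"
proof (rule T_unique[OF f _ T_sums[OF T_space[OF f t] s]])
  show "AE w in M. exp (- rate n * s) *\<^sub>R D n (T t f) w = exp (- rate n * (s + t)) *\<^sub>R D n f w" for n
    using D_of_Lp_sums[OF f T_sums[OF f t], of n] by eventually_elim (simp add: distrib_left exp_diff exp_minus field_simps flip: exp_add)
qed (use s t in simp)

text \<open>\<open>T t f - f\<close> averages \<open>E (Suc n) f - f\<close>. The differences with
  \<open>n \<ge> N\<close> are small, and the indices below \<open>N\<close> carry the total weight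
  \<open>1 - exp (- rate N * t)\<close>, which tends to 0 with \<open>t\<close>.\<close>

lemma T_continuous:
  assumes f: "f \<in> Lp"
  shows "((\<lambda>t. Np (\<lambda>w. T t f w - f w)) \<longlongrightarrow> 0) (at_right 0)"
proof (rule tendsto_0_if_eventually_less)
  fix e :: real assume e: "0 < e"
  obtain l where l: "Np f = ennreal l" "0 \<le> l" using Lp_spaceD(2)[OF f] by (auto simp: less_top_ennreal)
  have fm: "strongly_measurable M f" using f by (rule Lp_spaceD)
  have diff_le: "Np (\<lambda>w. E n f w - f w) \<le> ennreal (2 * l)" for n
  proof -
    have "Np (\<lambda>w. E n f w + (-1) *\<^sub>R f w) \<le> Np (E n f) + Np (\<lambda>w. (-1) *\<^sub>R f w)"
      by (intro Lp_norm_triangle p strongly_measurable_scaleR fm E_measurable[OF f])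
    also have "\<dots> \<le> ennreal l + ennreal l"
      using E_norm_le[OF f, of n] l by (intro add_mono) (simp_all add: Lp_norm_uminus)
    finally show ?thesis using l by (simp flip: ennreal_plus)
  qed
  have "\<forall>\<^sub>F n in sequentially. Np (\<lambda>w. E n f w - f w) < ennreal (e/2)"
    using e by (intro order_tendstoD(2)[OF E_tendsto[OF f]]) simp
  then obtain N where N: "\<And>n. N \<le> n \<Longrightarrow> Np (\<lambda>w. E n f w - f w) < ennreal (e/2)"
    by (auto simp: eventually_sequentially)
  have "((\<lambda>t. (1 - exp (- rate N * t)) * (2 * l)) \<longlongrightarrow> (1 - exp (- rate N * 0)) * (2 * l)) (at_right 0)"
    by (intro tendsto_intros)
  then have "\<forall>\<^sub>F t in at_right 0. (1 - exp (- rate N * t)) * (2 * l) < e / 2"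
    using e by (intro order_tendstoD(2)) auto
  moreover have "\<forall>\<^sub>F t in at_right (0::real). 0 < t" by (rule eventually_at_right_less)
  ultimately show "\<forall>\<^sub>F t in at_right 0. Np (\<lambda>w. T t f w - f w) \<le> ennreal e"
  proof eventually_elim
    case (elim t)
    let ?w = "\<lambda>n. exp (- rate n * t) - exp (- rate (Suc n) * t)"
    note w = exp_rate_telescope[OF elim(2)]
    let ?u = "\<lambda>n v. 1 *\<^sub>R (?w n *\<^sub>R E (Suc n) f v) + (-1) *\<^sub>R (?w n *\<^sub>R f v)"
    have "Lp_sums p M ?u (\<lambda>v. 1 *\<^sub>R T t f v + (-1) *\<^sub>R (1 *\<^sub>R f v))"
      by (intro Lp_sums_linear p T_sums_E f elim(2) Lp_sums_scaleR_const w(1))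
    from Lp_norm_sums_le[OF p this] have "Np (\<lambda>v. T t f v - f v) \<le> (\<Sum>n. Np (?u n))" by simp
    also have "\<dots> \<le> (\<Sum>n. ennreal (?w n * (e/2) + (if n < N then ?w n * (2 * l) else 0)))"
    proof (intro suminf_le)
      fix n
      have "?u n = (\<lambda>v. ?w n *\<^sub>R (E (Suc n) f v - f v))"
        by (simp only: scaleR_one scaleR_minus1_left scaleR_diff_right add_uminus_conv_diff)
      then have "Np (?u n) = Np (\<lambda>v. ?w n *\<^sub>R (E (Suc n) f v - f v))"
        by (rule arg_cong)
      also have "\<dots> = ennreal \<bar>?w n\<bar> * Np (\<lambda>v. E (Suc n) f v - f v)"
        using p by (intro Lp_norm_scaleR strongly_measurable_diff fm E_measurable[OF f]) simp
      also have "\<bar>?w n\<bar> = ?w n" using w(2)[of n] by (rule abs_of_nonneg)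
      also have "Np (\<lambda>v. E (Suc n) f v - f v) \<le> ennreal (e/2 + (if n < N then 2 * l else 0))"
      proof (cases "n < N")
        case True
        then show ?thesis using diff_le[of "Suc n"] e l by (auto intro: order_trans ennreal_leI)
      next
        case False
        then show ?thesis using N[of "Suc n"] by simp
      qed
      then have "ennreal (?w n) * Np (\<lambda>v. E (Suc n) f v - f v) \<le> ennreal (?w n) * ennreal (e/2 + (if n < N then 2 * l else 0))"
        by (rule mult_left_mono) simp
      also have "\<dots> = ennreal (?w n * (e/2 + (if n < N then 2 * l else 0)))"
        by (rule ennreal_mult'[OF w(2), symmetric])
      also have "?w n * (e/2 + (if n < N then 2 * l else 0)) = ?w n * (e/2) + (if n < N then ?w n * (2 * l) else 0)"
        by (simp add: distrib_left del: rate_simps)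
      finally show "Np (?u n) \<le> ennreal (?w n * (e/2) + (if n < N then ?w n * (2 * l) else 0))" .
    qed auto
    also have "\<dots> = ennreal (1 * (e/2) + (\<Sum>n<N. ?w n * (2 * l)))"
    proof (rule suminf_ennreal_eq)
      show "0 \<le> ?w n * (e/2) + (if n < N then ?w n * (2 * l) else 0)" for n
        using w(2)[of n] e l by (auto simp del: rate_simps)
      have "(\<lambda>n. if n < N then ?w n * (2 * l) else 0) sums (\<Sum>n | n < N. ?w n * (2 * l))"
        by (rule sums_If_finite) simp
      then have "(\<lambda>n. if n < N then ?w n * (2 * l) else 0) sums (\<Sum>n<N. ?w n * (2 * l))"
        by (simp only: lessThan_def)
      then show "(\<lambda>n. ?w n * (e/2) + (if n < N then ?w n * (2 * l) else 0)) sums (1 * (e/2) + (\<Sum>n<N. ?w n * (2 * l)))"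
        by (intro sums_add sums_mult2 w(1))
    qed
    also have "(\<Sum>n<N. ?w n * (2 * l)) = (1 - exp (- rate N * t)) * (2 * l)"
      unfolding sum_distrib_right[symmetric] sum_lessThan_telescope'[of "\<lambda>n. exp (- rate n * t)"] by simp
    also have "ennreal (1 * (e/2) + (1 - exp (- rate N * t)) * (2 * l)) \<le> ennreal e"
      using elim(1) by (intro ennreal_leI) simp
    finally show ?case .
  qed
qed

lemma contraction_semigroup_T:
  "contraction_semigroup p M (T :: real \<Rightarrow> ('a \<Rightarrow> 'x::banach) \<Rightarrow> 'a \<Rightarrow> 'x)"
  unfolding contraction_semigroup_def Lp_bounded_operator_def
proof (intro conjI allI impI ballI)
  fix t :: real and f g :: "'a \<Rightarrow> 'x" and r
  assume t: "0 < t" and f: "f \<in> Lp"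
  show "T t f \<in> Lp" by (rule T_space[OF f t])
  show "Np (T t f) \<le> ennreal 1 * Np f" using T_norm_le[OF f t] by simp
  show "AE w in M. T t (\<lambda>v. r *\<^sub>R f v) w = r *\<^sub>R T t f w"
    using T_linear[OF f f t, of r 0] by simp
  show "AE w in M. T t (\<lambda>v. f v + g v) w = T t f w + T t g w" if "g \<in> Lp"
    using T_linear[OF f that t, of 1 1] by simp
qed (auto intro: T_semigroup T_continuous)

section \<open>The fixed points of the semigroup\<close>

lemma T_E_1:
  assumes f: "f \<in> Lp" and t: "0 < t"
  shows "AE w in M. T t (E 1 f) w = E 1 f w"
proof (rule T_unique[OF E_space[OF f] t Lp_sums_single[OF E_space[OF f]]])
  show "AE w in M. (if n = 0 then E 1 f w else 0) = exp (- rate n * t) *\<^sub>R D n (E 1 f) w" for n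
    using D_E[OF f, of n 1] by eventually_elim (auto simp: D_def)
qed

text \<open>A single time suffices: comparing coefficients at time 1 gives
  \<open>(1 - exp (- rate n)) *\<^sub>R D n f = 0\<close>, and the factor is nonzero for every
  \<open>n \<ge> 1\<close>.\<close>

lemma fixed_eq_E_1:
  assumes f: "f \<in> Lp" and fixed: "AE w in M. T 1 f w = f w"
  shows "AE w in M. E 1 f w = f w"
proof -
  have "AE w in M. T 1 f w = E 1 f w"
  proof (rule T_unique[OF f _ Lp_sums_single[OF E_space[OF f]]])
    fix n
    have 1: "AE w in M. D n (T 1 f) w = D n f w"
      using f fixed by (intro D_cong T_space) auto
    have 2: "AE w in M. D n (T 1 f) w = exp (- rate n * 1) *\<^sub>R D n f w"
      by (rule D_of_Lp_sums[OF f T_sums[OF f]]) simp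
    show "AE w in M. (if n = 0 then E 1 f w else 0) = exp (- rate n * 1) *\<^sub>R D n f w"
      using 1 2
    proof eventually_elim
      case (elim w)
      show ?case
      proof (cases "n = 0")
        case True
        then show ?thesis by (simp add: D_def)
      next
        case False
        then have "exp (- rate n * 1) \<noteq> 1" using rate_ge_1[of n] by simp
        moreover have "(1 - exp (- rate n * 1)) *\<^sub>R D n f w = 0" using elim by (simp add: scaleR_diff_left)
        ultimately have "D n f w = 0" by simp
        then show ?thesis using False by simp
      qed
    qed
  qed simp
  with fixed show ?thesis by eventually_elim simp
qed

lemma is_fixed_projection_E_1:
  "is_fixed_projection p M (T :: real \<Rightarrow> ('a \<Rightarrow> 'x::banach) \<Rightarrow> 'a \<Rightarrow> 'x) (E 1)"
  unfolding is_fixed_projection_def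
proof (intro conjI ballI exI[of _ 1])
  show "Lp_bounded_operator p M 1 (E 1 :: ('a \<Rightarrow> 'x) \<Rightarrow> 'a \<Rightarrow> 'x)"
    unfolding Lp_bounded_operator_def
  proof (intro conjI allI ballI)
    fix f g :: "'a \<Rightarrow> 'x" and r
    assume f: "f \<in> Lp"
    show "E 1 f \<in> Lp" by (rule E_space[OF f])
    show "Np (E 1 f) \<le> ennreal 1 * Np f" using E_norm_le[OF f] by simp
    show "AE w in M. E 1 (\<lambda>v. r *\<^sub>R f v) w = r *\<^sub>R E 1 f w"
      using E_linear[OF f f, of 1 r 0] by simp
    show "AE w in M. E 1 (\<lambda>v. f v + g v) w = E 1 f w + E 1 g w" if "g \<in> Lp"
      using E_linear[OF f that, of 1 1 1] by simp
  qed
  show "E 1 f \<in> fixed_space p M T" if "f \<in> Lp" for f :: "'a \<Rightarrow> 'x"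
    using T_E_1[OF that] E_space[OF that] by (simp add: fixed_space_def)
  show "AE w in M. E 1 f w = f w" if "f \<in> fixed_space p M T" for f :: "'a \<Rightarrow> 'x"
    using that by (intro fixed_eq_E_1) (auto simp: fixed_space_def)
qed

section \<open>The derivative in time\<close>

text \<open>At the points of this set the series for the derivative converges for all \<open>t\<close> at once.\<close>

definition summable_set :: "('a \<Rightarrow> 'x::banach) \<Rightarrow> 'a set" where
  "summable_set f = {w \<in> space M. (\<Sum>n. ennreal (norm ((1/2) ^ n *\<^sub>R D (Suc n) f w))) < \<top>}"

text \<open>The term of rate 0 has no derivative, so the series starts at \<open>D 1 f\<close>; the
  sign compensates that of \<open>heat_deriv\<close>. The exceptional set does not depend on
  \<open>t\<close>, so the series is summed on a measurable rectangle, which gives joint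
  measurability.\<close>

definition deriv_T :: "('a \<Rightarrow> 'x::banach) \<Rightarrow> real \<Rightarrow> 'a \<Rightarrow> 'x" where
  "deriv_T f t w = (if 0 < t \<and> w \<in> summable_set f then - heat_deriv (\<lambda>n. D (Suc n) f w) t else 0)"

context
  fixes f :: "'a \<Rightarrow> 'x::banach"
  assumes f: "f \<in> Lp"
begin

lemma summable_set_sets: "summable_set f \<in> sets M"
proof -
  note [measurable] = strongly_measurable_norm[OF D_measurable[OF f]]
  show ?thesis unfolding summable_set_def by simp
qed

lemma AE_summable_set: "AE w in M. w \<in> summable_set f"
proof -
  \<comment> \<open>The factor 2 makes \<open>c (n + 1)\<close> equal to \<open>(1/2) ^ n\<close>,
    matching the shift by one in \<open>summable_set\<close>.\<close>
  define c :: "nat \<Rightarrow> real" where "c n = 2 * (1/2) ^ n" for n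
  have "(\<Sum>n. Np (\<lambda>w. c n *\<^sub>R D n f w)) < \<top>"
    by (rule Lp_sums_multiplier(2)[OF f]) (auto simp: c_def intro!: summable_mult summable_geometric)
  moreover have "(\<Sum>n. Np (\<lambda>w. c n *\<^sub>R D n f w)) =
      (\<Sum>n. Np (\<lambda>w. c (n + 1) *\<^sub>R D (n + 1) f w)) + (\<Sum>n<1. Np (\<lambda>w. c n *\<^sub>R D n f w))"
    by (rule suminf_offset) simp
  ultimately have "(\<Sum>n. Np (\<lambda>w. (1/2) ^ n *\<^sub>R D (Suc n) f w)) < \<top>"
    by (simp add: c_def ennreal_add_less_top)
  from AE_suminf_norm_finite[OF p _ this]
  have "AE w in M. (\<Sum>n. ennreal (norm ((1/2) ^ n *\<^sub>R D (Suc n) f w))) < \<top>"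
    by (auto intro!: strongly_measurable_scaleR D_measurable[OF f])
  then show ?thesis using AE_space by eventually_elim (simp add: summable_set_def)
qed

lemma summable_setD:
  assumes "w \<in> summable_set f"
  shows "summable (\<lambda>n. (1/2) ^ n * norm (D (Suc n) f w))"
proof -
  have "summable (\<lambda>n. norm ((1/2::real) ^ n *\<^sub>R D (Suc n) f w))"
    using assms unfolding summable_norm_iff_ennreal summable_set_def by simp
  then show ?thesis by simp
qed

lemma deriv_T_eq_suminf:
  assumes t: "0 < t" and w: "w \<in> summable_set f"
  shows "deriv_T f t w = (\<Sum>n. (- (\<mu> n * exp (- \<mu> n * t))) *\<^sub>R D (Suc n) f w)"
    and "summable (\<lambda>n. (- (\<mu> n * exp (- \<mu> n * t))) *\<^sub>R D (Suc n) f w)"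
proof -
  note s = summable_norm_cancel[OF summable_heat_deriv[OF summable_setD[OF w] t]]
  show "deriv_T f t w = (\<Sum>n. (- (\<mu> n * exp (- \<mu> n * t))) *\<^sub>R D (Suc n) f w)"
    using t w suminf_minus[OF s] by (simp add: deriv_T_def heat_deriv_def)
  show "summable (\<lambda>n. (- (\<mu> n * exp (- \<mu> n * t))) *\<^sub>R D (Suc n) f w)"
    using summable_minus[OF s] by simp
qed

lemma strongly_measurable_deriv_T:
  "strongly_measurable (restrict_space lborel {0<..} \<Otimes>\<^sub>M M) (\<lambda>(t, w). deriv_T f t w)"
proof -
  let ?N = "restrict_space lborel {0<..} :: real measure"
  let ?A = "{0<..} \<times> summable_set f"
  let ?u = "\<lambda>n z. (- (\<mu> n * exp (- \<mu> n * fst z))) *\<^sub>R D (Suc n) f (snd z)"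
  have "strongly_measurable (?N \<Otimes>\<^sub>M M) (\<lambda>z. if z \<in> ?A then \<Sum>n. ?u n z else 0)"
  proof (rule strongly_measurable_If_suminf)
    have [measurable]: "(\<lambda>z. fst z :: real) \<in> borel_measurable (?N \<Otimes>\<^sub>M M)"
      by (rule measurable_compose[OF measurable_fst]) (simp add: measurable_restrict_space1)
    show "strongly_measurable (?N \<Otimes>\<^sub>M M) (?u n)" for n
      by (intro strongly_measurable_scaleR_fun strongly_measurable_real
          strongly_measurable_comp[OF measurable_snd D_measurable[OF f]]) measurable
    have "{0<..} \<in> sets ?N" by (simp add: sets_restrict_space_iff)
    then show "?A \<in> sets (?N \<Otimes>\<^sub>M M)" using summable_set_sets by (rule pair_measureI)
    show "summable (\<lambda>n. ?u n z)" if "z \<in> ?A" for z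
      using that deriv_T_eq_suminf(2)[of "fst z" "snd z"] by auto
  qed
  also have "(\<lambda>z. if z \<in> ?A then \<Sum>n. ?u n z else 0) = (\<lambda>(t, w). deriv_T f t w)"
  proof (rule ext)
    fix z :: "real \<times> 'a"
    obtain t w where z: "z = (t, w)" by (cases z)
    show "(if z \<in> ?A then \<Sum>n. ?u n z else 0) = (case z of (t, w) \<Rightarrow> deriv_T f t w)"
    proof (cases "0 < t \<and> w \<in> summable_set f")
      case True
      then show ?thesis using deriv_T_eq_suminf(1)[of t w] by (simp add: z)
    next
      case False
      then show ?thesis by (auto simp: z deriv_T_def)
    qed
  qed
  finally show ?thesis .
qed

lemma deriv_T_sums:
  assumes t: "0 < t"
  shows "Lp_sums p M (\<lambda>n w. (- (rate n * exp (- rate n * t))) *\<^sub>R D n f w) (deriv_T f t)"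
proof (rule Lp_sums_AE_suminf[OF p])
  show "(\<lambda>w. (- (rate n * exp (- rate n * t))) *\<^sub>R D n f w) \<in> Lp" for n
    by (intro Lp_space_scaleR p D_space f)
  show "(\<Sum>n. Np (\<lambda>w. (- (rate n * exp (- rate n * t))) *\<^sub>R D n f w)) < \<top>"
    by (rule Lp_sums_multiplier(2)[OF f summable_rate[OF t]])
  have "strongly_measurable M (\<lambda>w. if w \<in> summable_set f then \<Sum>n. (- (\<mu> n * exp (- \<mu> n * t))) *\<^sub>R D (Suc n) f w else 0)"
    by (rule strongly_measurable_If_suminf[OF _ summable_set_sets deriv_T_eq_suminf(2)[OF t]])
      (intro strongly_measurable_scaleR D_measurable[OF f])
  also have "(\<lambda>w. if w \<in> summable_set f then \<Sum>n. (- (\<mu> n * exp (- \<mu> n * t))) *\<^sub>R D (Suc n) f w else 0) = deriv_T f t"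
  proof (rule ext)
    show "(if w \<in> summable_set f then \<Sum>n. (- (\<mu> n * exp (- \<mu> n * t))) *\<^sub>R D (Suc n) f w else 0) = deriv_T f t w" for w
      using deriv_T_eq_suminf(1)[OF t, of w] by (cases "w \<in> summable_set f") (auto simp: deriv_T_def)
  qed
  finally show "strongly_measurable M (deriv_T f t)" .
  show "AE w in M. deriv_T f t w = (\<Sum>n. (- (rate n * exp (- rate n * t))) *\<^sub>R D n f w)"
    using AE_summable_set
  proof eventually_elim
    case (elim w)
    let ?u = "\<lambda>n. (- (rate n * exp (- rate n * t))) *\<^sub>R D n f w"
    have "summable (\<lambda>n. ?u (Suc n))" using deriv_T_eq_suminf(2)[OF t elim] by (simp only: rate_simps)
    then have "summable ?u" by (subst (asm) summable_Suc_iff)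
    \<comment> \<open>The omitted term \<open>?u 0\<close> vanishes because
      \<open>rate 0 = 0\<close>.\<close>
    then have "(\<Sum>n. ?u (Suc n)) = suminf ?u - ?u 0" by (rule suminf_split_head)
    then show ?case unfolding deriv_T_eq_suminf(1)[OF t elim] by simp
  qed
qed

lemma deriv_T_space: "0 < t \<Longrightarrow> deriv_T f t \<in> Lp"
  using deriv_T_sums by (auto simp: Lp_sums_def)

text \<open>The error is again a series of multiples of the \<open>D n f\<close>, with coefficients
  bounded by \<open>\<bar>h\<bar>\<close> times a fixed summable sequence; the multiplier bound then
  makes its norm of order \<open>\<bar>h\<bar>\<close>.\<close>

lemma difference_quotient_tendsto:
  assumes t: "0 < t"
  shows "((\<lambda>h. Np (\<lambda>w. (T (t + h) f w - T t f w) /\<^sub>R h - deriv_T f t w)) \<longlongrightarrow> 0) (at 0)"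
proof -
  obtain l where l: "Np f = ennreal l" "0 \<le> l" using Lp_spaceD(2)[OF f] by (auto simp: less_top_ennreal)
  have t2: "0 < t / 2" using t by simp
  define K where "K = (\<Sum>n. (rate n)\<^sup>2 * exp (- rate n * (t/2)))"
  have K0: "0 \<le> K" unfolding K_def by (intro suminf_nonneg summable_rate_square t2) simp
  have bound: "Np (\<lambda>w. (T (t + h) f w - T t f w) /\<^sub>R h - deriv_T f t w) \<le> ennreal (\<bar>h\<bar> * K * (2 * l))"
    if h: "h \<noteq> 0" "\<bar>h\<bar> \<le> t / 2" for h
  proof -
    have th: "0 < t + h" using h t by linarith
    define b where "b n = (exp (- rate n * (t + h)) - exp (- rate n * t)) / h + rate n * exp (- rate n * t)" for n
    have b_le: "\<bar>b n\<bar> \<le> \<bar>h\<bar> * ((rate n)\<^sup>2 * exp (- rate n * (t/2)))" for n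
      unfolding b_def using h by (intro exp_difference_quotient_le rate_nonneg)
    have sb': "summable (\<lambda>n. \<bar>h\<bar> * ((rate n)\<^sup>2 * exp (- rate n * (t/2))))"
      by (intro summable_mult summable_rate_square t2)
    have sb: "summable (\<lambda>n. \<bar>b n\<bar>)"
      by (rule summable_comparison_test'[OF sb']) (use b_le in simp)
    have "(\<Sum>n. \<bar>b n\<bar>) \<le> (\<Sum>n. \<bar>h\<bar> * ((rate n)\<^sup>2 * exp (- rate n * (t/2))))"
      by (rule suminf_le[OF b_le sb sb'])
    also have "\<dots> = \<bar>h\<bar> * K" unfolding K_def by (rule suminf_mult[OF summable_rate_square[OF t2]])
    finally have sum_b: "(\<Sum>n. \<bar>b n\<bar>) \<le> \<bar>h\<bar> * K" .
    have "Lp_sums p M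
      (\<lambda>n w. 1 *\<^sub>R ((1/h) *\<^sub>R (exp (- rate n * (t + h)) *\<^sub>R D n f w) + (- (1/h)) *\<^sub>R (exp (- rate n * t) *\<^sub>R D n f w)) + (-1) *\<^sub>R ((- (rate n * exp (- rate n * t))) *\<^sub>R D n f w))
      (\<lambda>w. 1 *\<^sub>R ((1/h) *\<^sub>R T (t + h) f w + (- (1/h)) *\<^sub>R T t f w) + (-1) *\<^sub>R deriv_T f t w)"
      by (intro Lp_sums_linear p T_sums f th t deriv_T_sums)
    also have "(\<lambda>n w. 1 *\<^sub>R ((1/h) *\<^sub>R (exp (- rate n * (t + h)) *\<^sub>R D n f w) + (- (1/h)) *\<^sub>R (exp (- rate n * t) *\<^sub>R D n f w)) + (-1) *\<^sub>R ((- (rate n * exp (- rate n * t))) *\<^sub>R D n f w))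
      = (\<lambda>n w. b n *\<^sub>R D n f w)"
      by (intro ext) (simp add: b_def diff_divide_distrib scaleR_add_left scaleR_diff_left)
    also have "(\<lambda>w. 1 *\<^sub>R ((1/h) *\<^sub>R T (t + h) f w + (- (1/h)) *\<^sub>R T t f w) + (-1) *\<^sub>R deriv_T f t w)
      = (\<lambda>w. (T (t + h) f w - T t f w) /\<^sub>R h - deriv_T f t w)"
      by (intro ext) (simp add: scaleR_diff_right inverse_eq_divide)
    finally have "Np (\<lambda>w. (T (t + h) f w - T t f w) /\<^sub>R h - deriv_T f t w) \<le> (\<Sum>n. Np (\<lambda>w. b n *\<^sub>R D n f w))"
      by (rule Lp_norm_sums_le[OF p])
    also have "\<dots> \<le> ennreal (\<Sum>n. \<bar>b n\<bar>) * (2 * Np f)"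
      by (rule Lp_sums_multiplier(1)[OF f sb])
    also have "\<dots> \<le> ennreal (\<bar>h\<bar> * K) * (2 * ennreal l)"
      unfolding l(1) by (intro mult_right_mono ennreal_leI sum_b) simp
    also have "\<dots> = ennreal (\<bar>h\<bar> * K * (2 * l))"
      using K0 l(2) by (simp add: ennreal_mult)
    finally show ?thesis .
  qed
  have ev: "\<forall>\<^sub>F h in at 0. Np (\<lambda>w. (T (t + h) f w - T t f w) /\<^sub>R h - deriv_T f t w) \<le> ennreal (\<bar>h\<bar> * K * (2 * l))"
    unfolding eventually_at using t bound by (intro exI[of _ "t/2"]) (auto simp: dist_real_def)
  have "((\<lambda>h. ennreal (\<bar>h\<bar> * K * (2 * l))) \<longlongrightarrow> ennreal (\<bar>0\<bar> * K * (2 * l))) (at 0)"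
    by (intro tendsto_ennrealI tendsto_intros)
  then have lim0: "((\<lambda>h. ennreal (\<bar>h\<bar> * K * (2 * l))) \<longlongrightarrow> 0) (at 0)" by simp
  show ?thesis
    by (rule tendsto_sandwich[OF always_eventually ev tendsto_const lim0]) simp
qed

lemma is_deriv_version_deriv_T: "is_deriv_version p M T f (deriv_T f)"
  unfolding is_deriv_version_def
  using strongly_measurable_deriv_T deriv_T_space difference_quotient_tendsto by blast

text \<open>For each fixed \<open>t\<close> both versions are limits of the same difference
  quotients and agree almost everywhere. The set of agreement is jointly measurable, so Fubini
  exchanges the two quantifiers.\<close>

lemma is_deriv_version_unique:
  assumes v: "is_deriv_version p M T f v"
  shows "AE w in M. AE t in lborel. 0 < t \<longrightarrow> v t w = deriv_T f t w"
proof -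
  let ?N = "restrict_space lborel {0<..} :: real measure"
  have "sigma_finite_measure ?N"
    by (intro sigma_finite_measure_restrict_space sigma_finite_lborel) simp
  then interpret N: sigma_finite_measure ?N .
  interpret pair_sigma_finite ?N M ..
  have eq: "AE w in M. v t w = deriv_T f t w" if t: "0 < t" for t
  proof (rule Lp_limit_unique[OF p at_neq_bot])
    have "\<forall>\<^sub>F h in at (0::real). 0 < t + h"
      using t by (intro order_tendstoD(1)[of _ "t + 0"] tendsto_intros) simp
    then show "\<forall>\<^sub>F h in at 0. strongly_measurable M (\<lambda>w. (T (t + h) f w - T t f w) /\<^sub>R h)"
      by eventually_elim (intro strongly_measurable_scaleR strongly_measurable_diff Lp_spaceD(1)[OF T_space[OF f]] t)
    show "strongly_measurable M (v t)" "((\<lambda>h. Np (\<lambda>w. (T (t + h) f w - T t f w) /\<^sub>R h - v t w)) \<longlongrightarrow> 0) (at 0)"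
      using v t Lp_spaceD(1) unfolding is_deriv_version_def by blast+
    show "strongly_measurable M (deriv_T f t)" by (rule Lp_spaceD(1)[OF deriv_T_space[OF t]])
    show "((\<lambda>h. Np (\<lambda>w. (T (t + h) f w - T t f w) /\<^sub>R h - deriv_T f t w)) \<longlongrightarrow> 0) (at 0)"
      by (rule difference_quotient_tendsto[OF t])
  qed
  have "AE t in ?N. AE w in M. v t w = deriv_T f t w"
    using eq by (subst AE_restrict_space_iff) auto
  moreover have "{z \<in> space (?N \<Otimes>\<^sub>M M). v (fst z) (snd z) = deriv_T f (fst z) (snd z)} \<in> sets (?N \<Otimes>\<^sub>M M)"
  proof -
    have "strongly_measurable (?N \<Otimes>\<^sub>M M) (\<lambda>z. (case z of (t, w) \<Rightarrow> v t w) - (case z of (t, w) \<Rightarrow> deriv_T f t w))"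
      using v strongly_measurable_deriv_T unfolding is_deriv_version_def by (intro strongly_measurable_diff) auto
    from strongly_measurable_norm[OF this]
    have [measurable]: "(\<lambda>z. norm (v (fst z) (snd z) - deriv_T f (fst z) (snd z))) \<in> borel_measurable (?N \<Otimes>\<^sub>M M)"
      by (simp add: case_prod_unfold)
    have "{z \<in> space (?N \<Otimes>\<^sub>M M). norm (v (fst z) (snd z) - deriv_T f (fst z) (snd z)) = 0} \<in> sets (?N \<Otimes>\<^sub>M M)"
      by measurable
    then show ?thesis by simp
  qed
  ultimately have "AE w in M. AE t in ?N. v t w = deriv_T f t w"
    by (subst (asm) AE_commute)
  then show ?thesis by (subst (asm) AE_restrict_space_iff) auto
qed

section \<open>Pointwise comparison of the two square functions\<close>

lemma G_of_deriv_eq: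
  assumes "AE t in lborel. 0 < t \<longrightarrow> v t w = deriv_T f t w" and w: "w \<in> summable_set f"
  shows "G_of_deriv q v w = ennreal_powr (\<integral>\<^sup>+t\<in>{0<..}. ennreal (norm (t *\<^sub>R heat_deriv (\<lambda>n. D (Suc n) f w) t) powr q / t) \<partial>lborel) (1 / q)"
proof -
  have "(\<integral>\<^sup>+t\<in>{0<..}. ennreal (norm (t *\<^sub>R v t w) powr q / t) \<partial>lborel) =
    (\<integral>\<^sup>+t\<in>{0<..}. ennreal (norm (t *\<^sub>R heat_deriv (\<lambda>n. D (Suc n) f w) t) powr q / t) \<partial>lborel)"
    by (rule nn_integral_cong_AE)
      (use assms(1) in \<open>eventually_elim, use w in \<open>auto simp: deriv_T_def indicator_def\<close>\<close>)
  then show ?thesis by (simp add: G_of_deriv_def)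
qed

text \<open>Subtracting \<open>E 1 f\<close> removes exactly the first difference and leaves all
  others, which are those with a positive rate.\<close>

lemma mart_S_eq:
  assumes q: "1 \<le> q"
  shows "AE w in M. mart_S q p M A (\<lambda>y. f y - E 1 f y) w = ennreal_powr (\<Sum>n. ennreal (norm (D (Suc n) f w) powr q)) (1 / q)"
proof -
  have "AE w in M. \<forall>n. D n (\<lambda>y. f y - E 1 f y) w = (if n = 0 then 0 else D n f w)"
    unfolding AE_all_countable
  proof
    fix n
    show "AE w in M. D n (\<lambda>y. f y - E 1 f y) w = (if n = 0 then 0 else D n f w)"
      using D_linear[OF f E_space[OF f, of 1], of n 1 "-1"] D_E[OF f, of n 1] by eventually_elim simp
  qed
  then show ?thesis
  proof eventually_elim
    case (elim w)
    let ?u = "\<lambda>n. ennreal (norm (D n (\<lambda>y. f y - E 1 f y) w) powr q)"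
    have "(\<Sum>n. ?u n) = (\<Sum>n. ?u (n + 1)) + (\<Sum>n<1. ?u n)" by (rule suminf_offset) simp
    then show ?case using elim by (simp add: mart_S_def)
  qed
qed

lemma square_function_bounds:
  assumes q: "1 \<le> q" and v: "is_deriv_version p M T f v"
  shows "AE w in M. ennreal c_univ * mart_S q p M A (\<lambda>y. f y - E 1 f y) w \<le> G_of_deriv q v w \<and>
    G_of_deriv q v w \<le> ennreal C_univ * mart_S q p M A (\<lambda>y. f y - E 1 f y) w"
  using is_deriv_version_unique[OF v] AE_summable_set mart_S_eq[OF q]
proof eventually_elim
  case (elim w)
  let ?x = "\<lambda>n. D (Suc n) f w"
  define S where "S = (\<Sum>n. ennreal (norm (?x n) powr q))"
  define G where "G = (\<integral>\<^sup>+t\<in>{0<..}. ennreal (norm (t *\<^sub>R heat_deriv ?x t) powr q / t) \<partial>lborel)"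
  note sx = summable_setD[OF elim(2)]
  have S: "mart_S q p M A (\<lambda>y. f y - E 1 f y) w = ennreal_powr S (1 / q)"
    using elim(3) by (simp add: S_def)
  have G: "G_of_deriv q v w = ennreal_powr G (1 / q)"
    using G_of_deriv_eq[where v=v and w=w, OF elim(1,2)] by (simp add: G_def)
  \<comment> \<open>Taking q-th roots turns the factors \<open>54 powr q\<close> and
    \<open>4 powr q\<close> into 54 and 4; these fit since 54/100 is at most 1 and 4 is at most
    100.\<close>
  have root: "ennreal_powr a (1 / q) \<le> ennreal k * ennreal_powr b (1 / q)"
    if "a \<le> ennreal (k powr q) * b" "0 \<le> k" for a b k
    using ennreal_powr_mono[OF that(1), of "1 / q"] that(2) q by (simp add: ennreal_powr_mult)
  have c54: "ennreal (c_univ * 54) = ennreal c_univ * ennreal 54"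
    by (rule ennreal_mult') (simp add: c_univ_def)
  have "ennreal_powr S (1 / q) \<le> ennreal 54 * ennreal_powr G (1 / q)"
    using heat_deriv_lower[OF sx q] by (intro root) (simp_all add: S_def G_def)
  then have "ennreal c_univ * ennreal_powr S (1 / q) \<le> ennreal c_univ * (ennreal 54 * ennreal_powr G (1 / q))"
    by (rule mult_left_mono) simp
  also have "\<dots> = ennreal (c_univ * 54) * ennreal_powr G (1 / q)"
    by (simp only: c54 mult.assoc)
  also have "\<dots> \<le> 1 * ennreal_powr G (1 / q)"
    by (intro mult_right_mono) (auto simp: c_univ_def ennreal_le_1)
  finally have lower: "ennreal c_univ * ennreal_powr S (1 / q) \<le> ennreal_powr G (1 / q)" by simp
  have "ennreal_powr G (1 / q) \<le> ennreal 4 * ennreal_powr S (1 / q)"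
    using heat_deriv_upper[OF sx q] by (intro root) (simp_all add: S_def G_def)
  also have "\<dots> \<le> ennreal C_univ * ennreal_powr S (1 / q)"
    by (intro mult_right_mono ennreal_leI) (simp_all add: C_univ_def)
  finally show ?case unfolding S G using lower by blast
qed

end

end

theorem theorem1p6:
  shows "0 < c_univ \<and> 0 < C_univ \<and>
    (\<forall>(p::real) (q::real) (M::'a measure) A.
      1 \<le> p \<longrightarrow> 1 \<le> q \<longrightarrow> prob_space M \<longrightarrow> filtration_generating M A \<longrightarrow>
      (\<exists>a. strict_mono a \<and> a 0 = 0 \<and> a \<longlonglongrightarrow> 1 \<and>
        (let T = (mart_T p M A a :: real \<Rightarrow> ('a \<Rightarrow> 'x::banach) \<Rightarrow> 'a \<Rightarrow> 'x);
             F = mart_E p M A 1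
         in
          (\<forall>t>0. \<forall>f\<in>Lp_space p M.
             Lp_sums p M (\<lambda>n w. (1 - a n) powr t *\<^sub>R mart_dE p M A (Suc n) f w) (T t f) \<and>
             Lp_sums p M (\<lambda>n w. ((1 - a n) powr t - (1 - a (Suc n)) powr t)
                                   *\<^sub>R mart_E p M A (Suc n) f w) (T t f)) \<and>
          contraction_semigroup p M T \<and>
          is_fixed_projection p M T F \<and>
          (\<forall>f\<in>Lp_space p M.
             (\<exists>v. is_deriv_version p M T f v) \<and>
             (\<forall>v. is_deriv_version p M T f v \<longrightarrow>
               (AE w in M.
                  ennreal c_univ * mart_S q p M A (\<lambda>y. f y - F f y) w \<le> G_of_deriv q v w \<and>
                  G_of_deriv q v w \<le> ennreal C_univ * mart_S q p M A (\<lambda>y. f y - F f y) w))))))"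
  unfolding Let_def
\<comment> \<open>One explicit sequence serves all exponents, probability spaces and
  filtrations.\<close>
proof (intro conjI allI impI ballI exI[of _ knot])
  show "0 < c_univ" "0 < C_univ" by (simp_all add: c_univ_def C_univ_def)
  show "strict_mono knot" "knot 0 = 0" "knot \<longlonglongrightarrow> 1"
    using strict_mono_knot knot_limit by (simp_all add: knot_def)
next
  fix p q :: real and M :: "'a measure" and A
  assume pq: "1 \<le> p" "1 \<le> q" and M: "prob_space M" and A: "filtration_generating M A"
  interpret prob_space M by (rule M)
  interpret Lp_filtration M A p by unfold_locales (rule A pq)+
  show "contraction_semigroup p M (T :: real \<Rightarrow> ('a \<Rightarrow> 'x) \<Rightarrow> 'a \<Rightarrow> 'x)"
    by (rule contraction_semigroup_T)
  show "is_fixed_projection p M (T :: real \<Rightarrow> ('a \<Rightarrow> 'x) \<Rightarrow> 'a \<Rightarrow> 'x) (E 1)"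
    by (rule is_fixed_projection_E_1)
  fix f :: "'a \<Rightarrow> 'x" assume f: "f \<in> Lp_space p M"
  show "\<exists>v. is_deriv_version p M T f v" using is_deriv_version_deriv_T[OF f] by blast
  show "AE w in M. ennreal c_univ * mart_S q p M A (\<lambda>y. f y - E 1 f y) w \<le> G_of_deriv q v w \<and>
      G_of_deriv q v w \<le> ennreal C_univ * mart_S q p M A (\<lambda>y. f y - E 1 f y) w"
    if "is_deriv_version p M T f v" for v
    by (rule square_function_bounds[OF f pq(2) that])
  fix t :: real assume t: "0 < t"
  show "Lp_sums p M (\<lambda>n w. (1 - knot n) powr t *\<^sub>R D n f w) (T t f)"
    unfolding knot_powr by (rule T_sums[OF f t])
  show "Lp_sums p M (\<lambda>n w. ((1 - knot n) powr t - (1 - knot (Suc n)) powr t) *\<^sub>R E (Suc n) f w) (T t f)"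
    unfolding knot_powr by (rule T_sums_E[OF f t])
qed

end
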